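(* Let $1<k<n-1$, $X=G(k,n)$, and let $B$ be a complex $n\times n$ matrix not in the degenerate locus. Let $\mathcal E^*=\ker f_B$ be the vector bundle defined by $f_B$, and let $\mathcal E$ be its dual. Then $\mathcal E\cong T_X$ if and only if $B=\varepsilon I$ for some $\varepsilon\in\mathbb C$ with $\varepsilon\ne-\frac1k$.
   Context: $V=\mathbb C^n$, $\mathcal S$ is the tautological subbundle on $X$, $\mathcal V$ the trivial bundle with fibre $V$, $I$ the identity matrix. $f_B:\mathcal V^*\otimes\mathcal S\to\mathcal S^*\otimes\mathcal S$ is the bundle map $f_B(\xi\otimes s)=\xi|_{\mathcal S}\otimes s+\xi(Bs)\,\mathrm{id}_{\mathcal S}$. The degenerate locus is the set of $B$ for which $f_B$ fails to be surjective on the fibre at some point of $X$. *)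

theory Defs
  imports "HOL-Analysis.Analysis" "HOL-Library.Function_Algebras"
begin

section \<open>Complex spaces and holomorphic vector bundles\<close>

text \<open>
  A complex manifold is given by its topology and its structure sheaf of holomorphic functions.
  Functions and sections over an open set are total functions of which only the values on that
  set matter.
\<close>

record 'x cspace =
  topo :: "'x topology"
  hol :: "'x set \<Rightarrow> ('x \<Rightarrow> complex) set"

text \<open>
  A holomorphic vector bundle is given by its fibres (complex vector spaces, with the addition of
  the ambient type and the scalar multiplication \<open>scl\<close>) and by its sheaf of holomorphic
  sections.  A holomorphic structure on a family of vector spaces is determined by this sheaf.
\<close>

record ('x, 'a) hvb =
  fib :: "'x \<Rightarrow> 'a set"
  scl :: "complex \<Rightarrow> 'a \<Rightarrow> 'a"
  sec :: "'x set \<Rightarrow> ('x \<Rightarrow> 'a) set"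

definition trivial_line :: "'x cspace \<Rightarrow> ('x, complex) hvb" where
  "trivial_line X = \<lparr>fib = (\<lambda>x. UNIV), scl = (*), sec = hol X\<rparr>"

definition trivial_bundle :: "'x cspace \<Rightarrow> ('x, complex ^ 'n) hvb" where
  "trivial_bundle X =
     \<lparr>fib = (\<lambda>x. UNIV), scl = (*s), sec = (\<lambda>U. {s. \<forall>i. (\<lambda>x. s x $ i) \<in> hol X U})\<rparr>"

definition subbundle :: "('x, 'a) hvb \<Rightarrow> ('x \<Rightarrow> 'a set) \<Rightarrow> ('x, 'a) hvb" where
  "subbundle E F =
     \<lparr>fib = F, scl = scl E, sec = (\<lambda>U. {s \<in> sec E U. \<forall>x\<in>U. s x \<in> F x})\<rparr>"

definition kernel_bundle ::
    "('x, 'a) hvb \<Rightarrow> ('x \<Rightarrow> 'a \<Rightarrow> 'b::zero) \<Rightarrow> ('x, 'a) hvb" where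
  "kernel_bundle E f = subbundle E (\<lambda>x. {v \<in> fib E x. f x v = 0})"

text \<open>
  The bundle of fibrewise linear maps.  A linear map on \<open>fib E x\<close> is represented by its
  extension by zero.  A section is holomorphic if it maps local holomorphic sections to local
  holomorphic sections.  As fibres are finite-dimensional, this bundle also serves as the tensor
  product of the dual of \<open>E\<close> with \<open>F\<close>, where the pure tensor of
  \<open>\<xi>\<close> and \<open>s\<close> is the map sending \<open>v\<close> to
  \<open>\<xi> v\<close> times \<open>s\<close>.
\<close>

definition hom_bundle ::
    "'x cspace \<Rightarrow> ('x, 'a::ab_group_add) hvb \<Rightarrow> ('x, 'b::ab_group_add) hvb
      \<Rightarrow> ('x, 'a \<Rightarrow> 'b) hvb" where
  "hom_bundle X E F =
     (let H = (\<lambda>x. {\<phi>. (\<forall>v\<in>fib E x. \<phi> v \<in> fib F x) \<and>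
                      (\<forall>v\<in>fib E x. \<forall>w\<in>fib E x. \<phi> (v + w) = \<phi> v + \<phi> w) \<and>
                      (\<forall>c. \<forall>v\<in>fib E x. \<phi> (scl E c v) = scl F c (\<phi> v)) \<and>
                      (\<forall>v. v \<notin> fib E x \<longrightarrow> \<phi> v = 0)})
      in \<lparr>fib = H,
          scl = (\<lambda>c \<phi> v. scl F c (\<phi> v)),
          sec = (\<lambda>U. {\<phi>. (\<forall>x\<in>U. \<phi> x \<in> H x) \<and>
                    (\<forall>W s. openin (topo X) W \<and> W \<subseteq> U \<and> s \<in> sec E W \<and> (\<forall>x\<in>W. s x \<in> fib E x)
                        \<longrightarrow> (\<lambda>x. \<phi> x (s x)) \<in> sec F W)})\<rparr>)"

definition dual_bundle ::
    "'x cspace \<Rightarrow> ('x, 'a::ab_group_add) hvb \<Rightarrow> ('x, 'a \<Rightarrow> complex) hvb" where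
  "dual_bundle X E = hom_bundle X E (trivial_line X)"

text \<open>
  Holomorphic bundle morphisms are the global holomorphic sections of the Hom bundle.
\<close>

definition bundle_iso ::
    "'x cspace \<Rightarrow> ('x, 'a::ab_group_add) hvb \<Rightarrow> ('x, 'b::ab_group_add) hvb \<Rightarrow> bool" where
  "bundle_iso X E F \<longleftrightarrow>
     (\<exists>\<Phi> \<Psi>. \<Phi> \<in> sec (hom_bundle X E F) (topspace (topo X)) \<and>
            \<Psi> \<in> sec (hom_bundle X F E) (topspace (topo X)) \<and>
            (\<forall>x\<in>topspace (topo X). (\<forall>v\<in>fib E x. \<Psi> x (\<Phi> x v) = v) \<and>
                                   (\<forall>w\<in>fib F x. \<Phi> x (\<Psi> x w) = w)))"

text \<open>Functions holomorphic on some neighbourhood of a point.\<close>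

definition hol_near :: "'x cspace \<Rightarrow> 'x \<Rightarrow> ('x \<Rightarrow> complex) set" where
  "hol_near X x = {f. \<exists>U. openin (topo X) U \<and> x \<in> U \<and> f \<in> hol X U}"

text \<open>
  The holomorphic tangent space at a point: the \<open>\<complex>\<close>-linear derivations of the algebra of germs
  of holomorphic functions at the point.  A derivation is represented as a functional on
  functions depending only on the germ, extended by zero to functions that are not
  holomorphic near the point.
\<close>

definition tangent_space :: "'x cspace \<Rightarrow> 'x \<Rightarrow> (('x \<Rightarrow> complex) \<Rightarrow> complex) set" where
  "tangent_space X x = {D.
     (\<forall>f\<in>hol_near X x. \<forall>g\<in>hol_near X x. D (\<lambda>y. f y + g y) = D f + D g) \<and>
     (\<forall>c. \<forall>f\<in>hol_near X x. D (\<lambda>y. c * f y) = c * D f) \<and>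
     (\<forall>f\<in>hol_near X x. \<forall>g\<in>hol_near X x. D (\<lambda>y. f y * g y) = f x * D g + g x * D f) \<and>
     (\<forall>f\<in>hol_near X x. \<forall>g\<in>hol_near X x.
        (\<exists>U. openin (topo X) U \<and> x \<in> U \<and> (\<forall>y\<in>U. f y = g y)) \<longrightarrow> D f = D g) \<and>
     (\<forall>f. f \<notin> hol_near X x \<longrightarrow> D f = 0)}"

text \<open>
  A vector field is holomorphic if it maps local holomorphic functions to holomorphic functions.
\<close>

definition tangent_bundle :: "'x cspace \<Rightarrow> ('x, ('x \<Rightarrow> complex) \<Rightarrow> complex) hvb" where
  "tangent_bundle X =
     \<lparr>fib = tangent_space X,
      scl = (\<lambda>c D f. c * D f),
      sec = (\<lambda>U. {\<xi>. (\<forall>x\<in>U. \<xi> x \<in> tangent_space X x) \<and>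
                (\<forall>W f. openin (topo X) W \<and> W \<subseteq> U \<and> f \<in> hol X W
                    \<longrightarrow> (\<lambda>x. \<xi> x f) \<in> hol X W)})\<rparr>"


section \<open>The Grassmannian\<close>

definition grass :: "nat \<Rightarrow> (complex ^ 'n) set set" where
  "grass k = {S. vec.subspace S \<and> vec.dim S = k}"

text \<open>
  Holomorphic functions on an open set of matrices: Frechet differentiable with
  complex-linear derivative.
\<close>

definition matrix_holomorphic_on ::
    "(complex ^ 'n ^ 'n \<Rightarrow> complex) \<Rightarrow> (complex ^ 'n ^ 'n) set \<Rightarrow> bool" where
  "matrix_holomorphic_on f G \<longleftrightarrow>
     (\<forall>g\<in>G. \<exists>f'. (f has_derivative f') (at g) \<and> (\<forall>c A. f' (mat c ** A) = c * f' A))"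

text \<open>
  The Grassmannian carries the quotient topology and the quotient complex structure with respect
  to the orbit maps sending \<open>g\<close> to \<open>g ` S\<close> of the action of the general linear group,
  i.e. it is the homogeneous space of that group by the stabiliser of \<open>S\<close>.
\<close>

definition orbit_preimage :: "(complex ^ 'n) set \<Rightarrow> (complex ^ 'n) set set \<Rightarrow> (complex ^ 'n ^ 'n) set"
  where "orbit_preimage S U = {g. invertible g \<and> (*v) g ` S \<in> U}"

definition grass_topology :: "nat \<Rightarrow> (complex ^ 'n) set topology" where
  "grass_topology k =
     topology (\<lambda>U. U \<subseteq> grass k \<and> (\<forall>S\<in>grass k. open (orbit_preimage S U)))"

definition Gr :: "nat \<Rightarrow> (complex ^ 'n) set cspace" where
  "Gr k =
     \<lparr>topo = grass_topology k,
      hol = (\<lambda>U. {f. \<forall>S\<in>grass k.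
                matrix_holomorphic_on (\<lambda>g. f ((*v) g ` S)) (orbit_preimage S U)})\<rparr>"

lemma openin_grass_topology:
  fixes U :: "(complex ^ 'n) set set"
  shows "openin (grass_topology k) U \<longleftrightarrow> U \<subseteq> grass k \<and> (\<forall>S\<in>grass k. open (orbit_preimage S U))"
proof -
  have "istopology (\<lambda>U :: (complex ^ 'n) set set. U \<subseteq> grass k \<and> (\<forall>S\<in>grass k. open (orbit_preimage S U)))"
    unfolding istopology_def
  proof (intro conjI allI impI ballI)
    fix U V :: "(complex ^ 'n) set set" and S :: "(complex ^ 'n) set"
    assume "U \<subseteq> grass k \<and> (\<forall>S\<in>grass k. open (orbit_preimage S U))"
      "V \<subseteq> grass k \<and> (\<forall>S\<in>grass k. open (orbit_preimage S V))" "S \<in> grass k"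
    moreover have "orbit_preimage S (U \<inter> V) = orbit_preimage S U \<inter> orbit_preimage S V"
      by (auto simp: orbit_preimage_def)
    ultimately show "open (orbit_preimage S (U \<inter> V))" by auto
  next
    fix \<K> :: "(complex ^ 'n) set set set" and S :: "(complex ^ 'n) set"
    assume "\<forall>U\<in>\<K>. U \<subseteq> grass k \<and> (\<forall>S\<in>grass k. open (orbit_preimage S U))" "S \<in> grass k"
    moreover have "orbit_preimage S (\<Union>\<K>) = (\<Union>U\<in>\<K>. orbit_preimage S U)"
      by (auto simp: orbit_preimage_def)
    ultimately show "open (orbit_preimage S (\<Union>\<K>))" by auto
  qed auto
  thus ?thesis by (simp add: grass_topology_def topology_inverse')
qed

lemma image_mem_grass:
  assumes "invertible g" "S \<in> grass k"
  shows "(*v) g ` S \<in> grass k"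
proof -
  have l: "Vector_Spaces.linear (*s) (*s) ((*v) g)"
    by (rule matrix_vector_mul_linear_gen)
  have inj: "inj ((*v) g)"
    using assms(1) by (metis inj_matrix_vector_mult)
  have "vec.dim ((*v) g ` S) = vec.dim S"
    by (rule vec.dim_image_eq[OF l]) (use inj in \<open>auto intro: inj_on_subset\<close>)
  moreover have "vec.subspace ((*v) g ` S)"
    using vec.linear_subspace_image[OF l] assms(2) by (simp add: grass_def)
  ultimately show ?thesis using assms(2) by (simp add: grass_def)
qed

lemma topspace_Gr: "topspace (topo (Gr k)) = (grass k :: (complex ^ 'n) set set)"
proof -
  have "open {g :: complex ^ 'n ^ 'n. invertible g}"
  proof -
    have "continuous_on UNIV (det :: complex ^ 'n ^ 'n \<Rightarrow> complex)"
      unfolding det_def by (intro continuous_intros)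
    hence "open (det -` (- {0}) :: (complex ^ 'n ^ 'n) set)"
      by (intro open_vimage) auto
    moreover have "{g :: complex ^ 'n ^ 'n. invertible g} = det -` (- {0})"
      by (auto simp: invertible_det_nz)
    ultimately show ?thesis by simp
  qed
  moreover have "orbit_preimage S (grass k) = {g. invertible g}"
    if "S \<in> grass k" for S :: "(complex ^ 'n) set"
    using that image_mem_grass by (auto simp: orbit_preimage_def)
  ultimately have "openin (grass_topology k) (grass k :: (complex ^ 'n) set set)"
    by (simp add: openin_grass_topology)
  moreover have "topspace (grass_topology k) \<subseteq> (grass k :: (complex ^ 'n) set set)"
    using openin_grass_topology openin_topspace by blast
  ultimately show ?thesis by (auto simp: Gr_def dest: openin_subset)
qed

definition tautological :: "nat \<Rightarrow> ((complex ^ 'n) set, complex ^ 'n) hvb" where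
  "tautological k = subbundle (trivial_bundle (Gr k)) (\<lambda>S. S)"


section \<open>The bundle map and its kernel\<close>

definition VS_bundle :: "nat \<Rightarrow> ((complex ^ 'n) set, complex ^ 'n \<Rightarrow> complex ^ 'n) hvb" where
  "VS_bundle k = hom_bundle (Gr k) (trivial_bundle (Gr k)) (tautological k)"

definition SS_bundle :: "nat \<Rightarrow> ((complex ^ 'n) set, complex ^ 'n \<Rightarrow> complex ^ 'n) hvb" where
  "SS_bundle k = hom_bundle (Gr k) (tautological k) (tautological k)"

text \<open>
  The value at a pure tensor, as an endomorphism of \<open>S\<close> (extended by zero), and the linear
  extension, obtained by writing \<open>\<phi>\<close> as the sum over the coordinate functionals
  tensored with the images of the standard basis vectors.
\<close>

definition f_pure ::
    "complex ^ 'n ^ 'n \<Rightarrow> (complex ^ 'n) set \<Rightarrow> (complex ^ 'n \<Rightarrow> complex) \<Rightarrow> complex ^ 'n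
      \<Rightarrow> (complex ^ 'n \<Rightarrow> complex ^ 'n)" where
  "f_pure B S \<xi> s = (\<lambda>t. if t \<in> S then \<xi> t *s s + \<xi> (B *v s) *s t else 0)"

definition f_map ::
    "complex ^ 'n ^ 'n \<Rightarrow> (complex ^ 'n) set \<Rightarrow> (complex ^ 'n \<Rightarrow> complex ^ 'n)
      \<Rightarrow> (complex ^ 'n \<Rightarrow> complex ^ 'n)" where
  "f_map B S \<phi> = (\<Sum>i\<in>UNIV. f_pure B S (\<lambda>v. v $ i) (\<phi> (axis i 1)))"

lemma sum_fun_apply: "(\<Sum>i\<in>I. (f i :: 'a \<Rightarrow> 'b::comm_monoid_add)) x = (\<Sum>i\<in>I. f i x)"
  by (induction I rule: infinite_finite_induct) auto

lemma f_map_pure: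
  fixes \<xi> :: "complex ^ 'n \<Rightarrow> complex"
  assumes "Vector_Spaces.linear (*s) (*) \<xi>"
  shows "f_map B S (\<lambda>v. \<xi> v *s s) = f_pure B S \<xi> s"
proof
  fix t :: "complex ^ 'n"
  have hom: "\<xi> (c *s v) = c * \<xi> v" for c v
    using assms by (simp add: Vector_Spaces.linear_iff)
  interpret vs: Vector_Spaces.linear "(*s)" "(*)" \<xi> by (rule assms)
  have expand: "\<xi> v = (\<Sum>i\<in>UNIV. v $ i * \<xi> (axis i 1))" for v
  proof -
    have "\<xi> v = \<xi> (\<Sum>i\<in>UNIV. v $ i *s axis i 1)"
      by (simp only: basis_expansion)
    thus ?thesis by (simp add: vs.sum hom)
  qed
  have "(\<Sum>i\<in>UNIV. (t $ i * \<xi> (axis i 1)) *s s + ((B *v s) $ i * \<xi> (axis i 1)) *s t)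
      = \<xi> t *s s + \<xi> (B *v s) *s t"
    by (simp only: expand[of t] expand[of "B *v s"] sum.distrib vec.scale_sum_left)
  moreover have "B *v (c *s s) = c *s (B *v s)" for c
    by (rule vec.linear_scale[OF matrix_vector_mul_linear_gen])
  ultimately show "f_map B S (\<lambda>v. \<xi> v *s s) t = f_pure B S \<xi> s t"
    by (simp add: f_map_def f_pure_def sum_fun_apply mult.commute)
qed

lemma f_map_in_SS_bundle:
  assumes "S \<in> grass k" "\<phi> \<in> fib (VS_bundle k) S"
  shows "f_map B S \<phi> \<in> fib (SS_bundle k) S"
proof -
  have S: "vec.subspace S" using assms(1) by (simp add: grass_def)
  have \<phi>: "\<phi> v \<in> S" for v
    using assms(2) by (simp add: VS_bundle_def hom_bundle_def Let_def trivial_bundle_def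
        tautological_def subbundle_def)
  have pure: "f_pure B S \<xi> s t \<in> S" if "s \<in> S" for \<xi> s t
    using that S by (auto simp: f_pure_def vec.subspace_def)
  have "f_map B S \<phi> t \<in> S" for t
    by (auto simp: f_map_def sum_fun_apply intro!: vec.subspace_sum[OF S] pure \<phi>)
  moreover have "f_map B S \<phi> (v + w) = f_map B S \<phi> v + f_map B S \<phi> w"
    if "v \<in> S" "w \<in> S" for v w
  proof -
    have "v + w \<in> S" using that S by (rule_tac vec.subspace_add)
    thus ?thesis using that
      by (simp add: f_map_def sum_fun_apply f_pure_def sum.distrib[symmetric] algebra_simps)
  qed
  moreover have "f_map B S \<phi> (c *s v) = c *s f_map B S \<phi> v" if "v \<in> S" for c v
  proof -
    have "c *s v \<in> S" using that S by (rule_tac vec.subspace_scale)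
    thus ?thesis using that
      by (simp add: f_map_def sum_fun_apply f_pure_def vec.scale_sum_right algebra_simps)
  qed
  moreover have "f_map B S \<phi> v = 0" if "v \<notin> S" for v
    using that by (simp add: f_map_def sum_fun_apply f_pure_def)
  ultimately show ?thesis
    by (simp add: SS_bundle_def hom_bundle_def Let_def trivial_bundle_def tautological_def
        subbundle_def)
qed

text \<open>Non-surjectivity on some fibre.\<close>

definition degenerate_locus :: "nat \<Rightarrow> (complex ^ 'n ^ 'n) set" where
  "degenerate_locus k =
     {B. \<exists>S\<in>grass k. f_map B S ` fib (VS_bundle k) S \<noteq> fib (SS_bundle k) S}"

definition E_dual ::
    "nat \<Rightarrow> complex ^ 'n ^ 'n \<Rightarrow> ((complex ^ 'n) set, complex ^ 'n \<Rightarrow> complex ^ 'n) hvb" where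
  "E_dual k B = kernel_bundle (VS_bundle k) (f_map B)"

definition E_bundle ::
    "nat \<Rightarrow> complex ^ 'n ^ 'n
      \<Rightarrow> ((complex ^ 'n) set, (complex ^ 'n \<Rightarrow> complex ^ 'n) \<Rightarrow> complex) hvb" where
  "E_bundle k B = dual_bundle (Gr k) (E_dual k B)"

end

theory Submission
  imports Defs "HOL-Complex_Analysis.Cauchy_Integral_Formula"
begin

text \<open>
  In matrix terms the fibre of the kernel bundle at \<open>S\<close> consists of the \<open>M\<close> with range in \<open>S\<close> and
  \<open>M t = - tr (B M) t\<close> on \<open>S\<close>.  If \<open>B\<close> is a nondegenerate scalar or \<open>0\<close>, these are the \<open>M\<close> that
  vanish on \<open>S\<close>; their dual is the tangent space, the functional \<open>M \<mapsto> tr (M A)\<close> corresponding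
  to the derivation \<open>d/dt f (exp (t A) S)\<close>.

  Conversely, let the bundle at \<open>B\<close> be isomorphic to the tangent bundle, hence to the bundle at \<open>0\<close>.
  An isomorphism turns \<open>\<xi> \<otimes> s\<close>, with \<open>s \<in> S\<close> and \<open>\<xi>\<close> vanishing on \<open>S\<close>, into an element of the
  kernel at \<open>B\<close>.  By the theorem of Liouville this element does not change if \<open>S\<close> moves on a
  projective line of subspaces that contain \<open>s\<close> and lie in the kernel of \<open>\<xi>\<close>, so its range lies in the
  intersection of these subspaces, the span of \<open>s\<close>.  A map of rank one that is a multiple of the
  identity on \<open>S\<close> vanishes on \<open>S\<close>, as \<open>k > 1\<close>.  Thus all elements of the kernel at \<open>B\<close> vanish on \<open>S\<close>,
  which forces \<open>B S \<subseteq> S\<close>; this holds for all \<open>S\<close>, so \<open>B\<close> is a scalar.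
\<close>

text \<open>Two obstacles shape the proof. Tangent vectors are abstract derivations of germs, so
  labelling them by matrices requires writing \<open>f T - f S\<close> as a combination of chart
  coordinates vanishing at \<open>S\<close> with holomorphic coefficients. Holomorphy as defined
  here only gives a derivative at each point, so the regularity of that derivative must first be
  drawn from the Cauchy integral formula. Secondly, the given isomorphism relates the dual bundles.
  It is not dualised as a bundle map but applied to the global sections
  \<open>trace_form k B A\<close>, one for each constant matrix \<open>A\<close>. The value of the
  image on a fixed pure tensor is linear in \<open>A\<close>, hence equal to
  \<open>trace (M ** A)\<close> for a unique \<open>M\<close>; this \<open>M\<close> is the element
  of the kernel at \<open>B\<close>. That the sections are global is what allows Liouville to be
  applied on a whole projective line. The bound \<open>k < n - 1\<close> provides the second
  subspace: the kernel of a functional has dimension at least \<open>n - 1\<close>, so it is larger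
  than \<open>S\<close>. The exceptional scalar \<open>- 1 / k\<close> reflects that the identity of
  \<open>S\<close> has trace \<open>k\<close>.\<close>

section \<open>Complex scalars and unit matrices\<close>

lemma mat_mult_nth [simp]:
  fixes A :: "complex ^ 'n ^ 'n"
  shows "(mat c ** A) $ i $ j = c * A $ i $ j"
proof -
  have "(mat c ** A) $ i $ j = (\<Sum>k\<in>UNIV. (if i = k then c * A $ k $ j else 0))"
    unfolding matrix_matrix_mult_def mat_def by (simp add: if_distrib if_distribR cong: if_cong)
  thus ?thesis by simp
qed

lemma mat_mult_vec [simp]: "mat c *v x = c *s (x :: complex ^ 'n)"
proof -
  have "(mat c *v x) $ i = (\<Sum>k\<in>UNIV. (if i = k then c * x $ k else 0))" for i
    unfolding matrix_vector_mult_def mat_def by (simp add: if_distrib if_distribR cong: if_cong)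
  thus ?thesis by (simp add: vec_eq_iff)
qed

lemma scaleR_eq_mat: "r *\<^sub>R A = mat (complex_of_real r) ** (A :: complex ^ 'n ^ 'n)"
  unfolding vec_eq_iff vector_scaleR_component mat_mult_nth by (simp add: scaleR_conv_of_real)

definition unit_mat :: "'n \<Rightarrow> 'n \<Rightarrow> complex ^ 'n ^ 'n" where
  "unit_mat i j = axis i (axis j 1)"

lemma unit_mat_nth: "unit_mat i j $ k $ l = (if k = i \<and> l = j then 1 else 0)"
  by (simp add: unit_mat_def axis_def)

lemma matrix_expansion:
  fixes A :: "complex ^ 'n ^ 'n"
  shows "A = (\<Sum>i\<in>UNIV. \<Sum>j\<in>UNIV. mat (A $ i $ j) ** unit_mat i j)"
proof -
  have "(\<Sum>i\<in>UNIV. \<Sum>j\<in>UNIV. mat (A $ i $ j) ** unit_mat i j) $ k $ l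
      = (\<Sum>i\<in>UNIV. \<Sum>j\<in>UNIV. if i = k then (if j = l then A $ i $ j else 0) else 0)" for k l
    by (auto simp: unit_mat_nth intro!: sum.cong)
  also have "\<dots> k l = (\<Sum>i\<in>UNIV. if i = k then A $ i $ l else 0)" for k l
    by (intro sum.cong) (auto simp: sum.delta)
  finally show ?thesis by (simp add: vec_eq_iff)
qed

section \<open>Complex differentiable functions of a matrix\<close>

text \<open>The pointwise form of \<open>matrix_holomorphic_on\<close>, so that the differentiation
  rules need no ambient open set. A Frechet derivative is only real-linear; compatibility with
  \<open>mat c\<close> expresses the Cauchy-Riemann equations.\<close>

definition cdiff :: "(complex ^ 'n ^ 'n \<Rightarrow> complex) \<Rightarrow> complex ^ 'n ^ 'n \<Rightarrow> bool" where
  "cdiff f g \<longleftrightarrow> (\<exists>f'. (f has_derivative f') (at g) \<and> (\<forall>c A. f' (mat c ** A) = c * f' A))"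

abbreviation dird ::
    "(complex ^ 'n ^ 'n \<Rightarrow> complex) \<Rightarrow> complex ^ 'n ^ 'n \<Rightarrow> complex ^ 'n ^ 'n \<Rightarrow> complex" where
  "dird f g \<equiv> frechet_derivative f (at g)"

lemma matrix_holomorphic_on_iff: "matrix_holomorphic_on f G \<longleftrightarrow> (\<forall>g\<in>G. cdiff f g)"
  by (simp add: matrix_holomorphic_on_def cdiff_def)

lemma cdiffI:
  assumes "(f has_derivative f') (at g)" "\<And>c A. f' (mat c ** A) = c * f' A"
  shows "cdiff f g"
  using assms by (auto simp: cdiff_def)

lemma cdiff_has_derivative: "cdiff f g \<Longrightarrow> (f has_derivative dird f g) (at g)"
  by (auto simp: cdiff_def frechet_derivative_works[symmetric] differentiable_def)

lemma dird_unique: "(f has_derivative f') (at g) \<Longrightarrow> dird f g = f'"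
  using frechet_derivative_at[of f f' g] by (rule sym)

lemma dird_mat: "cdiff f g \<Longrightarrow> dird f g (mat c ** A) = c * dird f g A"
  by (auto simp: cdiff_def dest: dird_unique)

lemma dird_linear: "cdiff f g \<Longrightarrow> linear (dird f g)"
  by (rule bounded_linear.linear, rule has_derivative_bounded_linear, rule cdiff_has_derivative)

lemma dird_expansion:
  assumes "cdiff f g"
  shows "dird f g A = (\<Sum>i\<in>UNIV. \<Sum>j\<in>UNIV. A $ i $ j * dird f g (unit_mat i j))"
proof -
  have "dird f g A = dird f g (\<Sum>i\<in>UNIV. \<Sum>j\<in>UNIV. mat (A $ i $ j) ** unit_mat i j)"
    using matrix_expansion[of A] by simp
  also have "\<dots> = (\<Sum>i\<in>UNIV. \<Sum>j\<in>UNIV. A $ i $ j * dird f g (unit_mat i j))"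
    by (simp add: linear_sum[OF dird_linear[OF assms]] dird_mat[OF assms])
  finally show ?thesis .
qed

lemma cdiff_const [simp]: "cdiff (\<lambda>_. c) g"
  by (rule cdiffI[OF has_derivative_const]) simp

lemma dird_const [simp]: "dird (\<lambda>_. c) g A = 0"
  by (simp add: dird_unique[OF has_derivative_const])

lemma has_derivative_nth:
  "((\<lambda>g :: complex ^ 'n ^ 'n. g $ i $ j) has_derivative (\<lambda>A. A $ i $ j)) (at g)"
  by (rule bounded_linear_imp_has_derivative)
    (rule bounded_linear_compose[OF bounded_linear_vec_nth bounded_linear_vec_nth])

lemma cdiff_nth [simp]: "cdiff (\<lambda>g. g $ i $ j) g"
  by (rule cdiffI[OF has_derivative_nth]) simp

lemma dird_nth [simp]: "dird (\<lambda>g. g $ i $ j) g A = A $ i $ j"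
  by (simp add: dird_unique[OF has_derivative_nth])

lemma
  assumes "cdiff f g" "cdiff h g"
  shows cdiff_add: "cdiff (\<lambda>x. f x + h x) g"
    and dird_add: "dird (\<lambda>x. f x + h x) g A = dird f g A + dird h g A"
proof -
  have d: "((\<lambda>x. f x + h x) has_derivative (\<lambda>A. dird f g A + dird h g A)) (at g)"
    by (intro has_derivative_add cdiff_has_derivative assms)
  show "cdiff (\<lambda>x. f x + h x) g"
    by (rule cdiffI[OF d]) (simp add: dird_mat assms algebra_simps)
  show "dird (\<lambda>x. f x + h x) g A = dird f g A + dird h g A"
    by (simp add: dird_unique[OF d])
qed

lemma
  assumes "cdiff f g" "cdiff h g"
  shows cdiff_mult: "cdiff (\<lambda>x. f x * h x) g"
    and dird_mult: "dird (\<lambda>x. f x * h x) g A = f g * dird h g A + h g * dird f g A"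
proof -
  have d: "((\<lambda>x. f x * h x) has_derivative (\<lambda>A. f g * dird h g A + dird f g A * h g)) (at g)"
    by (intro has_derivative_mult cdiff_has_derivative assms)
  show "cdiff (\<lambda>x. f x * h x) g"
    by (rule cdiffI[OF d]) (simp add: dird_mat assms algebra_simps)
  show "dird (\<lambda>x. f x * h x) g A = f g * dird h g A + h g * dird f g A"
    by (simp add: dird_unique[OF d] mult.commute)
qed

lemma cdiff_minus: "cdiff f g \<Longrightarrow> cdiff h g \<Longrightarrow> cdiff (\<lambda>x. f x - h x) g"
  using cdiff_add[OF _ cdiff_mult[OF cdiff_const], of f g h "-1"] by simp

lemma cdiff_inverse:
  assumes "cdiff f g" "f g \<noteq> 0"
  shows "cdiff (\<lambda>x. inverse (f x)) g"
proof -
  have d: "((\<lambda>x. inverse (f x)) has_derivative (\<lambda>A. - (inverse (f g) * dird f g A * inverse (f g)))) (at g)"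
    by (intro Deriv.has_derivative_inverse cdiff_has_derivative assms)
  show ?thesis by (rule cdiffI[OF d]) (simp add: dird_mat assms)
qed

lemma cdiff_divide: "cdiff f g \<Longrightarrow> cdiff h g \<Longrightarrow> h g \<noteq> 0 \<Longrightarrow> cdiff (\<lambda>x. f x / h x) g"
  unfolding divide_inverse by (intro cdiff_mult cdiff_inverse)

lemma
  assumes "\<And>i. i \<in> I \<Longrightarrow> cdiff (f i) g"
  shows cdiff_sum: "cdiff (\<lambda>x. \<Sum>i\<in>I. f i x) g"
    and dird_sum: "dird (\<lambda>x. \<Sum>i\<in>I. f i x) g A = (\<Sum>i\<in>I. dird (f i) g A)"
proof -
  have "cdiff (\<lambda>x. \<Sum>i\<in>I. f i x) g \<and> dird (\<lambda>x. \<Sum>i\<in>I. f i x) g A = (\<Sum>i\<in>I. dird (f i) g A)"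
    using assms by (induction I rule: infinite_finite_induct) (auto simp: cdiff_add dird_add)
  thus "cdiff (\<lambda>x. \<Sum>i\<in>I. f i x) g"
      "dird (\<lambda>x. \<Sum>i\<in>I. f i x) g A = (\<Sum>i\<in>I. dird (f i) g A)" by auto
qed

lemma cdiff_prod: "(\<And>i. i \<in> I \<Longrightarrow> cdiff (f i) g) \<Longrightarrow> cdiff (\<lambda>x. \<Prod>i\<in>I. f i x) g"
  by (induction I rule: infinite_finite_induct) (auto simp: cdiff_mult)

lemma cdiff_det:
  fixes N :: "complex ^ 'm ^ 'm \<Rightarrow> complex ^ 'n ^ 'n"
  shows "(\<And>i j. cdiff (\<lambda>x. N x $ i $ j) g) \<Longrightarrow> cdiff (\<lambda>x. det (N x)) g"
  unfolding det_def by (intro cdiff_sum cdiff_mult cdiff_prod cdiff_const)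

lemma cdiff_matrix_mult:
  fixes M N :: "complex ^ 'm ^ 'm \<Rightarrow> complex ^ 'n ^ 'n"
  shows "(\<And>i j. cdiff (\<lambda>x. M x $ i $ j) g) \<Longrightarrow> (\<And>i j. cdiff (\<lambda>x. N x $ i $ j) g)
      \<Longrightarrow> cdiff (\<lambda>x. (M x ** N x) $ i $ j) g"
  unfolding matrix_matrix_mult_def by (simp, intro cdiff_sum cdiff_mult)

lemma cdiff_cong_open:
  assumes "open U" "g \<in> U" "\<And>x. x \<in> U \<Longrightarrow> f x = h x"
  shows "cdiff f g \<longleftrightarrow> cdiff h g" and "cdiff f g \<Longrightarrow> dird f g = dird h g"
proof -
  have fh: "(h has_derivative f') (at g)" if "(f has_derivative f') (at g)" for f'
    by (rule has_derivative_transform_within_open[OF that assms])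
  have hf: "(f has_derivative f') (at g)" if "(h has_derivative f') (at g)" for f'
    by (rule has_derivative_transform_within_open[OF that assms(1,2)]) (simp add: assms(3))
  show "cdiff f g \<longleftrightarrow> cdiff h g" unfolding cdiff_def using fh hf by blast
  show "dird f g = dird h g" if "cdiff f g"
    by (rule dird_unique[OF fh[OF cdiff_has_derivative[OF that]], symmetric])
qed

lemma cdiff_imp_continuous: "cdiff f g \<Longrightarrow> isCont f g"
  using cdiff_has_derivative has_derivative_continuous by blast

lemma has_derivative_matrix:
  fixes N :: "'a::real_normed_vector \<Rightarrow> complex ^ 'n ^ 'n"
  assumes "\<And>i j. ((\<lambda>x. N x $ i $ j) has_derivative (\<lambda>A. N' A $ i $ j)) (at g)"
  shows "(N has_derivative N') (at g)"
proof (subst has_derivative_componentwise_within, intro ballI)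
  fix b :: "complex ^ 'n ^ 'n" assume "b \<in> Basis"
  then obtain i j u where b: "b = axis i (axis j u)" by (auto simp: Basis_vec_def)
  show "((\<lambda>x. N x \<bullet> b) has_derivative (\<lambda>x. N' x \<bullet> b)) (at g)"
    unfolding b inner_axis by (intro has_derivative_inner_left assms)
qed

lemma
  fixes N :: "complex ^ 'm ^ 'm \<Rightarrow> complex ^ 'n ^ 'n"
  assumes N: "\<And>i j. cdiff (\<lambda>x. N x $ i $ j) g" and F: "cdiff F (N g)"
  shows cdiff_compose: "cdiff (\<lambda>x. F (N x)) g"
    and dird_compose: "dird (\<lambda>x. F (N x)) g A = dird F (N g) (\<chi> i j. dird (\<lambda>x. N x $ i $ j) g A)"
proof -
  let ?N = "\<lambda>A. \<chi> i j. dird (\<lambda>x. N x $ i $ j) g A"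
  have "(N has_derivative ?N) (at g)"
    by (rule has_derivative_matrix) (simp add: cdiff_has_derivative N)
  hence d: "((\<lambda>x. F (N x)) has_derivative (\<lambda>A. dird F (N g) (?N A))) (at g)"
    using has_derivative_compose[of N ?N g UNIV F] cdiff_has_derivative[OF F] by simp
  have "?N (mat c ** A) = mat c ** ?N A" for c A
    by (simp add: vec_eq_iff dird_mat[OF N])
  thus "cdiff (\<lambda>x. F (N x)) g"
    by (intro cdiffI[OF d]) (simp add: dird_mat[OF F])
  show "dird (\<lambda>x. F (N x)) g A = dird F (N g) (?N A)"
    by (simp add: dird_unique[OF d])
qed

text \<open>Restriction to complex lines gives access to the Cauchy theory of one variable.\<close>

lemma cdiff_line:
  assumes "cdiff F (x + mat z ** v)"
  shows "((\<lambda>z. F (x + mat z ** v)) has_field_derivative dird F (x + mat z ** v) v) (at z)"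
proof -
  have "((\<lambda>z. x + mat z ** v) has_derivative (\<lambda>z. mat z ** v)) (at z)"
    by (rule has_derivative_matrix) (auto intro!: derivative_eq_intros)
  from has_derivative_compose[OF this, of F "dird F (x + mat z ** v)"] cdiff_has_derivative[OF assms]
  have "((\<lambda>z. F (x + mat z ** v)) has_derivative (\<lambda>z'. dird F (x + mat z ** v) (mat z' ** v))) (at z)"
    by simp
  thus ?thesis
    by (simp add: has_field_derivative_def dird_mat[OF assms] mult.commute[of _ "dird _ _ v"]
        )
qed

section \<open>Cauchy integrals and the regularity of derivatives\<close>

lemma norm_mat_mult: "norm (mat c ** (A :: complex ^ 'n ^ 'n)) = norm c * norm A"
  by (simp add: norm_vec_def norm_mult L2_set_right_distrib)

lemma continuous_on_cdiff: "(\<And>x. x \<in> G \<Longrightarrow> cdiff F x) \<Longrightarrow> continuous_on G F"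
  by (intro continuous_at_imp_continuous_on ballI cdiff_imp_continuous)

text \<open>Differentiation under the integral sign, for an argument affine in \<open>x\<close> with
  real slope. This shape covers both uses: the Cauchy kernel, where \<open>m\<close> is 1 and
  \<open>q\<close> runs through a circle, and the average over a segment, where
  \<open>m t = t\<close> and \<open>q t\<close> is a multiple of the base point.\<close>

lemma cdiff_integral:
  fixes F :: "complex ^ 'n ^ 'n \<Rightarrow> complex"
    and m :: "real \<Rightarrow> real" and q :: "real \<Rightarrow> complex ^ 'n ^ 'n"
  assumes F: "\<And>x. x \<in> G \<Longrightarrow> cdiff F x" "\<And>v. continuous_on G (\<lambda>x. dird F x v)"
    and c: "continuous_on {0..1} c" and m: "continuous_on {0..1} m" and q: "continuous_on {0..1} q"
    and U: "open U" "convex U" "\<And>x t. x \<in> U \<Longrightarrow> t \<in> {0..1} \<Longrightarrow> m t *\<^sub>R x + q t \<in> G"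
    and x0: "x0 \<in> U"
  shows "cdiff (\<lambda>x. integral {0..1} (\<lambda>t. c t * F (m t *\<^sub>R x + q t))) x0"
proof -
  let ?p = "\<lambda>x t. m t *\<^sub>R x + q t"
  define D where "D = (\<lambda>x t A. c t * (of_real (m t) * dird F (?p x t) A))"
  have bl: "bounded_linear (D x t)" if "x \<in> U" "t \<in> {0..1}" for x t
    unfolding D_def
    by (intro bounded_linear_const_mult has_derivative_bounded_linear[OF cdiff_has_derivative]
        F U that)
  have D_apply: "blinfun_apply (Blinfun (D x t)) = D x t" if "x \<in> U" "t \<in> {0..1}" for x t
    by (rule bounded_linear_Blinfun_apply[OF bl[OF that]])
  have contp: "continuous_on (U \<times> {0..1}) (\<lambda>(x, t). ?p x t)"
    unfolding case_prod_beta
    by (intro continuous_intros continuous_on_compose2[OF m] continuous_on_compose2[OF q]) auto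
  have cont_comp: "continuous_on (U \<times> {0..1}) (\<lambda>(x, t). h (?p x t))"
    if "continuous_on G h" for h :: "complex ^ 'n ^ 'n \<Rightarrow> complex"
    unfolding case_prod_beta
    by (rule continuous_on_compose2[OF that contp[unfolded case_prod_beta]]) (auto intro: U(3))
  have contD: "continuous_on (U \<times> {0..1}) (\<lambda>(x, t). D x t A)" for A
    using cont_comp[OF F(2)[of A]] unfolding D_def case_prod_beta
    by (intro continuous_intros continuous_on_compose2[OF c] continuous_on_compose2[OF m]) auto
  have contF: "continuous_on (U \<times> {0..1}) (\<lambda>(x, t). c t * F (?p x t))"
    using cont_comp[OF continuous_on_cdiff[OF F(1)]] unfolding case_prod_beta
    by (intro continuous_intros continuous_on_compose2[OF c]) auto
  have slice: "continuous_on {0..1} (h x)" if "continuous_on (U \<times> {0..1}) (\<lambda>(x, t). h x t)" "x \<in> U"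
    for h :: "complex ^ 'n ^ 'n \<Rightarrow> real \<Rightarrow> 'c::real_normed_vector" and x
    using continuous_on_compose2[OF that(1), of "{0..1}" "\<lambda>t. (x, t)"] that(2)
    by (auto intro: continuous_on_Pair[OF continuous_on_const continuous_on_id])
  \<comment> \<open>In finite dimension, continuity in the operator norm follows from continuity at
    each fixed argument.\<close>
  have contB: "continuous_on (U \<times> {0..1}) (\<lambda>(x, t). Blinfun (D x t))"
  proof (rule continuous_on_blinfun_componentwise)
    fix A :: "complex ^ 'n ^ 'n"
    show "continuous_on (U \<times> {0..1}) (\<lambda>z. blinfun_apply (case z of (x, t) \<Rightarrow> Blinfun (D x t)) A)"
      using contD[of A] by (rule continuous_on_cong[THEN iffD1, rotated -1]) (auto simp: D_apply)
  qed
  have d: "((\<lambda>x. integral (cbox 0 1) (\<lambda>t. c t * F (?p x t))) has_derivative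
        blinfun_apply (integral (cbox 0 1) (\<lambda>t. Blinfun (D x0 t)))) (at x0 within U)"
  proof (rule leibniz_rule[OF _ _ _ x0 U(2)])
    fix x t assume x: "x \<in> U" and t: "t \<in> cbox 0 (1::real)"
    have t': "t \<in> {0..1}" using t by simp
    have "((\<lambda>x. ?p x t) has_derivative (\<lambda>A. m t *\<^sub>R A)) (at x within U)"
      by (auto intro!: derivative_eq_intros)
    from has_derivative_compose[OF this cdiff_has_derivative[OF F(1)[OF U(3)[OF x t']]]]
    have "((\<lambda>x. F (?p x t)) has_derivative (\<lambda>A. dird F (?p x t) (m t *\<^sub>R A))) (at x within U)" .
    hence "((\<lambda>x. c t * F (?p x t)) has_derivative (\<lambda>A. c t * dird F (?p x t) (m t *\<^sub>R A))) (at x within U)"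
      by (rule has_derivative_mult_right)
    moreover have "c t * dird F (?p x t) (m t *\<^sub>R A) = D x t A" for A
      unfolding D_def using dird_mat[OF F(1)[OF U(3)[OF x t']], of "of_real (m t)" A]
      by (simp only: scaleR_eq_mat[of "m t" A])
    ultimately show "((\<lambda>x. c t * F (?p x t)) has_derivative blinfun_apply (Blinfun (D x t))) (at x within U)"
      by (simp add: D_apply[OF x t'])
  next
    fix x assume x: "x \<in> U"
    show "(\<lambda>t. c t * F (?p x t)) integrable_on cbox 0 1"
      by (intro integrable_continuous) (use slice[OF contF x] in simp)
  qed (use contB in simp)
  have int: "(\<lambda>t. Blinfun (D x0 t)) integrable_on cbox 0 1"
    by (intro integrable_continuous) (use slice[OF contB x0] in simp)
  have app: "blinfun_apply (integral (cbox 0 1) (\<lambda>t. Blinfun (D x0 t))) A = integral (cbox 0 1) (\<lambda>t. D x0 t A)" for A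
    by (subst blinfun_apply_integral[OF int], rule integral_cong) (simp add: D_apply x0)
  have lin: "D x0 t (mat a ** A) = a * D x0 t A" if "t \<in> {0..1}" for t a A
    unfolding D_def by (subst dird_mat[OF F(1)[OF U(3)[OF x0 that]]]) (simp add: algebra_simps)
  show ?thesis
  proof (rule cdiffI)
    show "((\<lambda>x. integral {0..1} (\<lambda>t. c t * F (?p x t))) has_derivative
        (\<lambda>A. integral (cbox 0 1) (\<lambda>t. D x0 t A))) (at x0)"
      using d unfolding app[abs_def] at_within_open[OF x0 U(1)] by simp
    fix a A
    have "integral (cbox 0 1) (\<lambda>t. D x0 t (mat a ** A)) = integral (cbox 0 1) (\<lambda>t. a * D x0 t A)"
      by (rule integral_cong) (simp add: lin)
    thus "integral (cbox 0 1) (\<lambda>t. D x0 t (mat a ** A)) = a * integral (cbox 0 1) (\<lambda>t. D x0 t A)"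
      by (simp add: integral_mult_right)
  qed
qed

text \<open>The Cauchy formula on a circle in the complex line through \<open>x\<close> in direction
  \<open>v\<close>, parametrised over the unit interval. Neither the weight \<open>c\<close> nor the
  displacement \<open>q\<close> depends on \<open>x\<close>, so the derivative is an integral of
  translates of \<open>F\<close> itself and inherits the regularity of \<open>F\<close>.\<close>

lemma dird_Cauchy:
  fixes F :: "complex ^ 'n ^ 'n \<Rightarrow> complex"
  assumes G: "open G" and F: "\<forall>x\<in>G. cdiff F x" and x0: "x0 \<in> G"
  shows "\<exists>U c q. open U \<and> convex U \<and> x0 \<in> U \<and> U \<subseteq> G \<and>
    continuous_on {0..1} c \<and> continuous_on {0..1} q \<and> (\<forall>x\<in>U. \<forall>t\<in>{0..1::real}. x + q t \<in> G) \<and>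
    (\<forall>x\<in>U. dird F x v = integral {0..1} (\<lambda>t. c t * F (x + q t)))"
proof -
  obtain d where d: "d > 0" "ball x0 d \<subseteq> G" using G x0 open_contains_ball by blast
  \<comment> \<open>The summand 1 allows \<open>v = 0\<close>. The circle displaces points by less
    than \<open>d / 2\<close>, so it stays in \<open>G\<close> for every \<open>x\<close> in the
    ball of radius \<open>d / 2\<close>.\<close>
  define r where "r = d / (2 * (norm v + 1))"
  have r: "r > 0" unfolding r_def using d by (simp add: add_nonneg_pos)
  have rv: "r * norm v < d / 2"
  proof -
    have "r * norm v < r * (norm v + 1)" using r by simp
    also have "\<dots> = d / 2" unfolding r_def by (simp add: add_nonneg_eq_0_iff field_simps)
    finally show ?thesis .
  qed
  have inG: "x + mat z ** v \<in> G" if "x \<in> ball x0 (d/2)" "norm z \<le> r" for x z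
  proof -
    have "norm (mat z ** v) \<le> r * norm v" using that by (simp add: norm_mat_mult mult_right_mono)
    hence "dist x0 (x + mat z ** v) < d"
      using that rv norm_triangle_ineq4[of "x0 - x" "mat z ** v"] by (simp add: dist_norm diff_diff_eq)
    thus ?thesis using d by auto
  qed
  let ?e = "\<lambda>t::real. exp (2 * of_real pi * \<i> * of_real t)"
  have ne: "norm (?e t) = 1" for t
    using norm_exp_i_times[of "2 * pi * t"] by (simp add: mult_ac)
  show ?thesis
  proof (intro exI conjI ballI)
    show "open (ball x0 (d/2))" "convex (ball x0 (d/2))" "x0 \<in> ball x0 (d/2)" "ball x0 (d/2) \<subseteq> G"
      using d by auto
    show "continuous_on {0..1} (\<lambda>t. 1 / (of_real r * ?e t))"
      using r by (intro continuous_intros) auto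
    show "continuous_on {0..1} (\<lambda>t. mat (of_real r * ?e t) ** v)"
      by (subst continuous_on_componentwise) 
        (auto simp: Basis_vec_def inner_axis intro!: continuous_intros)
    fix x assume x: "x \<in> ball x0 (d/2)"
    show "x + mat (of_real r * ?e t) ** v \<in> G" for t :: real
      by (rule inG[OF x]) (use r ne[of t] in \<open>simp add: norm_mult\<close>)
    let ?h = "\<lambda>z. F (x + mat z ** v)"
    have der: "(?h has_field_derivative dird F (x + mat z ** v) v) (at z)" if "norm z \<le> r" for z
      by (rule cdiff_line[OF F[rule_format, OF inG[OF x that]]])
    have hol: "?h holomorphic_on cball 0 r"
      unfolding holomorphic_on_def field_differentiable_def
      by (intro ballI exI, rule has_field_derivative_at_within[OF der]) simp
    have "(?h has_field_derivative (1 / (2 * of_real pi * \<i>) * contour_integral (circlepath 0 r) (\<lambda>u. ?h u / (u - 0)^2))) (at 0)"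
      by (rule Cauchy_derivative_integral_circlepath)
        (use r hol in \<open>auto intro: holomorphic_on_imp_continuous_on holomorphic_on_subset\<close>)
    moreover have "mat 0 ** v = 0" by (simp add: vec_eq_iff)
    ultimately have "dird F x v = 1 / (2 * of_real pi * \<i>) * contour_integral (circlepath 0 r) (\<lambda>u. ?h u / u^2)"
      using der[of 0] r by (auto dest: DERIV_unique)
    also have "contour_integral (circlepath 0 r) (\<lambda>u. ?h u / u^2)
        = integral {0..1} (\<lambda>t. (2 * of_real pi * \<i>) * (1 / (of_real r * ?e t) * F (x + mat (of_real r * ?e t) ** v)))"
      unfolding contour_integral_integral vector_derivative_circlepath
      by (rule integral_cong) (use r in \<open>simp add: circlepath power2_eq_square field_simps\<close>)
    also have "\<dots> = (2 * of_real pi * \<i>) * integral {0..1} (\<lambda>t. 1 / (of_real r * ?e t) * F (x + mat (of_real r * ?e t) ** v))"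
      by (rule integral_mult_right)
    finally show "dird F x v = integral {0..1} (\<lambda>t. 1 / (of_real r * ?e t) * F (x + mat (of_real r * ?e t) ** v))"
      by simp
  qed
qed

text \<open>The Cauchy integral depends continuously on its parameter; this supplies the continuity
  hypothesis of \<open>cdiff_integral\<close>.\<close>

lemma continuous_on_dird:
  fixes F :: "complex ^ 'n ^ 'n \<Rightarrow> complex"
  assumes G: "open G" and F: "\<And>x. x \<in> G \<Longrightarrow> cdiff F x"
  shows "continuous_on G (\<lambda>x. dird F x v)"
proof (intro continuous_at_imp_continuous_on ballI)
  fix x0 assume x0: "x0 \<in> G"
  have F': "\<forall>x\<in>G. cdiff F x" using F by blast
  obtain U c and q :: "real \<Rightarrow> complex ^ 'n ^ 'n" where U: "open U" "convex U" "x0 \<in> U" "U \<subseteq> G"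
    and c: "continuous_on {0..1} c" and q: "continuous_on {0..1} q"
    and inG: "\<forall>x\<in>U. \<forall>t\<in>{0..1::real}. x + q t \<in> G"
    and eq: "\<forall>x\<in>U. dird F x v = integral {0..1} (\<lambda>t. c t * F (x + q t))"
    using dird_Cauchy[OF G F' x0, of v] by (elim exE conjE) (rule that)
  have cF: "continuous_on G F" by (rule continuous_on_cdiff[OF F])
  have "continuous_on (U \<times> {0..1}) (\<lambda>(x, t). c t * F (x + q t))"
    unfolding case_prod_beta
    by (intro continuous_intros continuous_on_compose2[OF c] continuous_on_compose2[OF q]
        continuous_on_compose2[OF cF]) (use inG in auto)
  hence "continuous_on U (\<lambda>x. integral (cbox 0 1) (\<lambda>t. c t * F (x + q t)))"
    by (intro integral_continuous_on_param) simp
  hence "continuous_on U (\<lambda>x. dird F x v)" by (simp add: eq cong: continuous_on_cong)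
  thus "isCont (\<lambda>x. dird F x v) x0" using U by (simp add: continuous_on_eq_continuous_at)
qed

text \<open>The Cauchy integral is differentiated under the integral sign, so holomorphy passes from
  a function to its derivatives.\<close>

lemma cdiff_dird:
  fixes F :: "complex ^ 'n ^ 'n \<Rightarrow> complex"
  assumes G: "open G" and F: "\<And>x. x \<in> G \<Longrightarrow> cdiff F x" and x0: "x0 \<in> G"
  shows "cdiff (\<lambda>x. dird F x v) x0"
proof -
  have F': "\<forall>x\<in>G. cdiff F x" using F by blast
  obtain U c and q :: "real \<Rightarrow> complex ^ 'n ^ 'n" where U: "open U" "convex U" "x0 \<in> U" "U \<subseteq> G"
    and c: "continuous_on {0..1} c" and q: "continuous_on {0..1} q"
    and inG: "\<forall>x\<in>U. \<forall>t\<in>{0..1::real}. x + q t \<in> G"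
    and eq: "\<forall>x\<in>U. dird F x v = integral {0..1} (\<lambda>t. c t * F (x + q t))"
    using dird_Cauchy[OF G F' x0, of v] by (elim exE conjE) (rule that)
  have "cdiff (\<lambda>x. integral {0..1} (\<lambda>t. c t * F (1 *\<^sub>R x + q t))) x0"
    by (rule cdiff_integral[where G = G, OF F continuous_on_dird[OF G F] c _ q U(1,2) _ U(3)])
      (use inG in auto)
  thus ?thesis by (subst cdiff_cong_open(1)[OF U(1,3) eq[rule_format]]) auto
qed

text \<open>Integrate the derivative of \<open>F\<close> along the segment from \<open>p\<close> to
  \<open>x\<close>. The coefficients are the averages of the partial derivatives over this segment;
  they are holomorphic in \<open>x\<close> because the partial derivatives are.\<close>

lemma Hadamard_lemma:
  fixes F :: "complex ^ 'n ^ 'n \<Rightarrow> complex"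
  assumes G: "open G" "convex G" and F: "\<And>x. x \<in> G \<Longrightarrow> cdiff F x" and p: "p \<in> G"
  obtains H where "\<And>i j x. x \<in> G \<Longrightarrow> cdiff (H i j) x" "\<And>i j. H i j p = dird F p (unit_mat i j)"
    "\<And>x. x \<in> G \<Longrightarrow> F x = F p + (\<Sum>i\<in>UNIV. \<Sum>j\<in>UNIV. (x $ i $ j - p $ i $ j) * H i j x)"
proof
  define H where "H = (\<lambda>i j x. integral {0..1} (\<lambda>t::real. 1 * dird F (t *\<^sub>R x + (1 - t) *\<^sub>R p) (unit_mat i j)))"
  have seg: "t *\<^sub>R x + (1 - t) *\<^sub>R p \<in> G" if "x \<in> G" "t \<in> {0..1}" for x t
    using convexD[OF G(2) that(1) p, of t "1 - t"] that(2) by auto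
  have cFd: "continuous_on G (\<lambda>x. dird F x v)" for v by (rule continuous_on_dird[OF G(1) F])
  have Fd: "cdiff (\<lambda>x. dird F x v) x" if "x \<in> G" for x v by (rule cdiff_dird[OF G(1) F that])
  show "cdiff (H i j) x" if "x \<in> G" for i j x
    unfolding H_def
    by (rule cdiff_integral[where G = G, OF Fd continuous_on_dird[OF G(1) Fd] _ _ _ G _ that])
      (auto intro!: continuous_intros seg)
  show "H i j p = dird F p (unit_mat i j)" for i j
    by (simp add: H_def flip: scaleR_add_left)
  fix x assume x: "x \<in> G"
  let ?p = "\<lambda>t::real. t *\<^sub>R x + (1 - t) *\<^sub>R p"
  have "((\<lambda>t. dird F (?p t) (x - p)) has_integral (F (?p 1) - F (?p 0))) {0..1}"
  proof (rule fundamental_theorem_of_calculus)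
    fix t :: real assume t: "t \<in> {0..1}"
    have "(?p has_derivative (\<lambda>s. s *\<^sub>R (x - p))) (at t within {0..1})"
      by (auto intro!: derivative_eq_intros simp: algebra_simps)
    from has_derivative_compose[OF this cdiff_has_derivative[OF F[OF seg[OF x t]]]]
    show "((\<lambda>t. F (?p t)) has_vector_derivative dird F (?p t) (x - p)) (at t within {0..1})"
      by (simp add: has_vector_derivative_def linear_cmul[OF dird_linear[OF F[OF seg[OF x t]]]])
  qed simp
  hence "F x - F p = integral {0..1} (\<lambda>t. dird F (?p t) (x - p))"
    by (simp add: integral_unique)
  also have "\<dots> = integral {0..1} (\<lambda>t. \<Sum>i\<in>UNIV. \<Sum>j\<in>UNIV. (x $ i $ j - p $ i $ j) * (1 * dird F (?p t) (unit_mat i j)))"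
    by (rule integral_cong) (subst dird_expansion[OF F[OF seg[OF x]]], auto)
  also have "\<dots> = (\<Sum>i\<in>UNIV. \<Sum>j\<in>UNIV. (x $ i $ j - p $ i $ j) * H i j x)"
  proof -
    have int: "(\<lambda>t. (x $ i $ j - p $ i $ j) * (1 * dird F (?p t) (unit_mat i j))) integrable_on {0..1}" for i j
      by (intro integrable_continuous_real continuous_intros
          continuous_on_compose2[OF cFd]) (auto intro: seg[OF x])
    have "integral {0..1} (\<lambda>t. \<Sum>i\<in>UNIV. \<Sum>j\<in>UNIV. (x $ i $ j - p $ i $ j) * (1 * dird F (?p t) (unit_mat i j)))
        = (\<Sum>i\<in>UNIV. \<Sum>j\<in>UNIV. integral {0..1} (\<lambda>t. (x $ i $ j - p $ i $ j) * (1 * dird F (?p t) (unit_mat i j))))"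
      by (subst integral_sum, simp, intro integrable_sum int, simp, rule sum.cong, simp)
        (rule integral_sum, simp, rule int)
    thus ?thesis unfolding H_def by (simp only: integral_mult_right)
  qed
  finally show "F x = F p + (\<Sum>i\<in>UNIV. \<Sum>j\<in>UNIV. (x $ i $ j - p $ i $ j) * H i j x)"
    by (simp add: algebra_simps)
qed

section \<open>Matrix algebra and holomorphy of the inverse\<close>

lemma matrix_mult_diff_left: "(A - B) ** (C :: complex ^ 'n ^ 'n) = A ** C - B ** C"
  by (simp add: vec_eq_iff matrix_matrix_mult_def left_diff_distrib sum_subtractf)

lemma matrix_mult_diff_right: "(C :: complex ^ 'n ^ 'n) ** (A - B) = C ** A - C ** B"
  by (simp add: vec_eq_iff matrix_matrix_mult_def right_diff_distrib sum_subtractf)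

lemma matrix_mult_add_left: "(A + B) ** (C :: complex ^ 'n ^ 'n) = A ** C + B ** C"
  by (simp add: vec_eq_iff matrix_matrix_mult_def distrib_right sum.distrib)

lemmas matrix_ring = matrix_mult_diff_left matrix_mult_diff_right matrix_add_ldistrib
  matrix_mult_add_left matrix_mul_assoc matrix_mul_lid matrix_mul_rid

lemma mv_image_mult: "(*v) (g ** h) ` S = (*v) g ` ((*v) h ` (S :: (complex ^ 'n) set))"
  by (simp add: image_image matrix_vector_mul_assoc)

lemma invertible_one [simp]: "invertible (mat 1 :: complex ^ 'n ^ 'n)"
  by (simp add: invertible_det_nz)

lemma invertibleE:
  fixes g :: "complex ^ 'n ^ 'n"
  assumes "invertible g"
  obtains h where "g ** h = mat 1" "h ** g = mat 1" "invertible h"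
  using assms by (auto simp: invertible_def)

lemma matrix_inv_mult:
  fixes M :: "complex ^ 'n ^ 'n"
  assumes "det M \<noteq> 0"
  shows "M ** matrix_inv M = mat 1" "matrix_inv M ** M = mat 1"
proof -
  have "\<exists>N. M ** N = mat 1 \<and> N ** M = mat 1"
    using assms by (simp add: invertible_det_nz[symmetric] invertible_def)
  hence "M ** matrix_inv M = mat 1 \<and> matrix_inv M ** M = mat 1"
    unfolding matrix_inv_def by (rule someI_ex)
  thus "M ** matrix_inv M = mat 1" "matrix_inv M ** M = mat 1" by auto
qed

text \<open>Cramer's rule for the columns of the inverse. As quotients of determinants, the entries
  are visibly holomorphic.\<close>

lemma matrix_inv_nth:
  fixes M :: "complex ^ 'n ^ 'n"
  assumes "det M \<noteq> 0"
  shows "matrix_inv M $ i $ j = det (\<chi> k l. if l = i then axis j 1 $ k else M $ k $ l) / det M"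
proof -
  have "M *v (matrix_inv M *v axis j 1) = axis j 1"
    using assms by (simp add: matrix_vector_mul_assoc matrix_inv_mult)
  hence "matrix_inv M *v axis j 1
      = (\<chi> i. det (\<chi> k l. if l = i then axis j 1 $ k else M $ k $ l) / det M)"
    by (simp only: cramer[OF assms])
  moreover have "(matrix_inv M *v axis j 1) $ i = matrix_inv M $ i $ j"
    by (simp add: matrix_vector_mult_def axis_def if_distrib cong: if_cong)
  ultimately show ?thesis by simp
qed

lemma open_det_nz:
  fixes N :: "complex ^ 'n ^ 'n \<Rightarrow> complex ^ 'n ^ 'n"
  assumes "\<And>x i j. cdiff (\<lambda>x. N x $ i $ j) x"
  shows "open {x. det (N x) \<noteq> 0}"
proof -
  have "continuous_on UNIV (\<lambda>x. det (N x))"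
    by (intro continuous_on_cdiff cdiff_det assms)
  from open_vimage[OF _ this, of "- {0}"] show ?thesis
    by (simp add: vimage_def open_Compl)
qed

lemma cdiff_matrix_inv:
  fixes N :: "complex ^ 'n ^ 'n \<Rightarrow> complex ^ 'n ^ 'n"
  assumes N: "\<And>x i j. cdiff (\<lambda>x. N x $ i $ j) x" and nz: "det (N g) \<noteq> 0"
  shows "cdiff (\<lambda>x. matrix_inv (N x) $ i $ j) g"
proof -
  have "cdiff (\<lambda>x. det (\<chi> k l. if l = i then axis j 1 $ k else N x $ k $ l) / det (N x)) g"
  proof (intro cdiff_divide cdiff_det N nz)
    show "cdiff (\<lambda>x. (\<chi> k l. if l = i then axis j 1 $ k else N x $ k $ l) $ k $ l) g" for k l
      using N by (cases "l = i") simp_all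
  qed
  thus ?thesis
    by (subst cdiff_cong_open(1)[OF open_det_nz[OF N]]) (use nz in \<open>auto simp: matrix_inv_nth\<close>)
qed

section \<open>Holomorphic functions on the Grassmannian\<close>

text \<open>Holomorphy at a single point, read off at the identity of the group only; translations
  in the group take care of all other elements.\<close>

definition hol_at :: "((complex ^ 'n) set \<Rightarrow> complex) \<Rightarrow> (complex ^ 'n) set \<Rightarrow> bool" where
  "hol_at f S \<longleftrightarrow> cdiff (\<lambda>g. f ((*v) g ` S)) (mat 1)"

text \<open>The derivative at \<open>S\<close> along the vector field by which a matrix acts
  infinitesimally on the Grassmannian.\<close>

abbreviation dG ::
    "((complex ^ 'n) set \<Rightarrow> complex) \<Rightarrow> (complex ^ 'n) set \<Rightarrow> complex ^ 'n ^ 'n \<Rightarrow> complex" where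
  "dG f S \<equiv> dird (\<lambda>g. f ((*v) g ` S)) (mat 1)"

lemma cdiff_mult_const: "cdiff (\<lambda>h. (h ** (A :: complex ^ 'n ^ 'n)) $ i $ j) g"
  by (intro cdiff_matrix_mult cdiff_nth cdiff_const)

lemma dird_mult_const: "dird (\<lambda>h. (h ** (A :: complex ^ 'n ^ 'n)) $ i $ j) g B = (B ** A) $ i $ j"
proof -
  have "dird (\<lambda>h. (h ** A) $ i $ j) g B = (\<Sum>k\<in>UNIV. B $ i $ k * A $ k $ j)"
    unfolding matrix_matrix_mult_def by (simp add: dird_sum cdiff_mult dird_mult mult.commute)
  thus ?thesis by (simp add: matrix_matrix_mult_def)
qed

text \<open>The orbit map of the subspace \<open>g S\<close> is that of \<open>S\<close> composed
  with right multiplication by \<open>g\<close>, which sends the identity to \<open>g\<close> and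
  the direction \<open>A\<close> to \<open>A ** g\<close>. Right multiplication by the inverse gives
  the converse.\<close>

lemma
  fixes g :: "complex ^ 'n ^ 'n"
  assumes g: "invertible g"
  shows cdiff_orbit: "cdiff (\<lambda>h. f ((*v) h ` S)) g \<longleftrightarrow> hol_at f ((*v) g ` S)"
    and dird_orbit: "hol_at f ((*v) g ` S) \<Longrightarrow> dG f ((*v) g ` S) A = dird (\<lambda>h. f ((*v) h ` S)) g (A ** g)"
proof -
  obtain h where h: "g ** h = mat 1" "h ** g = mat 1" using g by (rule invertibleE)
  let ?F = "\<lambda>x. f ((*v) x ` ((*v) g ` S))"
  have F: "?F = (\<lambda>x. f ((*v) (x ** g) ` S))" by (simp add: mv_image_mult)
  have F': "(\<lambda>x. ?F (x ** h)) = (\<lambda>x. f ((*v) x ` S))"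
    by (simp add: mv_image_mult[symmetric] matrix_mul_assoc[symmetric] h del: image_image)
  have "hol_at f ((*v) g ` S)" if "cdiff (\<lambda>h. f ((*v) h ` S)) g"
    using cdiff_compose[OF cdiff_mult_const, of "\<lambda>h. f ((*v) h ` S)" "mat 1" g] that
    by (simp add: hol_at_def F)
  moreover have "cdiff (\<lambda>h. f ((*v) h ` S)) g" if "hol_at f ((*v) g ` S)"
    using cdiff_compose[OF cdiff_mult_const, of ?F g h] that
    by (simp add: hol_at_def F' h)
  ultimately show iff: "cdiff (\<lambda>h. f ((*v) h ` S)) g \<longleftrightarrow> hol_at f ((*v) g ` S)" by blast
  show "dG f ((*v) g ` S) A = dird (\<lambda>h. f ((*v) h ` S)) g (A ** g)" if "hol_at f ((*v) g ` S)"
    using dird_compose[OF cdiff_mult_const, of "\<lambda>h. f ((*v) h ` S)" "mat 1" g A] that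
    by (simp add: iff F dird_mult_const vec_lambda_eta)
qed

lemma openin_Gr:
  "openin (topo (Gr k)) U \<longleftrightarrow> U \<subseteq> grass k \<and> (\<forall>S\<in>grass k. open (orbit_preimage S U))"
  by (simp add: Gr_def openin_grass_topology)

lemma hol_iff:
  assumes "U \<subseteq> grass k"
  shows "f \<in> hol (Gr k) U \<longleftrightarrow> (\<forall>S\<in>U. hol_at f S)"
proof
  assume f: "f \<in> hol (Gr k) U"
  show "\<forall>S\<in>U. hol_at f S"
  proof
    fix S assume S: "S \<in> U"
    hence "mat 1 \<in> orbit_preimage S U" by (simp add: orbit_preimage_def)
    thus "hol_at f S" using f S assms
      unfolding Gr_def matrix_holomorphic_on_iff hol_at_def by auto
  qed
next
  assume "\<forall>S\<in>U. hol_at f S"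
  thus "f \<in> hol (Gr k) U"
    by (auto simp: Gr_def matrix_holomorphic_on_iff orbit_preimage_def cdiff_orbit)
qed

lemma orbit_preimage_nhd:
  assumes "openin (topo (Gr k)) U" "S \<in> U"
  shows "open (orbit_preimage S U)" "mat 1 \<in> orbit_preimage S U"
  using assms by (auto simp: openin_Gr orbit_preimage_def)

lemma
  assumes U: "openin (topo (Gr k)) U" "S \<in> U" and eq: "\<And>T. T \<in> U \<Longrightarrow> f T = h T"
  shows hol_at_cong: "hol_at f S \<longleftrightarrow> hol_at h S"
    and dG_cong: "hol_at f S \<Longrightarrow> dG f S = dG h S"
proof -
  have "f ((*v) g ` S) = h ((*v) g ` S)" if "g \<in> orbit_preimage S U" for g
    using that eq by (simp add: orbit_preimage_def)
  note c = cdiff_cong_open[OF orbit_preimage_nhd[OF U],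
      of "\<lambda>g. f ((*v) g ` S)" "\<lambda>g. h ((*v) g ` S)", OF this]
  show "hol_at f S \<longleftrightarrow> hol_at h S" unfolding hol_at_def by (rule c(1)) simp
  show "dG f S = dG h S" if "hol_at f S"
    using that unfolding hol_at_def by (rule c(2)[rotated]) simp
qed

lemma hol_near_iff: "f \<in> hol_near (Gr k) S \<longleftrightarrow>
    (\<exists>U. openin (topo (Gr k)) U \<and> S \<in> U \<and> (\<forall>T\<in>U. hol_at f T))"
  unfolding hol_near_def by (auto simp: openin_Gr hol_iff)

section \<open>Projections and charts\<close>

lemma range_projection:
  fixes P :: "complex ^ 'n ^ 'n"
  assumes "P ** P = P"
  shows "v \<in> range ((*v) P) \<longleftrightarrow> P *v v = v"
proof
  assume "v \<in> range ((*v) P)"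
  then obtain w where "v = P *v w" by auto
  thus "P *v v = v" by (simp add: matrix_vector_mul_assoc assms)
next
  assume "P *v v = v"
  from this[symmetric] show "v \<in> range ((*v) P)" by (rule range_eqI)
qed

lemma projection_exists:
  assumes "S \<in> grass k"
  obtains P :: "complex ^ 'n ^ 'n" where "P ** P = P" "range ((*v) P) = S"
proof -
  have l: "Vector_Spaces.linear (*s) (*s) (id :: complex ^ 'n \<Rightarrow> _)" by (rule vec.linear_id)
  obtain f where f: "range f \<subseteq> S" "Vector_Spaces.linear (*s) (*s) f" "\<forall>v\<in>S. f v = v"
    using vec.linear_exists_left_inverse_on[OF l, of S] assms by (auto simp: grass_def)
  have m: "matrix f *v v = f v" for v by (rule matrix_works[OF f(2)])
  show ?thesis
  proof
    show "matrix f ** matrix f = matrix f"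
      using f(1,3) by (auto simp: matrix_eq m matrix_vector_mul_assoc[symmetric])
    show "range ((*v) (matrix f)) = S"
    proof (intro subset_antisym subsetI)
      fix v assume "v \<in> S"
      hence "v = matrix f *v v" using f(3) by (simp add: m)
      thus "v \<in> range ((*v) (matrix f))" by (rule range_eqI)
    qed (use f(1) in \<open>auto simp: m\<close>)
  qed
qed

text \<open>
  The chart at an idempotent \<open>P0\<close> consists of the complements of the kernel of \<open>P0\<close>; such a
  complement is identified with the idempotent that projects onto it along this kernel.
\<close>

definition is_chart_proj ::
    "complex ^ 'n ^ 'n \<Rightarrow> (complex ^ 'n) set \<Rightarrow> complex ^ 'n ^ 'n \<Rightarrow> bool" where
  "is_chart_proj P0 S P \<longleftrightarrow> range ((*v) P) = S \<and> P ** P0 = P \<and> P0 ** P = P0"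

definition chart :: "complex ^ 'n ^ 'n \<Rightarrow> (complex ^ 'n) set set" where
  "chart P0 = {S. \<exists>P. is_chart_proj P0 S P}"

definition chart_proj :: "complex ^ 'n ^ 'n \<Rightarrow> (complex ^ 'n) set \<Rightarrow> complex ^ 'n ^ 'n" where
  "chart_proj P0 S = (THE P. is_chart_proj P0 S P)"

lemma is_chart_proj_idem:
  assumes "is_chart_proj P0 S P"
  shows "P ** P = P"
  by (metis assms is_chart_proj_def matrix_mul_assoc)

text \<open>Idempotents with equal range satisfy \<open>P ** Q = Q\<close>; idempotents with equal
  kernel satisfy \<open>P ** Q = P\<close>.\<close>

lemma is_chart_proj_unique:
  assumes "is_chart_proj P0 S P" "is_chart_proj P0 S Q"
  shows "P = Q"
proof -
  have "P *v (Q *v v) = Q *v v" for v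
    using range_projection[OF is_chart_proj_idem[OF assms(1)], of "Q *v v"] assms
    by (auto simp: is_chart_proj_def)
  hence "P ** Q = Q" by (simp add: matrix_eq matrix_vector_mul_assoc[symmetric])
  moreover have "P ** Q = P" using assms by (metis is_chart_proj_def matrix_mul_assoc)
  ultimately show ?thesis by simp
qed

lemma chart_projI: "is_chart_proj P0 S P \<Longrightarrow> S \<in> chart P0 \<and> chart_proj P0 S = P"
  unfolding chart_def chart_proj_def using is_chart_proj_unique by blast

lemma chart_projD: "S \<in> chart P0 \<Longrightarrow> is_chart_proj P0 S (chart_proj P0 S)"
  using chart_projI by (force simp: chart_def)

lemma chart_proj_eq_iff:
  assumes "S \<in> chart P0"
  shows "v \<in> S \<longleftrightarrow> chart_proj P0 S *v v = v"
  using range_projection[OF is_chart_proj_idem[OF chart_projD[OF assms]]] chart_projD[OF assms]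
  by (auto simp: is_chart_proj_def)

lemma chart_proj_in: "S \<in> chart P0 \<Longrightarrow> chart_proj P0 S *v v \<in> S"
  using chart_projD[of S P0] by (auto simp: is_chart_proj_def)

lemma chart_proj_self:
  assumes "P0 ** P0 = P0" "range ((*v) P0) = S"
  shows "S \<in> chart P0" "chart_proj P0 S = P0"
  using chart_projI[of P0 S P0] assms by (auto simp: is_chart_proj_def)

text \<open>As \<open>P\<close> and \<open>P0\<close> have the same kernel, \<open>P - P0\<close>
  has square zero, so the inverse is \<open>1 - P + P0\<close>. On the range of \<open>P0\<close>
  the matrix acts as \<open>P\<close>.\<close>

lemma chart_transport:
  assumes P0: "P0 ** P0 = P0" and P: "is_chart_proj P0 S P"
  shows "invertible (mat 1 + P - P0)" "(*v) (mat 1 + P - P0) ` range ((*v) P0) = S"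
proof -
  have PP: "P ** P = P" "P ** P0 = P" "P0 ** P = P0" "range ((*v) P) = S"
    using P is_chart_proj_idem[OF P] by (auto simp: is_chart_proj_def)
  show "invertible (mat 1 + P - P0)"
    unfolding invertible_def by (rule exI[of _ "mat 1 - P + P0"]) (simp add: matrix_ring PP P0)
  have "(mat 1 + P - P0) ** P0 = P" by (simp add: matrix_ring PP P0)
  thus "(*v) (mat 1 + P - P0) ` range ((*v) P0) = S"
    using PP(4) by (simp add: mv_image_mult[symmetric] del: image_image)
qed

text \<open>The projection onto \<open>g S\<close> along the kernel of \<open>P0\<close> is
  \<open>g ** P ** matrix_inv (M g)\<close>, where \<open>M g\<close> is the identity on that
  kernel. At \<open>g = 1\<close> it is the invertible matrix of \<open>chart_transport\<close>, so
  its determinant stays nonzero nearby, and the entries of its inverse are holomorphic by Cramer's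
  rule.\<close>

lemma
  assumes P0: "P0 ** P0 = P0" and S: "S \<in> chart P0"
  shows chart_near: "\<exists>V. open V \<and> mat 1 \<in> V \<and> (\<forall>g\<in>V. invertible g \<and> (*v) g ` S \<in> chart P0)"
    and chart_proj_hol_at: "hol_at (\<lambda>S. chart_proj P0 S $ i $ j) S"
proof -
  define P where "P = chart_proj P0 S"
  have P: "is_chart_proj P0 S P" unfolding P_def by (rule chart_projD[OF S])
  have PP: "P ** P = P" "P ** P0 = P" "P0 ** P = P0" "range ((*v) P) = S"
    using P is_chart_proj_idem[OF P] by (auto simp: is_chart_proj_def)
  define M where "M = (\<lambda>g. g ** P + (mat 1 - P0))"
  have M_cdiff: "cdiff (\<lambda>g. M g $ i $ j) g" for g i j
    unfolding M_def by (simp add: cdiff_add cdiff_mult_const del: vector_minus_component)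
  define V where "V = {g. det g \<noteq> 0} \<inter> {g. det (M g) \<noteq> 0}"
  have "open V" unfolding V_def by (intro open_Int open_det_nz M_cdiff cdiff_nth)
  have M1: "M (mat 1) = mat 1 + P - P0" by (simp add: M_def)
  have oneV: "mat 1 \<in> V"
    using chart_transport(1)[OF P0 P] by (simp add: V_def M1 invertible_det_nz)
  have key: "is_chart_proj P0 ((*v) g ` S) (g ** P ** matrix_inv (M g))" if g: "g \<in> V" for g
  proof -
    have inv: "M g ** matrix_inv (M g) = mat 1" "matrix_inv (M g) ** M g = mat 1"
      using g by (auto simp: V_def matrix_inv_mult)
    let ?N = "matrix_inv (M g)"
    have "range ((*v) ?N) = UNIV"
      by (rule surjI[of _ "(*v) (M g)"]) (simp add: matrix_vector_mul_assoc inv)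
    hence r: "range ((*v) (g ** P ** ?N)) = (*v) g ` S"
      using PP(4) by (simp add: mv_image_mult del: image_image)
    have gP: "g ** P ** P0 = g ** P" by (simp add: matrix_mul_assoc[symmetric] PP)
    have "M g ** (mat 1 - P0) = mat 1 - P0" by (simp add: M_def matrix_ring PP P0 gP)
    hence "?N ** (mat 1 - P0) = mat 1 - P0" by (metis inv(2) matrix_mul_assoc matrix_mul_lid)
    hence "g ** P ** ?N ** (mat 1 - P0) = g ** P ** (mat 1 - P0)" by (metis matrix_mul_assoc)
    hence 1: "g ** P ** ?N ** P0 = g ** P ** ?N"
      using gP by (simp add: matrix_ring)
    have "P0 ** M g = P0 ** g ** P" by (simp add: M_def matrix_ring P0)
    hence "P0 ** (g ** P ** ?N) = P0 ** (M g ** ?N)" by (simp add: matrix_mul_assoc)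
    hence "P0 ** (g ** P ** ?N) = P0" by (simp add: inv)
    with r 1 show ?thesis by (simp add: is_chart_proj_def)
  qed
  show "\<exists>V. open V \<and> mat 1 \<in> V \<and> (\<forall>g\<in>V. invertible g \<and> (*v) g ` S \<in> chart P0)"
    using \<open>open V\<close> oneV chart_projI[OF key] by (auto simp: V_def invertible_det_nz)
  have "cdiff (\<lambda>g. (g ** P ** matrix_inv (M g)) $ i $ j) (mat 1)"
    by (intro cdiff_matrix_mult[of "\<lambda>g. g ** P"] cdiff_mult_const cdiff_matrix_inv M_cdiff)
      (use oneV in \<open>auto simp: V_def\<close>)
  thus "hol_at (\<lambda>S. chart_proj P0 S $ i $ j) S"
    unfolding hol_at_def
    by (subst cdiff_cong_open(1)[OF \<open>open V\<close> oneV]) (use chart_projI[OF key] in auto)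
qed

lemma openin_chart:
  assumes P0: "P0 ** P0 = P0" "range ((*v) P0) \<in> grass k"
  shows "openin (topo (Gr k)) (chart P0)"
  unfolding openin_Gr
proof (intro conjI ballI)
  show "chart P0 \<subseteq> grass k"
    using chart_transport[OF P0(1)] image_mem_grass[OF _ P0(2)] by (metis chart_projD subsetI)
  fix S1 :: "(complex ^ 'a) set" assume "S1 \<in> grass k"
  show "open (orbit_preimage S1 (chart P0))"
  proof (subst open_subopen, intro ballI)
    fix g assume "g \<in> orbit_preimage S1 (chart P0)"
    hence g: "invertible g" "(*v) g ` S1 \<in> chart P0" by (auto simp: orbit_preimage_def)
    obtain h where h: "g ** h = mat 1" "h ** g = mat 1" using g(1) by (rule invertibleE)
    obtain V where V: "open V" "mat 1 \<in> V" "\<forall>x\<in>V. invertible x \<and> (*v) x ` ((*v) g ` S1) \<in> chart P0"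
      using chart_near[OF P0(1) g(2)] by blast
    \<comment> \<open>\<open>chart_near\<close> provides a neighbourhood of the identity; right
      multiplication by the inverse \<open>h\<close> of \<open>g\<close> pulls it back to a
      neighbourhood of \<open>g\<close>.\<close>
    have "continuous_on UNIV (\<lambda>x. x ** h)"
      unfolding matrix_matrix_mult_def by (intro continuous_intros)
    hence "open ((\<lambda>x. x ** h) -` V)" using V(1) by (rule_tac open_vimage)
    moreover have "x \<in> orbit_preimage S1 (chart P0)" if "x ** h \<in> V" for x
    proof -
      have x: "x = (x ** h) ** g" by (simp add: matrix_mul_assoc[symmetric] h)
      have "invertible x" by (subst x) (use V(3) that g(1) in \<open>auto intro: invertible_mult\<close>)
      moreover have "(*v) x ` S1 \<in> chart P0"
        by (subst x, subst mv_image_mult) (use V(3) that in auto)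
      ultimately show ?thesis by (simp add: orbit_preimage_def)
    qed
    ultimately show "\<exists>T. open T \<and> g \<in> T \<and> T \<subseteq> orbit_preimage S1 (chart P0)"
      using h V(2) by (intro exI[of _ "(\<lambda>x. x ** h) -` V"]) auto
  qed
qed

section \<open>The trace pairing\<close>

lemma trace_mult: "trace ((A :: complex ^ 'n ^ 'n) ** B) = (\<Sum>i\<in>UNIV. \<Sum>j\<in>UNIV. A $ i $ j * B $ j $ i)"
  by (simp add: trace_def matrix_matrix_mult_def)

lemma matrix_mv [simp]: "matrix ((*v) (M :: complex ^ 'n ^ 'n)) = M"
  by (rule matrix_of_matrix_vector_mul)

lemma mv_axis: "((M :: complex ^ 'n ^ 'n) *v axis j 1) $ i = M $ i $ j"
  by (simp add: matrix_vector_mult_def axis_def if_distrib cong: if_cong)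

lemma trace_mult_all_zero:
  assumes "\<And>X. trace (X ** (A :: complex ^ 'n ^ 'n)) = 0"
  shows "A = 0"
proof -
  have "A $ j $ i = 0" for i j
  proof -
    have "trace (unit_mat i j ** A) = (\<Sum>k\<in>UNIV. \<Sum>l\<in>UNIV. if k = i then (if l = j then A $ l $ k else 0) else 0)"
      unfolding trace_mult by (intro sum.cong refl) (simp add: unit_mat_nth)
    also have "\<dots> = (\<Sum>k\<in>UNIV. if k = i then A $ j $ k else 0)" by (intro sum.cong) auto
    finally show ?thesis using assms by simp
  qed
  thus ?thesis by (simp add: vec_eq_iff)
qed

lemma trace_mat_mult: "trace (mat c ** (A :: complex ^ 'n ^ 'n)) = c * trace A"
  by (simp add: trace_def sum_distrib_left)

lemma mat_mult_assoc_right: "(A :: complex ^ 'n ^ 'n) ** (mat c ** B) = mat c ** (A ** (B :: complex ^ 'n ^ 'n))"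
  by (simp add: vec_eq_iff matrix_matrix_mult_def[of A] sum_distrib_left mult_ac)

lemma mat_mult_mv: "(mat c ** A) *v v = c *s ((A :: complex ^ 'n ^ 'n) *v v)"
  by (simp add: matrix_vector_mul_assoc[symmetric])

section \<open>The fibres of the kernel bundle and its dual\<close>

definition KM :: "complex ^ 'n ^ 'n \<Rightarrow> (complex ^ 'n) set \<Rightarrow> (complex ^ 'n ^ 'n) set" where
  "KM B S = {M. (\<forall>v. M *v v \<in> S) \<and> (\<forall>t\<in>S. M *v t + trace (B ** M) *s t = 0)}"

lemma fib_VS:
  "fib (VS_bundle k) S = (\<lambda>M. (*v) M) ` {M. \<forall>v. M *v v \<in> (S :: (complex ^ 'n) set)}"
proof -
  have "\<phi> = (*v) (matrix \<phi>)" if "\<forall>v w. \<phi> (v + w) = \<phi> v + \<phi> w" "\<forall>c v. \<phi> (c *s v) = c *s \<phi> v"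
    for \<phi> :: "complex ^ 'n \<Rightarrow> complex ^ 'n"
  proof -
    have "Vector_Spaces.linear (*s) (*s) \<phi>"
      using that vec.vector_space_axioms by (simp add: Vector_Spaces.linear_iff)
    thus ?thesis by (simp add: matrix_works fun_eq_iff)
  qed
  note mat = this
  have fib: "fib (VS_bundle k) S = {\<phi>. (\<forall>v. \<phi> v \<in> S) \<and>
      (\<forall>v w. \<phi> (v + w) = \<phi> v + \<phi> w) \<and> (\<forall>c v. \<phi> (c *s v) = c *s \<phi> v)}"
    by (simp add: VS_bundle_def hom_bundle_def Let_def trivial_bundle_def tautological_def
        subbundle_def)
  show ?thesis
  proof (intro set_eqI iffI)
    fix \<phi> assume \<phi>: "\<phi> \<in> fib (VS_bundle k) S"
    hence eq: "\<phi> = (*v) (matrix \<phi>)" using mat[of \<phi>] by (simp add: fib)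
    have "\<forall>v. matrix \<phi> *v v \<in> S" using \<phi> by (subst eq[symmetric]) (simp add: fib)
    with eq show "\<phi> \<in> (\<lambda>M. (*v) M) ` {M. \<forall>v. M *v v \<in> S}" by (intro image_eqI) auto
  qed (auto simp: fib matrix_vector_right_distrib vec.scale)
qed

text \<open>Summing over the coordinate functionals, the first term of the bundle map rebuilds
  \<open>M *v t\<close> from the columns of \<open>M\<close>, and the second collects the diagonal
  entries of \<open>B ** M\<close>, whence the trace.\<close>

lemma f_map_mv:
  "f_map B S ((*v) M) t = (if t \<in> S then M *v t + trace (B ** M) *s t else 0)"
proof (cases "t \<in> S")
  case True
  have "f_map B S ((*v) M) t
      = (\<Sum>i\<in>UNIV. t $ i *s (M *v axis i 1)) + (\<Sum>i\<in>UNIV. (B *v (M *v axis i 1)) $ i) *s t"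
    using True by (simp add: f_map_def sum_fun_apply f_pure_def sum.distrib vec.scale_sum_left)
  also have "(\<Sum>i\<in>UNIV. t $ i *s (M *v axis i 1)) = M *v (\<Sum>i\<in>UNIV. t $ i *s axis i 1)"
    by (simp add: vec.sum vec.scale)
  also have "(\<Sum>i\<in>UNIV. (B *v (M *v axis i 1)) $ i) = trace (B ** M)"
    by (simp add: matrix_vector_mul_assoc mv_axis trace_def)
  finally show ?thesis using True by (simp add: basis_expansion)
qed (simp add: f_map_def sum_fun_apply f_pure_def)

lemma fib_E_dual: "fib (E_dual k B) S = (\<lambda>M. (*v) M) ` KM B S"
proof -
  have "f_map B S ((*v) M) = 0 \<longleftrightarrow> (\<forall>t\<in>S. M *v t + trace (B ** M) *s t = 0)" for M
    by (auto simp: fun_eq_iff f_map_mv zero_fun_def)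
  thus ?thesis
    by (auto simp: E_dual_def kernel_bundle_def subbundle_def fib_VS KM_def)
qed

lemma inj_mv: "inj (\<lambda>M :: complex ^ 'n ^ 'n. (*v) M)"
  by (rule injI) (metis matrix_mv)

lemma mv_in_fib_E_dual [simp]: "(*v) M \<in> fib (E_dual k B) S \<longleftrightarrow> M \<in> KM B S"
  by (simp add: fib_E_dual inj_image_mem_iff[OF inj_mv])

lemma scl_E_dual: "scl (E_dual k B) c ((*v) M) = (*v) (mat c ** M)"
  by (simp add: E_dual_def kernel_bundle_def subbundle_def VS_bundle_def hom_bundle_def Let_def
      tautological_def trivial_bundle_def mat_mult_mv fun_eq_iff)

lemma mv_plus: "(*v) M + (*v) N = (*v) (M + N :: complex ^ 'n ^ 'n)"
  by (simp add: fun_eq_iff matrix_vector_mult_add_rdistrib)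

lemma KM_add:
  assumes "vec.subspace S" "M \<in> KM B S" "N \<in> KM B S"
  shows "M + N \<in> KM B S"
proof -
  have "(M + N) *v t + trace (B ** (M + N)) *s t = (M *v t + trace (B ** M) *s t) + (N *v t + trace (B ** N) *s t)" for t
    by (simp add: matrix_add_ldistrib trace_add matrix_vector_mult_add_rdistrib vec.scale_left_distrib)
  moreover have "(M + N) *v v \<in> S" for v
    using assms by (auto simp: KM_def matrix_vector_mult_add_rdistrib vec.subspace_add)
  ultimately show ?thesis using assms(2,3) by (simp only: KM_def mem_Collect_eq) simp
qed

lemma KM_scale:
  assumes "vec.subspace S" "M \<in> KM B S"
  shows "mat c ** M \<in> KM B S"
proof -
  have "(mat c ** M) *v t + trace (B ** (mat c ** M)) *s t = c *s (M *v t + trace (B ** M) *s t)" for t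
    by (simp add: mat_mult_assoc_right trace_mat_mult mat_mult_mv vec.scale_right_distrib)
  moreover have "(mat c ** M) *v v \<in> S" for v
    using assms by (auto simp: KM_def mat_mult_mv vec.subspace_scale)
  ultimately show ?thesis using assms(2) by (simp only: KM_def mem_Collect_eq) simp
qed

text \<open>Testing on all local sections amounts to testing matrix entries: the constant basis
  vectors are admissible tests, and every test is a combination of them with holomorphic
  coefficients.\<close>

lemma sec_E_dual_iff:
  fixes U :: "(complex ^ 'n) set set"
  assumes U: "openin (topo (Gr k)) U"
  shows "\<phi> \<in> sec (E_dual k B) U \<longleftrightarrow> (\<forall>S\<in>U. \<phi> S \<in> fib (E_dual k B) S) \<and>
    (\<forall>i j. \<forall>S\<in>U. hol_at (\<lambda>S. \<phi> S (axis j 1) $ i) S)" (is "?L \<longleftrightarrow> ?F \<and> ?H")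
proof -
  have sub: "W \<subseteq> grass k" if "openin (topo (Gr k)) W" for W :: "(complex ^ 'n) set set"
    using that by (simp add: openin_Gr)
  have fib: "sec (E_dual k B) U = {\<phi> \<in> sec (VS_bundle k) U. \<forall>S\<in>U. \<phi> S \<in> fib (E_dual k B) S}"
    by (simp add: E_dual_def kernel_bundle_def subbundle_def)
  have VS: "sec (VS_bundle k) U = {\<phi>. (\<forall>x\<in>U. \<phi> x \<in> fib (VS_bundle k) x) \<and>
      (\<forall>W (s :: _ \<Rightarrow> complex ^ 'n). openin (topo (Gr k)) W \<and> W \<subseteq> U \<and> (\<forall>i. (\<lambda>x. s x $ i) \<in> hol (Gr k) W)
        \<longrightarrow> (\<forall>i. (\<lambda>x. \<phi> x (s x) $ i) \<in> hol (Gr k) W) \<and> (\<forall>x\<in>W. \<phi> x (s x) \<in> x))}"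
    by (simp add: VS_bundle_def hom_bundle_def Let_def trivial_bundle_def tautological_def
        subbundle_def)
  have inVS: "\<phi> S \<in> fib (VS_bundle k) S" if "\<phi> S \<in> fib (E_dual k B) S" for S
    using that by (auto simp: fib_E_dual fib_VS KM_def)
  show ?thesis
  proof
    assume L: ?L
    hence ?F by (simp add: fib)
    moreover have "hol_at (\<lambda>S. \<phi> S (axis j 1) $ i) S" if "S \<in> U" for i j S
    proof -
      have "(\<lambda>x. axis j 1 $ i) \<in> hol (Gr k) U" for i
        by (simp add: hol_iff[OF sub[OF U]] hol_at_def)
      moreover have "\<forall>W (s :: _ \<Rightarrow> complex ^ 'n). openin (topo (Gr k)) W \<and> W \<subseteq> U \<and> (\<forall>i. (\<lambda>x. s x $ i) \<in> hol (Gr k) W)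
          \<longrightarrow> (\<forall>i. (\<lambda>x. \<phi> x (s x) $ i) \<in> hol (Gr k) W) \<and> (\<forall>x\<in>W. \<phi> x (s x) \<in> x)"
        using L unfolding fib VS by simp
      note this[rule_format, of U "\<lambda>_. axis j 1"]
      ultimately have "(\<lambda>x. \<phi> x (axis j 1) $ i) \<in> hol (Gr k) U" using U by simp
      thus ?thesis using that by (simp add: hol_iff[OF sub[OF U]])
    qed
    ultimately show "?F \<and> ?H" by blast
  next
    assume FH: "?F \<and> ?H"
    show ?L unfolding fib VS
    proof (intro CollectI conjI allI impI ballI; (elim conjE)?)
      show "\<phi> S \<in> fib (E_dual k B) S" "\<phi> S \<in> fib (VS_bundle k) S" if "S \<in> U" for S
        using FH that inVS by auto
      fix W and s :: "_ \<Rightarrow> complex ^ 'n" assume W: "openin (topo (Gr k)) W" "W \<subseteq> U" and s: "\<forall>i. (\<lambda>x. s x $ i) \<in> hol (Gr k) W"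
      show "\<phi> x (s x) \<in> x" if "x \<in> W" for x
      proof -
        have "\<phi> x \<in> fib (VS_bundle k) x" using inVS FH that W(2) by blast
        thus ?thesis by (auto simp: fib_VS)
      qed
      fix i
      show "(\<lambda>x. \<phi> x (s x) $ i) \<in> hol (Gr k) W"
        unfolding hol_iff[OF sub[OF W(1)]]
      proof
        fix S assume S: "S \<in> W"
        have eq: "\<phi> T (s T) $ i = (\<Sum>j\<in>UNIV. \<phi> T (axis j 1) $ i * s T $ j)" if "T \<in> W" for T
        proof -
          have "\<phi> T \<in> (\<lambda>M. (*v) M) ` KM B T"
            using FH that W(2) unfolding fib_E_dual by blast
          then obtain M where M: "\<phi> T = (*v) M" by blast
          show ?thesis by (simp add: M mv_axis) (simp add: matrix_vector_mult_def)
        qed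
        have "hol_at (\<lambda>T. \<Sum>j\<in>UNIV. \<phi> T (axis j 1) $ i * s T $ j) S"
          unfolding hol_at_def using FH S W(2) s
          by (intro cdiff_sum cdiff_mult) (auto simp: hol_iff[OF sub[OF W(1)]] hol_at_def)
        thus "hol_at (\<lambda>x. \<phi> x (s x) $ i) S"
          using hol_at_cong[OF W(1) S eq] by simp
      qed
    qed
  qed
qed

lemma fib_E_bundle: "fib (E_bundle k B) S = {e.
    (\<forall>M\<in>KM B S. \<forall>N\<in>KM B S. e ((*v) (M + N)) = e ((*v) M) + e ((*v) N)) \<and>
    (\<forall>c. \<forall>M\<in>KM B S. e ((*v) (mat c ** M)) = c * e ((*v) M)) \<and>
    (\<forall>\<phi>. \<phi> \<notin> fib (E_dual k B) S \<longrightarrow> e \<phi> = 0)}"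
  unfolding E_bundle_def dual_bundle_def hom_bundle_def Let_def
  by (auto simp: fib_E_dual trivial_line_def scl_E_dual mv_plus)

lemma scl_E_bundle: "scl (E_bundle k B) c e = (\<lambda>\<phi>. c * e \<phi>)"
  by (simp add: E_bundle_def dual_bundle_def hom_bundle_def Let_def trivial_line_def)

lemma sec_E_bundle: "e \<in> sec (E_bundle k B) U \<longleftrightarrow> (\<forall>S\<in>U. e S \<in> fib (E_bundle k B) S) \<and>
    (\<forall>W \<phi>. openin (topo (Gr k)) W \<and> W \<subseteq> U \<and> \<phi> \<in> sec (E_dual k B) W
       \<longrightarrow> (\<lambda>S. e S (\<phi> S)) \<in> hol (Gr k) W)"
proof -
  have "\<forall>S\<in>W. \<phi> S \<in> fib (E_dual k B) S" if "\<phi> \<in> sec (E_dual k B) W" for W \<phi>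
    using that by (simp add: E_dual_def kernel_bundle_def subbundle_def)
  thus ?thesis
    unfolding E_bundle_def dual_bundle_def hom_bundle_def Let_def
    by (auto simp: trivial_line_def)
qed

text \<open>The value 0 off the fibre follows the convention of \<open>hom_bundle\<close>, so that
  equal functionals are equal as functions. As \<open>A\<close> does not depend on \<open>S\<close>,
  every matrix yields a section over the whole Grassmannian.\<close>

definition trace_form ::
    "nat \<Rightarrow> complex ^ 'n ^ 'n \<Rightarrow> complex ^ 'n ^ 'n \<Rightarrow> (complex ^ 'n) set \<Rightarrow> (complex ^ 'n \<Rightarrow> complex ^ 'n) \<Rightarrow> complex"
  where "trace_form k B A S = (\<lambda>\<phi>. if \<phi> \<in> fib (E_dual k B) S then trace (matrix \<phi> ** A) else 0)"

lemma trace_form_mv [simp]: "M \<in> KM B S \<Longrightarrow> trace_form k B A S ((*v) M) = trace (M ** A)"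
  by (simp add: trace_form_def)

lemma trace_form_in_fib:
  assumes "S \<in> grass k"
  shows "trace_form k B A S \<in> fib (E_bundle k B) S"
proof -
  have S: "vec.subspace S" using assms by (simp add: grass_def)
  show ?thesis
    by (simp add: fib_E_bundle KM_add[OF S] KM_scale[OF S] matrix_mult_add_left trace_add
        matrix_mul_assoc[symmetric] trace_mat_mult) (simp add: trace_form_def)
qed

lemma trace_form_add: "trace_form k B (A + A') S = trace_form k B A S + trace_form k B A' S"
  by (simp add: fun_eq_iff trace_form_def matrix_add_ldistrib trace_add)

lemma trace_form_scale: "trace_form k B (mat c ** A) S = scl (E_bundle k B) c (trace_form k B A S)"
  by (simp add: fun_eq_iff trace_form_def scl_E_bundle mat_mult_assoc_right trace_mat_mult)

lemma trace_form_section: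
  assumes "openin (topo (Gr k)) U"
  shows "trace_form k B A \<in> sec (E_bundle k B) U"
  unfolding sec_E_bundle
proof (intro conjI allI impI ballI; (elim conjE)?)
  show "trace_form k B A S \<in> fib (E_bundle k B) S" if "S \<in> U" for S
    using trace_form_in_fib[of S k] that assms by (auto simp only: openin_Gr)
  fix W \<phi> assume W: "openin (topo (Gr k)) W" "\<phi> \<in> sec (E_dual k B) W"
  hence sub: "W \<subseteq> grass k" by (simp add: openin_Gr)
  have \<phi>: "\<forall>S\<in>W. \<phi> S \<in> fib (E_dual k B) S" "\<And>i j. \<forall>S\<in>W. hol_at (\<lambda>S. \<phi> S (axis j 1) $ i) S"
    using W(2) by (auto simp: sec_E_dual_iff[OF W(1)])
  show "(\<lambda>S. trace_form k B A S (\<phi> S)) \<in> hol (Gr k) W"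
    unfolding hol_iff[OF sub]
  proof
    fix S assume S: "S \<in> W"
    have eq: "trace_form k B A T (\<phi> T) = (\<Sum>i\<in>UNIV. \<Sum>j\<in>UNIV. \<phi> T (axis j 1) $ i * A $ j $ i)"
      if "T \<in> W" for T
      using \<phi>(1) that by (simp add: trace_form_def trace_mult matrix_def)
    have "hol_at (\<lambda>T. \<Sum>i\<in>UNIV. \<Sum>j\<in>UNIV. \<phi> T (axis j 1) $ i * A $ j $ i) S"
      unfolding hol_at_def using \<phi>(2) S
      by (intro cdiff_sum cdiff_mult cdiff_const) (auto simp: hol_at_def)
    thus "hol_at (\<lambda>S. trace_form k B A S (\<phi> S)) S"
      using hol_at_cong[OF W(1) S eq] by simp
  qed
qed

section \<open>Isomorphism of bundles as a symmetric and transitive relation\<close>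

lemma bundle_iso_sym: "bundle_iso X E F \<Longrightarrow> bundle_iso X F E"
  unfolding bundle_iso_def by blast

lemma hom_bundle_sec_comp:
  assumes P: "\<Phi> \<in> sec (hom_bundle X E F) U" and Q: "\<Psi> \<in> sec (hom_bundle X F G) U"
  shows "(\<lambda>x v. \<Psi> x (\<Phi> x v)) \<in> sec (hom_bundle X E G) U"
proof -
  \<comment> \<open>The composite must vanish off the fibres of \<open>E\<close>, where
    \<open>\<Phi> x\<close> is 0. In an arbitrary \<open>F\<close> the vector 0 may lie outside the
    fibre, hence the case distinction.\<close>
  have z: "\<Psi> x 0 = 0" if "x \<in> U" for x
  proof (cases "0 \<in> fib F x")
    case True
    hence "\<Psi> x (0 + 0) = \<Psi> x 0 + \<Psi> x 0"
      using Q that unfolding hom_bundle_def Let_def by (simp del: add_0 add_0_left add_0_right)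
    thus ?thesis by simp
  qed (use Q that in \<open>simp add: hom_bundle_def Let_def\<close>)
  have "(\<lambda>x. \<Psi> x (\<Phi> x (s x))) \<in> sec G W"
    if W: "openin (topo X) W" "W \<subseteq> U" "s \<in> sec E W" "\<forall>x\<in>W. s x \<in> fib E x" for W s
  proof -
    have "(\<lambda>x. \<Phi> x (s x)) \<in> sec F W" using P W by (simp add: hom_bundle_def Let_def)
    moreover have "\<forall>x\<in>W. \<Phi> x (s x) \<in> fib F x"
      using P W unfolding hom_bundle_def Let_def by auto
    ultimately show ?thesis using Q W(1,2) by (simp add: hom_bundle_def Let_def)
  qed
  thus ?thesis using P Q z unfolding hom_bundle_def Let_def by auto
qed

lemma bundle_iso_trans:
  assumes "bundle_iso X E F" "bundle_iso X F G"
  shows "bundle_iso X E G"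
proof -
  let ?U = "topspace (topo X)"
  obtain \<Phi> \<Psi> where 1: "\<Phi> \<in> sec (hom_bundle X E F) ?U" "\<Psi> \<in> sec (hom_bundle X F E) ?U"
    "\<forall>x\<in>?U. (\<forall>v\<in>fib E x. \<Psi> x (\<Phi> x v) = v) \<and> (\<forall>w\<in>fib F x. \<Phi> x (\<Psi> x w) = w)"
    using assms(1) unfolding bundle_iso_def by blast
  obtain \<Phi>' \<Psi>' where 2: "\<Phi>' \<in> sec (hom_bundle X F G) ?U" "\<Psi>' \<in> sec (hom_bundle X G F) ?U"
    "\<forall>x\<in>?U. (\<forall>v\<in>fib F x. \<Psi>' x (\<Phi>' x v) = v) \<and> (\<forall>w\<in>fib G x. \<Phi>' x (\<Psi>' x w) = w)"
    using assms(2) unfolding bundle_iso_def by blast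
  have m: "\<forall>x\<in>?U. \<forall>v\<in>fib E x. \<Phi> x v \<in> fib F x" "\<forall>x\<in>?U. \<forall>v\<in>fib G x. \<Psi>' x v \<in> fib F x"
    using 1(1) 2(2) unfolding hom_bundle_def Let_def by auto
  show ?thesis unfolding bundle_iso_def
    by (rule exI[of _ "\<lambda>x v. \<Phi>' x (\<Phi> x v)"], rule exI[of _ "\<lambda>x v. \<Psi> x (\<Psi>' x v)"],
        intro conjI hom_bundle_sec_comp[OF 1(1) 2(1)] hom_bundle_sec_comp[OF 2(2) 1(2)])
      (use 1(3) 2(3) m in simp)
qed

section \<open>The tangent bundle of the Grassmannian\<close>

lemma dird_matrix_mult:
  fixes M N :: "complex ^ 'n ^ 'n \<Rightarrow> complex ^ 'n ^ 'n"
  assumes "\<And>i j. cdiff (\<lambda>x. M x $ i $ j) g" "\<And>i j. cdiff (\<lambda>x. N x $ i $ j) g"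
  shows "dird (\<lambda>x. (M x ** N x) $ i $ j) g A =
    (M g ** (\<chi> i j. dird (\<lambda>x. N x $ i $ j) g A) + (\<chi> i j. dird (\<lambda>x. M x $ i $ j) g A) ** N g) $ i $ j"
  unfolding matrix_matrix_mult_def
  by (simp add: dird_sum cdiff_mult dird_mult assms sum.distrib mult.commute)

lemma hol_near_hol_at: "f \<in> hol_near (Gr k) S \<Longrightarrow> hol_at f S"
  by (auto simp: hol_near_iff)

lemma hol_nearI: "openin (topo (Gr k)) U \<Longrightarrow> S \<in> U \<Longrightarrow> (\<And>T. T \<in> U \<Longrightarrow> hol_at f T) \<Longrightarrow> f \<in> hol_near (Gr k) S"
  by (auto simp: hol_near_iff)

lemma hol_near_combine:
  assumes "f \<in> hol_near (Gr k) S" "h \<in> hol_near (Gr k) S"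
    and "\<And>T. hol_at f T \<Longrightarrow> hol_at h T \<Longrightarrow> hol_at q T"
  shows "q \<in> hol_near (Gr k) S"
proof -
  obtain U W where "openin (topo (Gr k)) U" "S \<in> U" "\<forall>T\<in>U. hol_at f T"
    "openin (topo (Gr k)) W" "S \<in> W" "\<forall>T\<in>W. hol_at h T"
    using assms(1,2) unfolding hol_near_iff by blast
  thus ?thesis
    by (intro hol_nearI[of k "U \<inter> W"]) (auto intro: assms(3))
qed

lemma hol_near_add: "f \<in> hol_near (Gr k) S \<Longrightarrow> h \<in> hol_near (Gr k) S \<Longrightarrow> (\<lambda>x. f x + h x) \<in> hol_near (Gr k) S"
  by (rule hol_near_combine[of f k S h]) (auto simp: hol_at_def intro: cdiff_add)

lemma hol_near_mult: "f \<in> hol_near (Gr k) S \<Longrightarrow> h \<in> hol_near (Gr k) S \<Longrightarrow> (\<lambda>x. f x * h x) \<in> hol_near (Gr k) S"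
  by (rule hol_near_combine[of f k S h]) (auto simp: hol_at_def intro: cdiff_mult)

lemma hol_near_const:
  assumes "S \<in> grass k" shows "(\<lambda>x. c) \<in> hol_near (Gr k) S"
proof (rule hol_nearI)
  show "openin (topo (Gr k)) (grass k)" using openin_topspace[of "topo (Gr k)"] by (simp add: topspace_Gr)
qed (auto simp: hol_at_def assms)

lemma hol_near_sum:
  assumes "S \<in> grass k" "\<And>i. i \<in> I \<Longrightarrow> f i \<in> hol_near (Gr k) S"
  shows "(\<lambda>x. \<Sum>i\<in>I. f i x) \<in> hol_near (Gr k) S"
  using assms(2) by (induction I rule: infinite_finite_induct) (auto simp: hol_near_const[OF assms(1)] hol_near_add)

lemma hol_near_chart_proj:
  assumes "P0 ** P0 = P0" "range ((*v) P0) \<in> grass k" "S \<in> chart P0"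
  shows "(\<lambda>T. chart_proj P0 T $ i $ j) \<in> hol_near (Gr k) S"
  by (rule hol_nearI[OF openin_chart[OF assms(1,2)] assms(3)]) (rule chart_proj_hol_at[OF assms(1)])

text \<open>The derivation at \<open>S\<close> given by the velocity of the curve \<open>exp (t A) S\<close>.\<close>

definition velocity ::
    "nat \<Rightarrow> complex ^ 'n ^ 'n \<Rightarrow> (complex ^ 'n) set \<Rightarrow> ((complex ^ 'n) set \<Rightarrow> complex) \<Rightarrow> complex" where
  "velocity k A S = (\<lambda>f. if f \<in> hol_near (Gr k) S then dG f S A else 0)"

lemma velocity_in_tangent_space:
  assumes S: "S \<in> grass k"
  shows "velocity k A S \<in> tangent_space (Gr k) S"
  unfolding tangent_space_def
proof (intro CollectI conjI ballI allI impI)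
  fix f g assume f: "f \<in> hol_near (Gr k) S" and g: "g \<in> hol_near (Gr k) S"
  note fg = hol_near_hol_at[OF f, unfolded hol_at_def] hol_near_hol_at[OF g, unfolded hol_at_def]
  show "velocity k A S (\<lambda>y. f y + g y) = velocity k A S f + velocity k A S g"
    by (simp add: velocity_def f g hol_near_add dird_add fg)
  show "velocity k A S (\<lambda>y. f y * g y) = f S * velocity k A S g + g S * velocity k A S f"
    by (simp add: velocity_def f g hol_near_mult dird_mult fg)
  assume "\<exists>U. openin (topo (Gr k)) U \<and> S \<in> U \<and> (\<forall>y\<in>U. f y = g y)"
  then obtain U where "openin (topo (Gr k)) U" "S \<in> U" "\<forall>y\<in>U. f y = g y" by blast
  thus "velocity k A S f = velocity k A S g"
    using dG_cong[of k U S f g] hol_near_hol_at[OF f] f g by (simp add: velocity_def)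
next
  fix c f assume f: "f \<in> hol_near (Gr k) S"
  note fc = hol_near_hol_at[OF f, unfolded hol_at_def]
  show "velocity k A S (\<lambda>y. c * f y) = c * velocity k A S f"
    by (simp add: velocity_def f hol_near_mult hol_near_const S dird_mult fc)
qed (simp add: velocity_def)

lemma dG_linear: "hol_at f S \<Longrightarrow> linear (dG f S)"
  unfolding hol_at_def by (rule dird_linear)

lemma velocity_add: "velocity k (A + A') S = velocity k A S + velocity k A' S"
  by (auto simp: fun_eq_iff velocity_def linear_add[OF dG_linear[OF hol_near_hol_at]])

lemma velocity_scale: "velocity k (mat c ** A) S = (\<lambda>f. c * velocity k A S f)"
  by (auto simp: fun_eq_iff velocity_def dest!: hol_near_hol_at simp: hol_at_def dird_mat)

text \<open>Write \<open>p\<close> for the chart projection and \<open>X\<close> for its derivative.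
  Differentiating \<open>p (g S) ** g ** P = g ** P\<close> at \<open>g = 1\<close> gives
  \<open>P ** A ** P + X ** P = A ** P\<close>, and multiplication by \<open>M\<close> from the left
  kills the first term. So the pairing of \<open>M\<close> with a tangent vector is determined by
  the values of this vector on the chart coordinates.\<close>

lemma dG_chart_proj:
  assumes P0: "P0 ** P0 = P0" and S: "S \<in> chart P0" and M: "\<forall>v. M *v v \<in> S" "\<forall>v\<in>S. M *v v = 0"
  shows "trace (M ** (\<chi> i j. dG (\<lambda>T. chart_proj P0 T $ i $ j) S A)) = trace (M ** A)"
proof -
  define P where "P = chart_proj P0 S"
  define X where "X = (\<chi> i j. dG (\<lambda>T. chart_proj P0 T $ i $ j) S A)"
  obtain V where V: "open V" "mat 1 \<in> V" "\<forall>g\<in>V. invertible g \<and> (*v) g ` S \<in> chart P0"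
    using chart_near[OF P0 S] by blast
  have PinS: "P *v v \<in> S" for v unfolding P_def by (rule chart_proj_in[OF S])
  have eq: "(chart_proj P0 ((*v) g ` S) ** (g ** P)) $ i $ j = (g ** P) $ i $ j" if "g \<in> V" for g i j
  proof -
    have "chart_proj P0 ((*v) g ` S) *v (g *v (P *v v)) = g *v (P *v v)" for v
      using chart_proj_eq_iff[of "(*v) g ` S" P0] V(3) that PinS by blast
    hence "chart_proj P0 ((*v) g ` S) ** (g ** P) = g ** P"
      by (simp add: matrix_eq matrix_vector_mul_assoc[symmetric])
    thus ?thesis by simp
  qed
  have pc: "cdiff (\<lambda>g. chart_proj P0 ((*v) g ` S) $ i $ j) (mat 1)" for i j
    using chart_proj_hol_at[OF P0 S] by (simp add: hol_at_def)
  have "dird (\<lambda>g. (chart_proj P0 ((*v) g ` S) ** (g ** P)) $ i $ j) (mat 1) A = (A ** P) $ i $ j" for i j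
  proof -
    have "dird (\<lambda>g. (chart_proj P0 ((*v) g ` S) ** (g ** P)) $ i $ j) (mat 1)
        = dird (\<lambda>g. (g ** P) $ i $ j) (mat 1)"
      by (rule cdiff_cong_open(2)[OF V(1,2)], erule eq)
        (intro cdiff_matrix_mult pc cdiff_mult_const)
    thus ?thesis by (simp add: dird_mult_const)
  qed
  hence "(P ** (A ** P) + X ** P) $ i $ j = (A ** P) $ i $ j" for i j
    by (subst (asm) dird_matrix_mult) (auto intro!: pc cdiff_mult_const simp: dird_mult_const vec_lambda_eta X_def P_def)
  hence PX: "P ** (A ** P) + X ** P = A ** P" by (simp add: vec_eq_iff)
  have MP: "M ** P = 0" using M(2) PinS by (simp add: matrix_eq matrix_vector_mul_assoc[symmetric])
  have PM: "P ** M = M"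
    using M(1) chart_proj_eq_iff[OF S] by (simp add: matrix_eq matrix_vector_mul_assoc[symmetric] P_def)
  have "M ** A ** P = M ** (P ** (A ** P) + X ** P)" unfolding PX by (simp add: matrix_mul_assoc)
  also have "\<dots> = M ** P ** A ** P + M ** X ** P" by (simp add: matrix_add_ldistrib matrix_mul_assoc)
  also have "\<dots> = M ** X ** P" by (simp add: MP)
  finally have "trace (M ** A ** P) = trace (M ** X ** P)" by simp
  moreover have "trace (M ** Y ** P) = trace (M ** Y)" for Y
    using trace_mul_sym[of P "M ** Y"] by (simp add: matrix_mul_assoc PM)
  ultimately show ?thesis by (simp add: X_def)
qed

text \<open>For small \<open>z\<close> the matrix \<open>1 + z C\<close> is invertible and maps
  \<open>S\<close> onto itself, so \<open>f\<close> is constant along this curve.\<close>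

lemma dG_stabiliser:
  assumes S: "S \<in> grass k" and C: "\<forall>v\<in>S. C *v v \<in> S" and f: "hol_at f S"
  shows "dG f S C = 0"
proof -
  let ?g = "\<lambda>z. mat 1 + mat z ** C"
  have sub: "vec.subspace S" using S by (simp add: grass_def)
  have stab: "(*v) (?g z) ` S = S" if "invertible (?g z)" for z
  proof (rule vec.subspace_dim_equal)
    have "?g z *v v \<in> S" if "v \<in> S" for v
      using that C sub by (simp add: matrix_vector_mult_add_rdistrib mat_mult_mv vec.subspace_add vec.subspace_scale)
    thus "(*v) (?g z) ` S \<subseteq> S" by blast
    show "vec.subspace ((*v) (?g z) ` S)" "vec.dim S \<le> vec.dim ((*v) (?g z) ` S)"
      using image_mem_grass[OF that S] S by (auto simp: grass_def)
  qed (rule sub)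
  let ?F = "\<lambda>g. f ((*v) g ` S)"
  have g0: "?g 0 = mat 1" by (simp add: vec_eq_iff)
  have "continuous_on UNIV (\<lambda>z. det (?g z))"
    unfolding det_def vector_add_component mat_mult_nth by (intro continuous_intros)
  hence op: "open ((\<lambda>z. det (?g z)) -` (- {0}))" by (intro open_vimage) auto
  have d: "((\<lambda>z. ?F (?g z)) has_field_derivative dG f S C) (at 0)"
    using cdiff_line[of ?F "mat 1" 0 C] f unfolding hol_at_def g0 by simp
  have "((\<lambda>z. f S) has_field_derivative dG f S C) (at 0)"
    by (rule has_field_derivative_transform_within_open[OF d op])
      (auto simp: g0 invertible_det_nz[symmetric] stab)
  thus ?thesis using DERIV_const DERIV_unique by blast
qed

section \<open>Cotangent spaces and equality of velocities\<close>

text \<open>With \<open>V\<close> the whole space this is Hom(V/S, S), the cotangent space of the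
  Grassmannian at \<open>S\<close>.\<close>

definition K0 :: "(complex ^ 'n) set \<Rightarrow> (complex ^ 'n ^ 'n) set" where
  "K0 S = {M. (\<forall>v. M *v v \<in> S) \<and> (\<forall>v\<in>S. M *v v = 0)}"

lemma K0_sandwich:
  assumes "P ** P = P" "range ((*v) P) = S"
  shows "P ** X ** (mat 1 - P) \<in> K0 S"
proof -
  have "P *v v \<in> S" for v using assms(2) by auto
  moreover have "(P ** X ** (mat 1 - P)) *v v = 0" if "v \<in> S" for v
    using that range_projection[OF assms(1), of v] assms(2)
    by (simp add: matrix_vector_mul_assoc[symmetric] matrix_vector_mult_diff_rdistrib)
  ultimately show ?thesis by (simp add: K0_def matrix_vector_mul_assoc[symmetric])
qed

lemma K0_eq_sandwich:
  assumes "P ** P = P" "range ((*v) P) = S" "M \<in> K0 S"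
  shows "P ** M ** (mat 1 - P) = M" "P ** M = M" "M ** P = 0"
proof -
  have "P *v v \<in> S" for v using assms(2) by auto
  thus MP: "M ** P = 0" using assms(3)
    by (simp add: K0_def matrix_eq matrix_vector_mul_assoc[symmetric])
  show PM: "P ** M = M" using assms(3) range_projection[OF assms(1)] assms(2)
    by (simp add: K0_def matrix_eq matrix_vector_mul_assoc[symmetric])
  show "P ** M ** (mat 1 - P) = M" by (simp add: PM MP matrix_mult_diff_right)
qed

text \<open>Both sides say that \<open>A - A'\<close> maps \<open>S\<close> into itself. Equal
  velocities agree on chart coordinates and thus pair equally with \<open>K0 S\<close>. Equal
  pairings give \<open>(1 - P) (A - A') P = 0\<close> because the trace form is nondegenerate, and
  then \<open>dG_stabiliser\<close> applies to \<open>A - A'\<close>.\<close>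

lemma velocity_eq_iff:
  assumes S: "S \<in> grass k"
  shows "velocity k A S = velocity k A' S \<longleftrightarrow> (\<forall>M\<in>K0 S. trace (M ** A) = trace (M ** A'))"
proof
  obtain P where P: "P ** P = P" "range ((*v) P) = S" using S by (rule projection_exists)
  {
    assume eq: "velocity k A S = velocity k A' S"
    note ch = chart_proj_self(1)[OF P]
    have d: "dG (\<lambda>T. chart_proj P T $ i $ j) S A = dG (\<lambda>T. chart_proj P T $ i $ j) S A'" for i j
      using fun_cong[OF eq, of "\<lambda>T. chart_proj P T $ i $ j"] hol_near_chart_proj[OF P(1) _ ch] S P(2)
      by (simp add: velocity_def)
    show "\<forall>M\<in>K0 S. trace (M ** A) = trace (M ** A')"
    proof
      fix M assume "M \<in> K0 S"
      thus "trace (M ** A) = trace (M ** A')"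
        using dG_chart_proj[OF P(1) ch, of M A] dG_chart_proj[OF P(1) ch, of M A']
        by (simp add: K0_def d)
    qed
  next
    assume tr: "\<forall>M\<in>K0 S. trace (M ** A) = trace (M ** A')"
    have "trace (X ** ((mat 1 - P) ** (A - A') ** P)) = 0" for X
    proof -
      have "trace (X ** ((mat 1 - P) ** (A - A') ** P)) = trace (P ** X ** (mat 1 - P) ** (A - A'))"
        using trace_mul_sym[of "X ** (mat 1 - P) ** (A - A')" P] by (simp add: matrix_mul_assoc)
      also have "\<dots> = 0"
        using tr K0_sandwich[OF P] by (simp only: matrix_mult_diff_right[of _ A A'] trace_sub) simp
      finally show ?thesis .
    qed
    hence 0: "(mat 1 - P) ** (A - A') ** P = 0" by (rule trace_mult_all_zero)
    have "(A - A') *v v \<in> S" if "v \<in> S" for v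
    proof -
      have "P *v v = v" using that range_projection[OF P(1)] P(2) by simp
      hence "(mat 1 - P) *v ((A - A') *v v) = 0"
        using arg_cong[OF 0, of "\<lambda>M. M *v v"] by (simp add: matrix_vector_mul_assoc[symmetric])
      hence "P *v ((A - A') *v v) = (A - A') *v v" by (simp add: matrix_vector_mult_diff_rdistrib)
      thus ?thesis using range_projection[OF P(1)] P(2) by simp
    qed
    hence "dG f S (A - A') = 0" if "hol_at f S" for f using dG_stabiliser[OF S _ that] by blast
    hence "dG f S A = dG f S A'" if "hol_at f S" for f
      using that linear_diff[OF dG_linear[OF that], of A A'] by simp
    thus "velocity k A S = velocity k A' S"
      by (auto simp: velocity_def fun_eq_iff dest: hol_near_hol_at)
  }
qed

section \<open>Derivations of germs are velocities\<close>

lemma continuous_on_matrix: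
  fixes N :: "'a::topological_space \<Rightarrow> complex ^ 'n ^ 'n"
  assumes "\<And>i j. continuous_on A (\<lambda>x. N x $ i $ j)"
  shows "continuous_on A N"
proof -
  have "continuous_on A (\<lambda>x. \<chi> i j. N x $ i $ j)"
    by (intro continuous_on_vec_lambda assms)
  thus ?thesis by (simp add: vec_lambda_eta)
qed

lemma openin_chart_vimage:
  fixes P0 :: "complex ^ 'n ^ 'n"
  assumes P0: "P0 ** P0 = P0" "range ((*v) P0) \<in> grass k" and G: "open G"
  shows "openin (topo (Gr k)) {T \<in> chart P0. chart_proj P0 T \<in> G}"
  unfolding openin_Gr
proof (intro conjI ballI)
  show "{T \<in> chart P0. chart_proj P0 T \<in> G} \<subseteq> grass k"
    using openin_chart[OF P0] by (auto simp: openin_Gr)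
  fix S :: "(complex ^ 'n) set" assume S: "S \<in> grass k"
  let ?O = "orbit_preimage S (chart P0)"
  have O: "open ?O" using openin_chart[OF P0] S by (simp add: openin_Gr)
  have "continuous_on ?O (\<lambda>g. chart_proj P0 ((*v) g ` S))"
  proof (intro continuous_on_matrix continuous_on_cdiff)
    fix i j g assume "g \<in> ?O"
    thus "cdiff (\<lambda>g. chart_proj P0 ((*v) g ` S) $ i $ j) g"
      using cdiff_orbit[of g "\<lambda>T. chart_proj P0 T $ i $ j" S] chart_proj_hol_at[OF P0(1)]
      by (simp add: orbit_preimage_def)
  qed
  from continuous_open_preimage[OF this O G]
  have "open (?O \<inter> (\<lambda>g. chart_proj P0 ((*v) g ` S)) -` G)" .
  moreover have "orbit_preimage S {T \<in> chart P0. chart_proj P0 T \<in> G}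
      = ?O \<inter> (\<lambda>g. chart_proj P0 ((*v) g ` S)) -` G"
    by (auto simp: orbit_preimage_def)
  ultimately show "open (orbit_preimage S {T \<in> chart P0. chart_proj P0 T \<in> G})" by simp
qed

lemma
  assumes D: "D \<in> tangent_space (Gr k) S" and f: "f \<in> hol_near (Gr k) S" and g: "g \<in> hol_near (Gr k) S"
  shows tangent_add: "D (\<lambda>y. f y + g y) = D f + D g"
    and tangent_mult: "D (\<lambda>y. f y * g y) = f S * D g + g S * D f"
    and tangent_cong: "openin (topo (Gr k)) U \<Longrightarrow> S \<in> U \<Longrightarrow> \<forall>y\<in>U. f y = g y \<Longrightarrow> D f = D g"
proof -
  show "D (\<lambda>y. f y + g y) = D f + D g" "D (\<lambda>y. f y * g y) = f S * D g + g S * D f"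
    using D f g by (auto simp add: tangent_space_def)
  assume "openin (topo (Gr k)) U" "S \<in> U" "\<forall>y\<in>U. f y = g y"
  hence "\<exists>U. openin (topo (Gr k)) U \<and> S \<in> U \<and> (\<forall>y\<in>U. f y = g y)" by blast
  thus "D f = D g" using D f g by (simp add: tangent_space_def)
qed

text \<open>The product rule for \<open>1 * 1\<close> makes the value at 1 equal to its
  double.\<close>

lemma tangent_const:
  assumes D: "D \<in> tangent_space (Gr k) S" and S: "S \<in> grass k"
  shows "D (\<lambda>T. c) = 0"
proof -
  note c = hol_near_const[OF S]
  have "D (\<lambda>y. 1) = 0" using tangent_mult[OF D c[of 1] c[of 1]] by simp
  moreover have "\<forall>c. \<forall>f\<in>hol_near (Gr k) S. D (\<lambda>y. c * f y) = c * D f"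
    using D by (simp add: tangent_space_def)
  note this[rule_format, OF c[of 1], of c]
  ultimately show ?thesis by simp
qed

lemma tangent_sum:
  assumes D: "D \<in> tangent_space (Gr k) S" and S: "S \<in> grass k"
    and f: "\<And>i. i \<in> I \<Longrightarrow> f i \<in> hol_near (Gr k) S"
  shows "D (\<lambda>T. \<Sum>i\<in>I. f i T) = (\<Sum>i\<in>I. D (f i))"
  using f
  by (induction I rule: infinite_finite_induct)
    (simp_all add: tangent_const[OF D S] tangent_add[OF D] hol_near_sum[OF S])

text \<open>
  In a chart, \<open>T\<close> is the image of \<open>S\<close> under the matrix \<open>1 + p T - P\<close>, where \<open>p T\<close> is the projection
  onto \<open>T\<close>; hence a function \<open>f\<close> is a holomorphic function of this matrix, to which the lemma of
  Hadamard applies.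
\<close>

lemma tangent_space_velocity:
  fixes S :: "(complex ^ 'n) set"
  assumes S: "S \<in> grass k" and D: "D \<in> tangent_space (Gr k) S"
  shows "\<exists>A. D = velocity k A S"
proof -
  obtain P where P: "P ** P = P" "range ((*v) P) = S" using S by (rule projection_exists)
  have Pg: "range ((*v) P) \<in> grass k" using S P(2) by simp
  note ch = chart_proj_self[OF P]
  let ?p = "chart_proj P"
  \<comment> \<open>The values of \<open>D\<close> on the chart coordinates, normalised to vanish at
    \<open>S\<close>.\<close>
  define A where "A = (\<chi> i j. D (\<lambda>T. ?p T $ i $ j - P $ i $ j))"
  have "D f = dG f S A" if f: "f \<in> hol_near (Gr k) S" for f
  proof -
    obtain U where U: "openin (topo (Gr k)) U" "S \<in> U" "\<forall>T\<in>U. hol_at f T"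
      using f unfolding hol_near_iff by blast
    let ?F = "\<lambda>g. f ((*v) g ` S)"
    obtain d where d: "d > 0" "ball (mat 1) d \<subseteq> orbit_preimage S U"
      using orbit_preimage_nhd[OF U(1,2)] open_contains_ball by blast
    let ?G = "ball (mat 1 :: complex ^ 'n ^ 'n) d"
    have F: "cdiff ?F g" if "g \<in> ?G" for g
      using that d(2) U(3) by (auto simp: orbit_preimage_def cdiff_orbit)
    obtain H where H: "\<And>i j x. x \<in> ?G \<Longrightarrow> cdiff (H i j) x"
        "\<And>i j. H i j (mat 1) = dird ?F (mat 1) (unit_mat i j)"
        "\<And>x. x \<in> ?G \<Longrightarrow> ?F x = ?F (mat 1) + (\<Sum>i\<in>UNIV. \<Sum>j\<in>UNIV. (x $ i $ j - mat 1 $ i $ j) * H i j x)"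
    proof (rule Hadamard_lemma[of ?G ?F "mat 1"])
      show "open ?G" "convex ?G" "mat 1 \<in> ?G" using d(1) by (simp_all add: convex_ball)
      show "cdiff ?F x" if "x \<in> ?G" for x by (rule F[OF that])
    qed blast
    let ?N = "\<lambda>T. mat 1 + ?p T - P"
    \<comment> \<open>\<open>?N T\<close> differs from the identity by \<open>?p T - P\<close>; this
      neighbourhood keeps it in the ball on which the Hadamard expansion holds.\<close>
    let ?V = "{T \<in> chart P. ?p T \<in> ball P d}"
    have V: "openin (topo (Gr k)) ?V" by (rule openin_chart_vimage[OF P(1) Pg]) simp
    have SV: "S \<in> ?V" using ch d by simp
    have NG: "?N T \<in> ?G" if "T \<in> ?V" for T
      using that by (simp add: dist_norm norm_minus_commute algebra_simps)
    define b where "b = (\<lambda>i j T. H i j (?N T))"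
    define a where "a = (\<lambda>i j T. ?p T $ i $ j - P $ i $ j)"
    have a_hol: "hol_at (a i j) T" if "T \<in> ?V" for i j T
      unfolding a_def hol_at_def
      by (intro cdiff_minus cdiff_const) (use chart_proj_hol_at[OF P(1)] that in \<open>simp add: hol_at_def\<close>)
    have b_hol: "hol_at (b i j) T" if "T \<in> ?V" for i j T
      unfolding b_def hol_at_def
    proof (rule cdiff_compose[of "\<lambda>g. ?N ((*v) g ` T)"])
      show "cdiff (\<lambda>g. ?N ((*v) g ` T) $ i $ j) (mat 1)" for i j
        unfolding vector_add_component vector_minus_component
        by (intro cdiff_minus cdiff_add cdiff_const)
          (use chart_proj_hol_at[OF P(1)] that in \<open>simp add: hol_at_def\<close>)
    qed (use H(1) NG[OF that] in simp)
    note an = hol_nearI[OF V SV a_hol] and bn = hol_nearI[OF V SV b_hol]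
    have f_eq: "f T = f S + (\<Sum>i\<in>UNIV. \<Sum>j\<in>UNIV. a i j T * b i j T)" if "T \<in> ?V" for T
      using H(3)[OF NG[OF that]] chart_transport(2)[OF P(1) chart_projD, of T] that P(2)
      by (simp add: a_def b_def)
    have ab: "(\<lambda>T. a i j T * b i j T) \<in> hol_near (Gr k) S" for i j
      by (rule hol_near_mult[OF an bn])
    \<comment> \<open>Since \<open>a i j\<close> vanishes at \<open>S\<close>, the product rule
      leaves only \<open>b i j S * D (a i j)\<close>, and \<open>b i j S\<close> is the derivative
      of \<open>f\<close> in the direction \<open>unit_mat i j\<close>.\<close>
    have Dab: "D (\<lambda>T. a i j T * b i j T) = A $ i $ j * dG f S (unit_mat i j)" for i j
    proof -
      have "D (\<lambda>T. a i j T * b i j T) = a i j S * D (b i j) + b i j S * D (a i j)"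
        by (rule tangent_mult[OF D an bn])
      thus ?thesis by (simp add: a_def b_def ch H(2) A_def)
    qed
    note ab_sum = hol_near_sum[OF S hol_near_sum[OF S ab]]
    have "D f = D (\<lambda>T. f S + (\<Sum>i\<in>UNIV. \<Sum>j\<in>UNIV. a i j T * b i j T))"
      by (rule tangent_cong[OF D f hol_near_add[OF hol_near_const[OF S] ab_sum] V SV])
        (use f_eq in blast)
    also have "\<dots> = D (\<lambda>T. f S) + D (\<lambda>T. \<Sum>i\<in>UNIV. \<Sum>j\<in>UNIV. a i j T * b i j T)"
      by (rule tangent_add[OF D hol_near_const[OF S] ab_sum])
    also have "\<dots> = (\<Sum>i\<in>UNIV. \<Sum>j\<in>UNIV. D (\<lambda>T. a i j T * b i j T))"
      by (simp add: tangent_const[OF D S] tangent_sum[OF D S] hol_near_sum[OF S] ab)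
    also have "\<dots> = (\<Sum>i\<in>UNIV. \<Sum>j\<in>UNIV. A $ i $ j * dG f S (unit_mat i j))"
      by (simp only: Dab)
    also have "\<dots> = dG f S A"
      using dird_expansion[of ?F "mat 1" A] F[of "mat 1"] d(1) by simp
    finally show ?thesis .
  qed
  hence "D = velocity k A S"
    using D by (auto simp: fun_eq_iff velocity_def tangent_space_def)
  thus ?thesis ..
qed

text \<open>Along the orbit map this is the derivative of the pulled back function at
  \<open>g\<close> in the direction \<open>C ** g\<close>, a combination of partial derivatives that
  \<open>cdiff_dird\<close> shows to be holomorphic.\<close>

lemma hol_at_dG:
  assumes U: "openin (topo (Gr k)) U" "S \<in> U" and f: "\<And>T. T \<in> U \<Longrightarrow> hol_at f T"
  shows "hol_at (\<lambda>T. dG f T C) S"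
proof -
  let ?O = "orbit_preimage S U" and ?F = "\<lambda>h. f ((*v) h ` S)"
  note O = orbit_preimage_nhd[OF U]
  have F: "cdiff ?F g" if "g \<in> ?O" for g
    using that f by (auto simp: orbit_preimage_def cdiff_orbit)
  have eq: "dG f ((*v) g ` S) C = (\<Sum>i\<in>UNIV. \<Sum>j\<in>UNIV. (C ** g) $ i $ j * dird ?F g (unit_mat i j))"
    if "g \<in> ?O" for g
    using dird_orbit[of g f S C] that f dird_expansion[OF F[OF that], of "C ** g"]
    by (auto simp: orbit_preimage_def)
  have "cdiff (\<lambda>g. \<Sum>i\<in>UNIV. \<Sum>j\<in>UNIV. (C ** g) $ i $ j * dird ?F g (unit_mat i j)) (mat 1)"
    by (intro cdiff_sum cdiff_mult cdiff_matrix_mult cdiff_const cdiff_nth cdiff_dird[OF O(1) _ O(2)] F)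
  thus ?thesis unfolding hol_at_def
    by (subst cdiff_cong_open(1)[OF O eq]) auto
qed

section \<open>Functionals on the cotangent spaces and local sections\<close>

text \<open>Elements of \<open>K0 S\<close> satisfy \<open>M = P ** M ** (1 - P)\<close>. Expanding
  the inner \<open>M\<close> in unit matrices expresses \<open>e\<close> through its values on the
  sandwiched units. The indices are transposed because the trace pairs entry \<open>(i, j)\<close>
  with entry \<open>(j, i)\<close>.\<close>

lemma K0_functional:
  assumes S: "S \<in> grass k" and P: "P ** P = P" "range ((*v) P) = S"
    and KM: "KM B S = K0 S" and e: "e \<in> fib (E_bundle k B) S" and M: "M \<in> K0 S"
  shows "e ((*v) M) = trace (M ** (\<chi> j i. e ((*v) (P ** unit_mat i j ** (mat 1 - P)))))"
proof -
  let ?Y = "\<lambda>i j. P ** unit_mat i j ** (mat 1 - P)"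
  have sub: "vec.subspace S" using S by (simp add: grass_def)
  have add: "e ((*v) (M + N)) = e ((*v) M) + e ((*v) N)" if "M \<in> K0 S" "N \<in> K0 S" for M N
    using e that by (simp add: fib_E_bundle KM)
  have scl: "e ((*v) (mat c ** M)) = c * e ((*v) M)" if "M \<in> K0 S" for c M
    using e that by (simp add: fib_E_bundle KM)
  have K0_add: "M + N \<in> K0 S" if "M \<in> K0 S" "N \<in> K0 S" for M N
    using KM_add[OF sub, of M B N] that by (simp add: KM)
  have K0_scale: "mat c ** M \<in> K0 S" if "M \<in> K0 S" for c M
    using KM_scale[OF sub, of M B c] that by (simp add: KM)
  have zero: "0 \<in> K0 S" using sub by (simp add: K0_def vec.subspace_0)
  have "e ((*v) (0 + 0)) = e ((*v) 0) + e ((*v) 0)" by (rule add[OF zero zero])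
  hence e0: "e ((*v) 0) = 0" by simp
  have sum: "(\<Sum>i\<in>I. f i) \<in> K0 S \<and> e ((*v) (\<Sum>i\<in>I. f i)) = (\<Sum>i\<in>I. e ((*v) (f i)))"
    if "\<And>i. f i \<in> K0 S" for f :: "'b \<Rightarrow> _" and I
    using that by (induction I rule: infinite_finite_induct) (simp_all add: zero e0 add K0_add)
  have Y: "mat c ** ?Y i j \<in> K0 S" for c i j by (rule K0_scale[OF K0_sandwich[OF P]])
  have distl: "P ** (\<Sum>i\<in>I. f i) = (\<Sum>i\<in>I. P ** f i)" for f :: "'b \<Rightarrow> _" and I
    by (induction I rule: infinite_finite_induct) (simp_all add: matrix_add_ldistrib)
  have distr: "(\<Sum>i\<in>I. f i) ** (mat 1 - P) = (\<Sum>i\<in>I. f i ** (mat 1 - P))" for f :: "'b \<Rightarrow> _" and I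
    by (induction I rule: infinite_finite_induct) (simp_all add: matrix_mult_add_left)
  have "M = P ** (\<Sum>i\<in>UNIV. \<Sum>j\<in>UNIV. mat (M $ i $ j) ** unit_mat i j) ** (mat 1 - P)"
    using K0_eq_sandwich(1)[OF P M] matrix_expansion[of M] by simp
  also have "\<dots> = (\<Sum>i\<in>UNIV. \<Sum>j\<in>UNIV. mat (M $ i $ j) ** ?Y i j)"
    by (simp add: distl distr mat_mult_assoc_right) (simp add: matrix_mul_assoc)
  finally have "e ((*v) M) = e ((*v) (\<Sum>i\<in>UNIV. \<Sum>j\<in>UNIV. mat (M $ i $ j) ** ?Y i j))"
    by (rule arg_cong)
  also have "\<dots> = (\<Sum>i\<in>UNIV. \<Sum>j\<in>UNIV. M $ i $ j * e ((*v) (?Y i j)))"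
    by (simp add: sum Y scl[OF K0_sandwich[OF P]])
  finally have "e ((*v) M) = (\<Sum>i\<in>UNIV. \<Sum>j\<in>UNIV. M $ i $ j * e ((*v) (?Y i j)))" .
  thus ?thesis by (simp add: trace_mult)
qed

text \<open>Holomorphy of a functional is tested on local sections of the kernel bundle. Placing a
  constant matrix between the moving projection and its complement provides enough of them, as their
  values fill each \<open>K0 T\<close>.\<close>

lemma chart_section:
  fixes X :: "complex ^ 'n ^ 'n"
  assumes P0: "P0 ** P0 = P0" and U: "openin (topo (Gr k)) U" "U \<subseteq> chart P0"
    and KM: "\<And>T. T \<in> U \<Longrightarrow> KM B T = K0 T"
  shows "(\<lambda>T. (*v) (chart_proj P0 T ** X ** (mat 1 - chart_proj P0 T))) \<in> sec (E_dual k B) U"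
  unfolding sec_E_dual_iff[OF U(1)]
proof (intro conjI ballI allI)
  let ?p = "chart_proj P0"
  fix T assume TU: "T \<in> U"
  have "?p T ** ?p T = ?p T" "range ((*v) (?p T)) = T"
    using chart_projD[of T P0] is_chart_proj_idem[OF chart_projD[of T P0]] TU U(2)
    by (auto simp: is_chart_proj_def)
  from K0_sandwich[OF this] show "(*v) (?p T ** X ** (mat 1 - ?p T)) \<in> fib (E_dual k B) T"
    using KM[OF TU] by simp
  show "hol_at (\<lambda>T. ((?p T ** X ** (mat 1 - ?p T)) *v axis m 1) $ l) T" for l m
    unfolding mv_axis hol_at_def
  proof (intro cdiff_matrix_mult cdiff_const)
    have "cdiff (\<lambda>g. ?p ((*v) g ` T) $ l $ m) (mat 1)" for l m
      using chart_proj_hol_at[OF P0, of T] TU U(2) by (auto simp: hol_at_def)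
    thus "cdiff (\<lambda>g. ?p ((*v) g ` T) $ l $ m) (mat 1)"
      "cdiff (\<lambda>g. (mat 1 - ?p ((*v) g ` T)) $ l $ m) (mat 1)" for l m
      unfolding vector_minus_component by (intro cdiff_minus cdiff_const | assumption)+
  qed
qed

lemma scl_tangent_bundle: "scl (tangent_bundle X) c D = (\<lambda>f. c * D f)"
  by (simp add: tangent_bundle_def)

lemma fib_tangent_bundle: "fib (tangent_bundle X) = tangent_space X"
  by (simp add: tangent_bundle_def)

lemma sec_tangent_bundle: "\<xi> \<in> sec (tangent_bundle X) U \<longleftrightarrow> (\<forall>x\<in>U. \<xi> x \<in> tangent_space X x) \<and>
    (\<forall>W f. openin (topo X) W \<and> W \<subseteq> U \<and> f \<in> hol X W \<longrightarrow> (\<lambda>x. \<xi> x f) \<in> hol X W)"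
  by (simp add: tangent_bundle_def)

lemma sec_hom_bundleI:
  assumes "\<And>x v. x \<in> U \<Longrightarrow> v \<in> fib E x \<Longrightarrow> \<Phi> x v \<in> fib F x"
    and "\<And>x v w. x \<in> U \<Longrightarrow> v \<in> fib E x \<Longrightarrow> w \<in> fib E x \<Longrightarrow> \<Phi> x (v + w) = \<Phi> x v + \<Phi> x w"
    and "\<And>x c v. x \<in> U \<Longrightarrow> v \<in> fib E x \<Longrightarrow> \<Phi> x (scl E c v) = scl F c (\<Phi> x v)"
    and "\<And>x v. x \<in> U \<Longrightarrow> v \<notin> fib E x \<Longrightarrow> \<Phi> x v = 0"
    and "\<And>W s. openin (topo X) W \<Longrightarrow> W \<subseteq> U \<Longrightarrow> s \<in> sec E W \<Longrightarrow> (\<And>x. x \<in> W \<Longrightarrow> s x \<in> fib E x) \<Longrightarrow>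
        (\<lambda>x. \<Phi> x (s x)) \<in> sec F W"
  shows "\<Phi> \<in> sec (hom_bundle X E F) U"
  using assms unfolding hom_bundle_def Let_def by auto

text \<open>The explicit matrix matters: on a chart its entries are values of \<open>e\<close> on
  the sections of \<open>chart_section\<close>, so they vary holomorphically if \<open>e\<close>
  does.\<close>

lemma fib_E_bundle_trace_form:
  assumes S: "S \<in> grass k" and KM: "KM B S = K0 S" and e: "e \<in> fib (E_bundle k B) S"
    and P: "P ** P = P" "range ((*v) P) = S"
  shows "e = trace_form k B (\<chi> j i. e ((*v) (P ** unit_mat i j ** (mat 1 - P)))) S" (is "e = ?t")
proof
  fix \<phi>
  show "e \<phi> = ?t \<phi>"
  proof (cases "\<phi> \<in> fib (E_dual k B) S")
    case True
    then obtain M where "\<phi> = (*v) M" "M \<in> KM B S" by (auto simp: fib_E_dual)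
    thus ?thesis using K0_functional[OF S P KM e, of M] KM by simp
  next
    case False
    thus ?thesis using e by (simp add: fib_E_bundle trace_form_def)
  qed
qed

lemma trace_form_eq_iff:
  assumes "KM B S = K0 S"
  shows "trace_form k B A S = trace_form k B A' S \<longleftrightarrow> (\<forall>M\<in>K0 S. trace (M ** A) = trace (M ** A'))"
proof
  assume "trace_form k B A S = trace_form k B A' S"
  thus "\<forall>M\<in>K0 S. trace (M ** A) = trace (M ** A')"
    using assms by (metis trace_form_mv)
next
  assume "\<forall>M\<in>K0 S. trace (M ** A) = trace (M ** A')"
  thus "trace_form k B A S = trace_form k B A' S"
    using assms by (auto simp: fun_eq_iff trace_form_def fib_E_dual)
qed

section \<open>The isomorphism with the tangent bundle\<close>

text \<open>Through \<open>trace_form\<close> and \<open>velocity\<close>, both fibres are quotients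
  of the space of all matrices by the same subspace, the annihilator of \<open>K0 S\<close> under
  the trace. The matrix \<open>A\<close> thus serves as a common label, and charts are needed only
  for holomorphy.\<close>

lemma E_bundle_iso_tangent_bundle:
  fixes B :: "complex ^ 'n ^ 'n"
  assumes KM: "\<And>S. S \<in> grass k \<Longrightarrow> KM B S = K0 S"
  shows "bundle_iso (Gr k) (E_bundle k B) (tangent_bundle (Gr k))"
proof -
  let ?E = "E_bundle k B" and ?T = "tangent_bundle (Gr k :: (complex ^ 'n) set cspace)"
  \<comment> \<open>The choice of a label is immaterial by \<open>eq_iff\<close> below.\<close>
  define \<Phi> where "\<Phi> = (\<lambda>S e. if e \<in> fib ?E S then velocity k (SOME A. e = trace_form k B A S) S else 0)"
  define \<Psi> where "\<Psi> = (\<lambda>S D. if D \<in> tangent_space (Gr k) S then trace_form k B (SOME A. D = velocity k A S) S else 0)"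
  have eq_iff: "trace_form k B A S = trace_form k B A' S \<longleftrightarrow> velocity k A S = velocity k A' S"
    if "S \<in> grass k" for A A' S
    using trace_form_eq_iff[OF KM[OF that]] velocity_eq_iff[OF that] by blast
  have \<Phi>: "\<Phi> S (trace_form k B A S) = velocity k A S" if S: "S \<in> grass k" for S A
  proof -
    have "trace_form k B A S = trace_form k B (SOME A'. trace_form k B A S = trace_form k B A' S) S"
      by (rule someI[of _ A]) simp
    thus ?thesis using trace_form_in_fib[OF S] eq_iff[OF S] by (simp add: \<Phi>_def)
  qed
  have \<Psi>: "\<Psi> S (velocity k A S) = trace_form k B A S" if S: "S \<in> grass k" for S A
  proof -
    have "velocity k A S = velocity k (SOME A'. velocity k A S = velocity k A' S) S"
      by (rule someI[of _ A]) simp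
    thus ?thesis using velocity_in_tangent_space[OF S] eq_iff[OF S] by (simp add: \<Psi>_def)
  qed
  have E: "\<exists>A. e = trace_form k B A S" if S: "S \<in> grass k" and e: "e \<in> fib ?E S" for S e
  proof -
    obtain P where "P ** P = P" "range ((*v) P) = S" using S by (rule projection_exists)
    from fib_E_bundle_trace_form[OF S KM[OF S] e this] show ?thesis by blast
  qed
  note T = tangent_space_velocity
  have sub: "W \<subseteq> grass k" if "openin (topo (Gr k)) W" for W :: "(complex ^ 'n) set set"
    using that by (simp add: openin_Gr)
  have sec\<Phi>: "\<Phi> \<in> sec (hom_bundle (Gr k) ?E ?T) (grass k)"
  proof (rule sec_hom_bundleI)
    fix S :: "(complex ^ 'n) set" and e assume S: "S \<in> grass k"
    show "\<Phi> S e = 0" if "e \<notin> fib ?E S" using that by (simp add: \<Phi>_def)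
    assume "e \<in> fib ?E S"
    then obtain A where A: "e = trace_form k B A S" using E[OF S] by blast
    show "\<Phi> S e \<in> fib ?T S"
      unfolding A \<Phi>[OF S] fib_tangent_bundle by (rule velocity_in_tangent_space[OF S])
    show "\<Phi> S (scl ?E c e) = scl ?T c (\<Phi> S e)" for c
      by (simp only: A trace_form_scale[symmetric] \<Phi>[OF S] scl_tangent_bundle velocity_scale)
    fix e' assume "e' \<in> fib ?E S"
    then obtain A' where A': "e' = trace_form k B A' S" using E[OF S] by blast
    show "\<Phi> S (e + e') = \<Phi> S e + \<Phi> S e'"
      by (simp only: A A' trace_form_add[symmetric] \<Phi>[OF S] velocity_add)
  next
    fix W s assume W: "openin (topo (Gr k)) W" and s: "s \<in> sec ?E W" "\<And>S. S \<in> W \<Longrightarrow> s S \<in> fib ?E S"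
    show "(\<lambda>S. \<Phi> S (s S)) \<in> sec ?T W"
      unfolding sec_tangent_bundle
    proof (intro conjI ballI allI impI; (elim conjE)?)
      fix S assume S: "S \<in> W"
      hence Sg: "S \<in> grass k" using sub[OF W] by blast
      obtain A where A: "s S = trace_form k B A S" using E[OF Sg s(2)[OF S]] by blast
      show "\<Phi> S (s S) \<in> tangent_space (Gr k) S"
        unfolding A \<Phi>[OF Sg] by (rule velocity_in_tangent_space[OF Sg])
    next
      fix W' f assume W': "openin (topo (Gr k)) W'" "W' \<subseteq> W" and f: "f \<in> hol (Gr k) W'"
      have f_hol: "hol_at f S" if "S \<in> W'" for S using f that by (simp add: hol_iff[OF sub[OF W'(1)]])
      show "(\<lambda>S. \<Phi> S (s S) f) \<in> hol (Gr k) W'"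
        unfolding hol_iff[OF sub[OF W'(1)]]
      proof
        fix S assume S: "S \<in> W'"
        hence Sg: "S \<in> grass k" using sub[OF W'(1)] by blast
        obtain P0 where P0: "P0 ** P0 = P0" "range ((*v) P0) = S" using Sg by (rule projection_exists)
        have P0g: "range ((*v) P0) \<in> grass k" using Sg P0(2) by simp
        let ?p = "chart_proj P0"
        let ?U = "chart P0 \<inter> W'"
        have U: "openin (topo (Gr k)) ?U" by (intro openin_Int openin_chart P0(1) P0g W'(1))
        have SU: "S \<in> ?U" using S chart_proj_self[OF P0] by simp
        let ?Y = "\<lambda>i j T. ?p T ** unit_mat i j ** (mat 1 - ?p T)"
        \<comment> \<open>A label for \<open>s T\<close> that varies holomorphically with
          \<open>T\<close>, in place of the arbitrary choice in \<open>\<Phi>\<close>.\<close>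
        define A where "A = (\<lambda>T. \<chi> j i. s T ((*v) (?Y i j T)))"
        have pT: "?p T ** ?p T = ?p T" "range ((*v) (?p T)) = T" if "T \<in> chart P0" for T
          using chart_projD[OF that] is_chart_proj_idem[OF chart_projD[OF that]] by (auto simp: is_chart_proj_def)
        have val: "\<Phi> T (s T) f = (\<Sum>i\<in>UNIV. \<Sum>j\<in>UNIV. A T $ i $ j * dG f T (unit_mat i j))"
          if TU: "T \<in> ?U" for T
        proof -
          have Tg: "T \<in> grass k" using TU sub[OF W'(1)] by blast
          have "s T = trace_form k B (A T) T" unfolding A_def
            by (rule fib_E_bundle_trace_form[OF Tg KM[OF Tg] s(2) pT]) (use TU W'(2) in auto)
          hence "\<Phi> T (s T) f = velocity k (A T) T f" using \<Phi>[OF Tg] by metis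
          also have "\<dots> = dG f T (A T)"
            using hol_nearI[OF W'(1) _ f_hol, of T] TU by (simp add: velocity_def)
          also have "\<dots> = (\<Sum>i\<in>UNIV. \<Sum>j\<in>UNIV. A T $ i $ j * dG f T (unit_mat i j))"
            using f_hol[of T] TU unfolding hol_at_def by (intro dird_expansion) auto
          finally show ?thesis .
        qed
        have A_hol: "hol_at (\<lambda>T. A T $ i $ j) S" for i j
        proof -
          have "(\<lambda>T. (*v) (?Y j i T)) \<in> sec (E_dual k B) ?U"
            by (rule chart_section[OF P0(1) U]) (use KM sub[OF W'(1)] in auto)
          hence "(\<lambda>T. s T ((*v) (?Y j i T))) \<in> hol (Gr k) ?U"
            using s(1) U W'(2) unfolding sec_E_bundle by blast
          thus ?thesis using SU by (simp add: hol_iff[OF sub[OF U]] A_def)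
        qed
        have "hol_at (\<lambda>T. \<Sum>i\<in>UNIV. \<Sum>j\<in>UNIV. A T $ i $ j * dG f T (unit_mat i j)) S"
          using A_hol hol_at_dG[OF W'(1) S f_hol] unfolding hol_at_def
          by (intro cdiff_sum cdiff_mult) auto
        thus "hol_at (\<lambda>S. \<Phi> S (s S) f) S" using hol_at_cong[OF U SU val] by simp
      qed
    qed
  qed
  have sec\<Psi>: "\<Psi> \<in> sec (hom_bundle (Gr k) ?T ?E) (grass k)"
  proof (rule sec_hom_bundleI; (unfold fib_tangent_bundle)?)
    fix S :: "(complex ^ 'n) set" and D :: "((complex ^ 'n) set \<Rightarrow> complex) \<Rightarrow> complex" assume S: "S \<in> grass k"
    show "\<Psi> S D = 0" if "D \<notin> tangent_space (Gr k) S" using that by (simp add: \<Psi>_def)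
    assume "D \<in> tangent_space (Gr k) S"
    then obtain A where A: "D = velocity k A S" using T[OF S] by blast
    show "\<Psi> S D \<in> fib ?E S"
      unfolding A \<Psi>[OF S] by (rule trace_form_in_fib[OF S])
    show "\<Psi> S (scl ?T c D) = scl ?E c (\<Psi> S D)" for c
      by (simp only: A trace_form_scale[symmetric] \<Psi>[OF S] scl_tangent_bundle velocity_scale[symmetric])
    fix D' assume "D' \<in> tangent_space (Gr k) S"
    then obtain A' where A': "D' = velocity k A' S" using T[OF S] by blast
    show "\<Psi> S (D + D') = \<Psi> S D + \<Psi> S D'"
      by (simp only: A A' trace_form_add \<Psi>[OF S] velocity_add[symmetric])
  next
    fix W \<xi> assume W: "openin (topo (Gr k)) W" and \<xi>: "\<xi> \<in> sec ?T W" "\<And>S. S \<in> W \<Longrightarrow> \<xi> S \<in> tangent_space (Gr k) S"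
    show "(\<lambda>S. \<Psi> S (\<xi> S)) \<in> sec ?E W"
      unfolding sec_E_bundle
    proof (intro conjI ballI allI impI; (elim conjE)?)
      fix S assume S: "S \<in> W"
      hence Sg: "S \<in> grass k" using sub[OF W] by blast
      obtain A where A: "\<xi> S = velocity k A S" using T[OF Sg \<xi>(2)[OF S]] by blast
      show "\<Psi> S (\<xi> S) \<in> fib ?E S"
        unfolding A \<Psi>[OF Sg] by (rule trace_form_in_fib[OF Sg])
    next
      fix W' \<phi> assume W': "openin (topo (Gr k)) W'" "W' \<subseteq> W" and \<phi>: "\<phi> \<in> sec (E_dual k B) W'"
      show "(\<lambda>S. \<Psi> S (\<xi> S) (\<phi> S)) \<in> hol (Gr k) W'"
        unfolding hol_iff[OF sub[OF W'(1)]]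
      proof
        fix S assume S: "S \<in> W'"
        hence Sg: "S \<in> grass k" using sub[OF W'(1)] by blast
        obtain P0 where P0: "P0 ** P0 = P0" "range ((*v) P0) = S" using Sg by (rule projection_exists)
        have P0g: "range ((*v) P0) \<in> grass k" using Sg P0(2) by simp
        let ?p = "\<lambda>i j T. chart_proj P0 T $ i $ j"
        let ?U = "chart P0 \<inter> W'"
        have U: "openin (topo (Gr k)) ?U" by (intro openin_Int openin_chart P0(1) P0g W'(1))
        have SU: "S \<in> ?U" using S chart_proj_self[OF P0] by simp
        \<comment> \<open>By \<open>dG_chart_proj\<close> the pairing only involves values of the
          vector field on chart coordinates, and these are holomorphic by the definition of a
          holomorphic vector field.\<close>
        have val: "\<Psi> T (\<xi> T) (\<phi> T) = (\<Sum>i\<in>UNIV. \<Sum>j\<in>UNIV. \<phi> T (axis j 1) $ i * \<xi> T (?p j i))"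
          if TU: "T \<in> ?U" for T
        proof -
          have Tg: "T \<in> grass k" using TU sub[OF W'(1)] by blast
          obtain A where A: "\<xi> T = velocity k A T" using T[OF Tg \<xi>(2)] TU W'(2) by blast
          have "\<phi> T \<in> fib (E_dual k B) T" using \<phi> TU by (simp add: sec_E_dual_iff[OF W'(1)])
          then obtain M where M: "\<phi> T = (*v) M" "M \<in> KM B T" by (auto simp: fib_E_dual)
          have M0: "M \<in> K0 T" using M(2) KM[OF Tg] by simp
          have "\<Psi> T (\<xi> T) (\<phi> T) = trace (M ** A)" using M by (simp add: A \<Psi>[OF Tg])
          also have "\<dots> = trace (M ** (\<chi> i j. dG (?p i j) T A))"
            by (rule dG_chart_proj[OF P0(1), symmetric]) (use TU M0 in \<open>auto simp: K0_def\<close>)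
          also have "\<dots> = (\<Sum>i\<in>UNIV. \<Sum>j\<in>UNIV. M $ i $ j * \<xi> T (?p j i))"
            using hol_near_chart_proj[OF P0(1) P0g] TU by (simp add: trace_mult A velocity_def)
          finally show ?thesis by (simp add: M(1) mv_axis)
        qed
        have "?p j i \<in> hol (Gr k) ?U" for i j
          unfolding hol_iff[OF sub[OF U]] using chart_proj_hol_at[OF P0(1)] by blast
        hence "(\<lambda>T. \<xi> T (?p j i)) \<in> hol (Gr k) ?U" for i j
          using \<xi>(1) U W'(2) unfolding sec_tangent_bundle by blast
        hence \<xi>p: "hol_at (\<lambda>T. \<xi> T (?p j i)) S" for i j
          using SU by (simp add: hol_iff[OF sub[OF U]])
        have "hol_at (\<lambda>T. \<Sum>i\<in>UNIV. \<Sum>j\<in>UNIV. \<phi> T (axis j 1) $ i * \<xi> T (?p j i)) S"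
          using \<xi>p \<phi> S unfolding sec_E_dual_iff[OF W'(1)] hol_at_def
          by (intro cdiff_sum cdiff_mult) auto
        thus "hol_at (\<lambda>S. \<Psi> S (\<xi> S) (\<phi> S)) S" using hol_at_cong[OF U SU val] by simp
      qed
    qed
  qed
  show ?thesis
    unfolding bundle_iso_def topspace_Gr
  proof (intro exI[of _ \<Phi>] exI[of _ \<Psi>] conjI ballI sec\<Phi> sec\<Psi>)
    fix S :: "(complex ^ 'n) set" assume S: "S \<in> grass k"
    show "\<Psi> S (\<Phi> S e) = e" if "e \<in> fib ?E S" for e
      using E[OF S that] \<Phi>[OF S] \<Psi>[OF S] by auto
    show "\<Phi> S (\<Psi> S D) = D" if "D \<in> fib ?T S" for D
      using T[OF S, of D] that \<Phi>[OF S] \<Psi>[OF S] by (auto simp: fib_tangent_bundle)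
  qed
qed

section \<open>Rank-one matrices and traces\<close>

text \<open>Complex bilinear, without the conjugation of the Hermitian product, so that
  \<open>y\<close> stands for a complex-linear functional.\<close>

definition lin :: "complex ^ 'n \<Rightarrow> complex ^ 'n \<Rightarrow> complex" where
  "lin y v = (\<Sum>j\<in>UNIV. y $ j * v $ j)"

text \<open>The pure tensor of the functional \<open>lin y\<close> and the vector
  \<open>s\<close>.\<close>

definition outer :: "complex ^ 'n \<Rightarrow> complex ^ 'n \<Rightarrow> complex ^ 'n ^ 'n" where
  "outer s y = (\<chi> i j. s $ i * y $ j)"

lemma lin_add: "lin y (v + w) = lin y v + lin y w"
  by (simp add: lin_def distrib_left sum.distrib)

lemma lin_scale: "lin y (c *s v) = c * lin y v"
  by (simp add: lin_def sum_distrib_left mult_ac)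

lemma lin_diff: "lin y (v - w) = lin y v - lin y w"
  by (simp add: lin_def right_diff_distrib sum_subtractf)

lemma lin_zero [simp]: "lin y 0 = 0"
  by (simp add: lin_def)

lemma lin_axis [simp]: "lin (axis i 1) v = v $ i"
  by (simp add: lin_def axis_def if_distrib if_distribR cong: if_cong)

lemma lin_span:
  assumes "\<And>x. x \<in> W \<Longrightarrow> lin y x = 0" "v \<in> vec.span W"
  shows "lin y v = 0"
proof -
  have "vec.subspace {v. lin y v = 0}"
    by (rule vec.subspaceI) (auto simp: lin_add lin_scale)
  thus ?thesis using vec.span_minimal[of W "{v. lin y v = 0}"] assms by blast
qed

lemma outer_mv: "outer s y *v v = lin y v *s s"
  by (simp add: vec_eq_iff matrix_vector_mult_def outer_def lin_def sum_distrib_left mult_ac)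

lemma trace_outer_mult: "trace (outer s y ** A) = lin y (A *v s)"
proof -
  have "trace (outer s y ** A) = (\<Sum>i\<in>UNIV. \<Sum>j\<in>UNIV. y $ j * (A $ j $ i * s $ i))"
    by (simp add: trace_mult outer_def mult_ac)
  also have "\<dots> = (\<Sum>j\<in>UNIV. \<Sum>i\<in>UNIV. y $ j * (A $ j $ i * s $ i))" by (rule sum.swap)
  finally show ?thesis by (simp add: lin_def matrix_vector_mult_def sum_distrib_left)
qed

lemma trace_mult_outer: "trace (A ** outer s y) = lin y (A *v s)"
  by (subst trace_mul_sym) (rule trace_outer_mult)

lemma functional_exists:
  assumes "vec.independent W"
  shows "\<exists>y. \<forall>x\<in>W. lin y x = c x"
proof -
  \<comment> \<open>The linear extension used here takes values in vectors; an arbitrary coordinate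
    \<open>i0\<close> carries the scalar.\<close>
  fix i0 :: 'a
  obtain g where g: "Vector_Spaces.linear (*s) (*s) g" "\<forall>x\<in>W. g x = axis i0 (c x)"
    using vec.linear_independent_extend[OF assms, of "\<lambda>x. axis i0 (c x)"] by blast
  have "lin (matrix g $ i0) x = g x $ i0" for x
    by (simp add: lin_def matrix_works[OF g(1), symmetric] matrix_vector_mult_def)
  thus ?thesis using g(2) by (intro exI[of _ "matrix g $ i0"]) simp
qed

lemma grass_basis:
  assumes "S \<in> grass k"
  obtains W where "vec.independent W" "finite W" "card W = k" "vec.span W = S"
proof -
  have S: "vec.subspace S" "vec.dim S = k" using assms by (auto simp: grass_def)
  obtain W where "W \<subseteq> S" "vec.independent W" "S \<subseteq> vec.span W" "card W = vec.dim S"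
    by (rule vec.basis_exists)
  thus ?thesis using that[of W] S vec.finiteI_independent vec.span_minimal[of W S] by blast
qed

lemma span_in_grass: "vec.independent W \<Longrightarrow> card W = k \<Longrightarrow> vec.span W \<in> grass k"
  by (simp add: grass_def vec.dim_eq_card_independent)

text \<open>A basis of \<open>S\<close> with dual functionals gives another projection
  \<open>Q\<close> onto \<open>S\<close>. Its kernel may differ from that of \<open>P\<close>, but
  \<open>Q ** P = P\<close>, and the trace of \<open>Q ** P\<close> has one summand 1 for each basis
  vector.\<close>

lemma trace_projection:
  fixes P :: "complex ^ 'n ^ 'n"
  assumes P: "P ** P = P" "range ((*v) P) = S" and S: "S \<in> grass k"
  shows "trace P = of_nat k"
proof -
  obtain W where W: "vec.independent W" "finite W" "card W = k" "vec.span W = S"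
    using S by (rule grass_basis)
  have "\<exists>y. \<forall>x\<in>W. lin y x = (if x = b then 1 else 0)" for b
    by (rule functional_exists[OF W(1)])
  then obtain y where y: "\<And>b x. x \<in> W \<Longrightarrow> lin (y b) x = (if x = b then 1 else 0)" by metis
  define Q where "Q = (\<Sum>b\<in>W. outer b (y b))"
  have Qv: "Q *v v = (\<Sum>b\<in>W. lin (y b) v *s b)" for v
    unfolding Q_def using W(2) by (induction W rule: finite_induct) (auto simp: outer_mv matrix_vector_mult_add_rdistrib)
  have "Q *v x = x" if "x \<in> W" for x
  proof -
    have "Q *v x = (\<Sum>b\<in>W. if x = b then x else 0)"
      unfolding Qv by (rule sum.cong) (auto simp: y[OF that])
    thus ?thesis using that W(2) by simp
  qed
  hence "Q *v v = v" if "v \<in> S" for v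
    using vec.linear_eq_on[OF matrix_vector_mul_linear_gen[of Q] vec.linear_id, of v W] that W(4) by auto
  hence "Q ** P = P" using P(2) by (auto simp: matrix_eq matrix_vector_mul_assoc[symmetric])
  hence "trace P = trace (Q ** P)" by simp
  also have "\<dots> = (\<Sum>b\<in>W. trace (outer b (y b) ** P))"
    unfolding Q_def using W(2)
    by (induction W rule: finite_induct) (simp_all add: matrix_mult_add_left trace_add, simp add: trace_def)
  also have "\<dots> = (\<Sum>b\<in>W. 1)"
  proof (rule sum.cong[OF refl])
    fix b assume b: "b \<in> W"
    have "b \<in> range ((*v) P)" using b W(4) P(2) vec.span_base by blast
    hence "P *v b = b" using range_projection[OF P(1)] by blast
    thus "trace (outer b (y b) ** P) = 1" using y[OF b, of b] by (simp add: trace_outer_mult)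
  qed
  finally show ?thesis using W(3) by simp
qed

section \<open>Scalar matrices and the exceptional value\<close>

text \<open>A matrix with range in \<open>S\<close> has the same trace as its restriction to
  \<open>S\<close>. For \<open>M\<close> in the kernel the restriction is the scalar
  \<open>- \<epsilon> tr M\<close>, so \<open>(1 + k \<epsilon>) tr M = 0\<close>; elements of
  \<open>K0 S\<close> have trace 0 for the same reason.\<close>

lemma KM_mat:
  fixes S :: "(complex ^ 'n) set"
  assumes S: "S \<in> grass k" and nz: "1 + of_nat k * \<epsilon> \<noteq> 0"
  shows "KM (mat \<epsilon>) S = K0 S"
proof -
  obtain P where P: "P ** P = P" "range ((*v) P) = S" using S by (rule projection_exists)
  have PS: "P *v v \<in> S" for v using P(2) by auto
  have tr: "trace M = trace (M ** P)" if "\<forall>v. M *v v \<in> S" for M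
  proof -
    have "P ** M = M" using that range_projection[OF P(1)] P(2)
      by (simp add: matrix_eq matrix_vector_mul_assoc[symmetric])
    thus ?thesis by (metis trace_mul_sym)
  qed
  have "M \<in> K0 S" if M: "M \<in> KM (mat \<epsilon>) S" for M
  proof -
    have MP: "M ** P = mat (- \<epsilon> * trace M) ** P"
      using M PS unfolding KM_def
      by (auto simp: matrix_eq matrix_vector_mul_assoc[symmetric] trace_mat_mult eq_neg_iff_add_eq_0)
    have "trace M = - \<epsilon> * trace M * of_nat k"
      using tr[of M] M unfolding MP trace_mat_mult trace_projection[OF P S] by (simp add: KM_def)
    moreover have "(1 + of_nat k * \<epsilon>) * trace M = trace M - (- \<epsilon> * trace M * of_nat k)"
      by (simp add: algebra_simps)
    ultimately have "(1 + of_nat k * \<epsilon>) * trace M = 0" by simp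
    hence "trace M = 0" using nz by simp
    thus ?thesis using M by (simp add: KM_def K0_def trace_mat_mult)
  qed
  moreover have "M \<in> KM (mat \<epsilon>) S" if M: "M \<in> K0 S" for M
  proof -
    have "M ** P = 0" by (rule K0_eq_sandwich(3)[OF P M])
    hence "trace M = 0" using tr[of M] M by (simp add: K0_def trace_def)
    thus ?thesis using M by (simp add: KM_def K0_def trace_mat_mult)
  qed
  ultimately show ?thesis by blast
qed

lemma KM_zero: "KM 0 S = K0 S"
  by (simp add: KM_def K0_def trace_def)

text \<open>The identity of \<open>S\<close> is not attained: for a preimage \<open>M\<close>,
  taking traces on \<open>S\<close> gives \<open>k = (1 + k \<epsilon>) tr M\<close>.\<close>

lemma mat_degenerate:
  fixes S :: "(complex ^ 'n) set"
  assumes S: "S \<in> grass k" and k: "k > 0" and \<epsilon>: "1 + of_nat k * \<epsilon> = 0"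
  shows "mat \<epsilon> \<in> (degenerate_locus k :: (complex ^ 'n ^ 'n) set)"
proof -
  obtain P where P: "P ** P = P" "range ((*v) P) = S" using S by (rule projection_exists)
  have sub: "vec.subspace S" using S by (simp add: grass_def)
  let ?I = "\<lambda>t. if t \<in> S then t else 0"
  have "?I \<in> fib (SS_bundle k) S"
    using sub by (auto simp: SS_bundle_def hom_bundle_def Let_def tautological_def subbundle_def
        trivial_bundle_def vec.subspace_add vec.subspace_scale)
  moreover have "?I \<notin> f_map (mat \<epsilon>) S ` fib (VS_bundle k) S"
  proof
    assume "?I \<in> f_map (mat \<epsilon>) S ` fib (VS_bundle k) S"
    then obtain M where M: "\<forall>v. M *v v \<in> S" "f_map (mat \<epsilon>) S ((*v) M) = ?I"
      by (auto simp: fib_VS)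
    have eq: "M *v t + (\<epsilon> * trace M) *s t = t" if "t \<in> S" for t
      using fun_cong[OF M(2), of t] that by (simp add: f_map_mv trace_mat_mult)
    have "M *v (P *v v) = (1 - \<epsilon> * trace M) *s (P *v v)" for v
      using eq[of "P *v v"] P(2) by (auto simp: vec.scale_left_diff_distrib eq_diff_eq)
    hence MP: "M ** P = mat (1 - \<epsilon> * trace M) ** P"
      by (simp add: matrix_eq matrix_vector_mul_assoc[symmetric])
    have "P ** M = M" using M(1) range_projection[OF P(1)] P(2)
      by (simp add: matrix_eq matrix_vector_mul_assoc[symmetric])
    hence "trace M = trace (M ** P)" by (metis trace_mul_sym)
    also have "\<dots> = (1 - \<epsilon> * trace M) * of_nat k"
      unfolding MP trace_mat_mult trace_projection[OF P S] ..
    finally have "of_nat k = (1 + of_nat k * \<epsilon>) * trace M" by (simp add: algebra_simps)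
    thus False using \<epsilon> k by simp
  qed
  ultimately show ?thesis using S unfolding degenerate_locus_def by blast
qed

lemma grass_nonempty:
  assumes "k \<le> CARD('n)"
  shows "\<exists>S :: (complex ^ 'n) set. S \<in> grass k"
proof -
  have "k \<le> card (cart_basis :: (complex ^ 'n) set)" using assms by (simp add: card_cart_basis)
  then obtain W where W: "W \<subseteq> (cart_basis :: (complex ^ 'n) set)" "card W = k"
    by (metis obtain_subset_with_card_n)
  hence "vec.independent W" using vec.independent_mono[OF independent_cart_basis] by blast
  thus ?thesis using span_in_grass W(2) by blast
qed

section \<open>Matrices preserving all subspaces of a given dimension\<close>

lemma all_eigenvectors_scalar:
  fixes B :: "complex ^ 'n ^ 'n"
  assumes "\<And>v. v \<noteq> 0 \<Longrightarrow> B *v v \<in> vec.span {v}"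
  shows "\<exists>\<epsilon>. B = mat \<epsilon>"
proof -
  have ev: "\<exists>c. B *v v = c *s v" if "v \<noteq> 0" for v
    using assms[OF that] by (auto simp: vec.span_singleton)
  have nz: "axis i 1 \<noteq> (0 :: complex ^ 'n)" for i by (simp add: axis_eq_0_iff)
  have off: "B $ j $ i = 0" if "j \<noteq> i" for i j
  proof -
    obtain c where "B *v axis i 1 = c *s axis i 1" using ev[OF nz] by blast
    hence "(B *v axis i 1) $ j = c * axis i 1 $ j" by simp
    thus ?thesis using that unfolding mv_axis by (simp add: axis_def)
  qed
  \<comment> \<open>The sum of two basis vectors is an eigenvector only if their eigenvalues
    agree.\<close>
  have diag: "B $ i $ i = B $ j $ j" if "i \<noteq> j" for i j
  proof -
    let ?v = "axis i 1 + axis j 1 :: complex ^ 'n"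
    have "?v $ i = 1" using that by (simp add: axis_def)
    hence "?v \<noteq> 0" by (metis zero_index zero_neq_one)
    then obtain c where "B *v ?v = c *s ?v" using ev by blast
    from arg_cong[OF this, of "\<lambda>w. w $ l" for l]
    have "B $ l $ i + B $ l $ j = c * (axis i 1 $ l + axis j 1 $ l)" for l
      by (simp only: matrix_vector_right_distrib vector_add_component mv_axis
          vector_smult_component)
    from this[of i] this[of j] show ?thesis using that off[of i j] off[of j i]
      by (simp add: axis_def)
  qed
  fix i0 :: 'n
  have "B $ i $ i = B $ i0 $ i0" for i using diag[of i i0] by (cases "i = i0") auto
  hence "B = mat (B $ i0 $ i0)"
    using off by (auto simp: vec_eq_iff mat_def)
  thus ?thesis ..
qed

text \<open>If \<open>B v\<close> were no multiple of \<open>v\<close>, a basis containing both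
  would have enough further vectors, as \<open>k < n\<close>, to span together with \<open>v\<close>
  a subspace of dimension \<open>k\<close> that omits \<open>B v\<close>.\<close>

lemma preserves_grass_scalar:
  fixes B :: "complex ^ 'n ^ 'n"
  assumes k: "1 \<le> k" "k < CARD('n)" and B: "\<And>S v. S \<in> grass k \<Longrightarrow> v \<in> S \<Longrightarrow> B *v v \<in> S"
  shows "\<exists>\<epsilon>. B = mat \<epsilon>"
proof (rule all_eigenvectors_scalar, rule ccontr)
  fix v assume v: "v \<noteq> 0" and nin: "B *v v \<notin> vec.span {v}"
  let ?w = "B *v v"
  have wv: "?w \<noteq> v" using nin vec.span_base by force
  have "vec.independent {?w, v}" using v nin by (simp add: vec.independent_insert vec.span_empty)
  then obtain W where W: "{?w, v} \<subseteq> W" "vec.independent W" "UNIV \<subseteq> vec.span W"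
    by (rule vec.maximal_independent_subset_extend[OF subset_UNIV])
  have fin: "finite W" using W(2) by (rule vec.finiteI_independent)
  have "card W = CARD('n)"
    using vec.dim_eq_card[of W UNIV] W vec.dim_UNIV by (simp add: card_cart_basis top.extremum_unique)
  hence "k - 1 \<le> card (W - {?w, v})" using W(1) k wv by (simp add: card_Diff_subset)
  then obtain T where T: "T \<subseteq> W - {?w, v}" "card T = k - 1" by (metis obtain_subset_with_card_n)
  have finT: "finite T" using T(1) fin finite_subset by blast
  have "insert v T \<subseteq> W" using T W(1) by auto
  hence "vec.independent (insert v T)" using W(2) vec.independent_mono by blast
  moreover have "card (insert v T) = k" using T finT k by (subst card_insert_disjoint) auto
  ultimately have "vec.span (insert v T) \<in> grass k" by (rule span_in_grass)
  hence "?w \<in> vec.span (insert v T)" by (rule B) (simp add: vec.span_base)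
  moreover have "insert v T \<subseteq> W - {?w}" using T W(1) wv by auto
  ultimately have "?w \<in> vec.span (W - {?w})" using vec.span_mono by blast
  thus False using W(1,2) by (auto simp: vec.dependent_def)
qed

section \<open>Sections are constant along lines\<close>

lemma outer_in_K0: "vec.subspace S \<Longrightarrow> s \<in> S \<Longrightarrow> (\<And>v. v \<in> S \<Longrightarrow> lin y v = 0) \<Longrightarrow> outer s y \<in> K0 S"
  by (auto simp: K0_def outer_mv vec.subspace_scale)

text \<open>The subspaces \<open>L t\<close> form the affine part of a projective line. As
  \<open>\<alpha>\<close> is 1 on \<open>a\<close> and vanishes on \<open>b\<close> and
  \<open>W\<close>, the matrix \<open>N\<close> has square zero, and \<open>1 + t N\<close> carries
  \<open>L u\<close> to \<open>L (u + t)\<close>. The pencil is thus traced by an orbit map along a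
  complex line of matrices.\<close>

lemma line_holomorphic:
  fixes a b :: "complex ^ 'n"
  assumes ind: "vec.independent (insert a (insert b W))" and ab: "a \<noteq> b" "a \<notin> W" "b \<notin> W"
    and card: "card W + 1 = k"
    and e: "e \<in> sec (E_bundle k 0) (grass k)"
    and s: "s \<in> vec.span W" and y: "\<And>x. x \<in> insert a (insert b W) \<Longrightarrow> lin y x = 0"
  shows "(\<lambda>t. e (vec.span (insert (a + t *s b) W)) ((*v) (outer s y))) holomorphic_on UNIV"
proof -
  define L where "L = (\<lambda>t. vec.span (insert (a + t *s b) W))"
  have fin: "finite W" using vec.finiteI_independent[OF ind] by simp
  obtain \<alpha> where "\<forall>x\<in>insert a (insert b W). lin \<alpha> x = (if x = a then 1 else 0)"
    using functional_exists[OF ind, of "\<lambda>x. if x = a then 1 else 0"] by blast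
  hence \<alpha>: "lin \<alpha> a = 1" "lin \<alpha> b = 0" "\<And>w. w \<in> W \<Longrightarrow> lin \<alpha> w = 0"
    using ab by auto
  define N where "N = outer b \<alpha>"
  let ?g = "\<lambda>t. mat 1 + mat t ** N"
  have gv: "?g t *v v = v + (t * lin \<alpha> v) *s b" for t v
    by (simp add: matrix_vector_mult_add_rdistrib mat_mult_mv N_def outer_mv)
  have gW: "?g t *v w = w" if "w \<in> W" for t w using \<alpha>(3)[OF that] by (simp add: gv)
  have "?g t ** ?g (- t) = mat 1 \<and> ?g (- t) ** ?g t = mat 1" for t
    by (simp add: matrix_eq matrix_vector_mul_assoc[symmetric] gv lin_add lin_diff lin_scale \<alpha>)
  hence g_inv: "invertible (?g t)" for t unfolding invertible_def by blast
  have gL: "(*v) (?g t) ` L u = L (u + t)" for t u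
  proof -
    have "(*v) (?g t) ` insert (a + u *s b) W = insert (a + (u + t) *s b) W"
      using gW by (auto simp: gv lin_add lin_scale \<alpha> vec.scale_left_distrib add_ac image_iff)
    thus ?thesis
      unfolding L_def using vec.linear_span_image[OF matrix_vector_mul_linear_gen[of "?g t"]] by metis
  qed
  have L0: "L 0 \<in> grass k"
    unfolding L_def
  proof (rule span_in_grass)
    show "vec.independent (insert (a + 0 *s b) W)"
      by (rule vec.independent_mono[OF ind]) auto
    show "card (insert (a + 0 *s b) W) = k" using card fin ab(2) by simp
  qed
  have Lg: "L t \<in> grass k" for t
    using image_mem_grass[OF g_inv[of t] L0] by (simp only: gL add_0)
  have sL: "s \<in> L t" for t
    using s vec.span_mono[of W "insert (a + t *s b) W"] unfolding L_def by auto
  have yL: "lin y v = 0" if "v \<in> L t" for v t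
    using that y unfolding L_def by (rule_tac lin_span) (auto simp: lin_add lin_scale)
  have "\<exists>D. ((\<lambda>t. e (L t) ((*v) (outer s y))) has_field_derivative D) (at t0)" for t0
  proof -
    obtain P0 where P0: "P0 ** P0 = P0" "range ((*v) P0) = L t0" using Lg by (rule projection_exists)
    have U: "openin (topo (Gr k)) (chart P0)" by (rule openin_chart[OF P0(1)]) (simp add: P0(2) Lg)
    have LU: "L t0 \<in> chart P0" by (rule chart_proj_self(1)[OF P0])
    let ?p = "chart_proj P0"
    \<comment> \<open>\<open>outer s y\<close> need not lie in the kernel over subspaces off the
      pencil. The local section of \<open>chart_section\<close> is defined on the whole chart and
      has the value \<open>outer s y\<close> at each \<open>L t\<close> in it.\<close>
    define h where "h = (\<lambda>T. e T ((*v) (?p T ** outer s y ** (mat 1 - ?p T))))"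
    have "(\<lambda>T. (*v) (?p T ** outer s y ** (mat 1 - ?p T))) \<in> sec (E_dual k 0) (chart P0)"
      by (rule chart_section[OF P0(1) U order_refl KM_zero])
    moreover have sub: "chart P0 \<subseteq> grass k" using U by (simp add: openin_Gr)
    ultimately have "h \<in> hol (Gr k) (chart P0)"
      using e U unfolding h_def sec_E_bundle by blast
    hence "hol_at h (L t0)" using LU by (simp add: hol_iff[OF sub])
    moreover have g0: "?g 0 = mat 1" by (simp add: vec_eq_iff)
    ultimately have d: "((\<lambda>z. h ((*v) (?g z) ` L t0)) has_field_derivative dG h (L t0) N) (at 0)"
      using cdiff_line[of "\<lambda>g. h ((*v) g ` L t0)" "mat 1" 0 N] unfolding hol_at_def by simp
    have "continuous_on UNIV ?g"
      by (intro continuous_on_matrix, unfold vector_add_component mat_mult_nth) (intro continuous_intros)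
    hence op: "open (?g -` orbit_preimage (L t0) (chart P0))"
      using orbit_preimage_nhd(1)[OF U LU] by (rule_tac open_vimage)
    have "((\<lambda>z. e (L (t0 + z)) ((*v) (outer s y))) has_field_derivative dG h (L t0) N) (at 0)"
    proof (rule has_field_derivative_transform_within_open[OF d op])
      show "0 \<in> ?g -` orbit_preimage (L t0) (chart P0)"
        using orbit_preimage_nhd(2)[OF U LU] by (simp add: g0)
      fix z assume "z \<in> ?g -` orbit_preimage (L t0) (chart P0)"
      hence ch: "L (t0 + z) \<in> chart P0" by (simp add: orbit_preimage_def gL del: image_image)
      have "outer s y \<in> K0 (L (t0 + z))"
        using Lg sL yL by (intro outer_in_K0) (auto simp: grass_def)
      hence "?p (L (t0 + z)) ** outer s y ** (mat 1 - ?p (L (t0 + z))) = outer s y"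
        using chart_projD[OF ch] is_chart_proj_idem[OF chart_projD[OF ch]]
        by (intro K0_eq_sandwich(1)) (auto simp: is_chart_proj_def)
      thus "h ((*v) (?g z) ` L t0) = e (L (t0 + z)) ((*v) (outer s y))" by (simp add: h_def gL del: image_image)
    qed
    hence "((\<lambda>t. e (L t) ((*v) (outer s y))) has_field_derivative dG h (L t0) N) (at (t0 + 0))"
      using DERIV_shift[of "\<lambda>t. e (L t) ((*v) (outer s y))" _ 0 t0] by (simp add: add.commute)
    thus ?thesis by auto
  qed
  thus ?thesis unfolding L_def holomorphic_on_def field_differentiable_def
    by (blast intro: has_field_derivative_at_within)
qed

text \<open>\<open>?F\<close> and \<open>?H\<close> describe the same function in the two affine
  charts of a projective line, glued by inversion. Continuity of \<open>?H\<close> at 0 gives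
  \<open>?F\<close> a limit at infinity, and an entire function with such a limit is constantly
  equal to it.\<close>

lemma line_constant:
  fixes a b :: "complex ^ 'n"
  assumes ind: "vec.independent (insert a (insert b W))" and ab: "a \<noteq> b" "a \<notin> W" "b \<notin> W"
    and card: "card W + 1 = k"
    and e: "e \<in> sec (E_bundle k 0) (grass k)"
    and s: "s \<in> vec.span W" and y: "\<And>x. x \<in> insert a (insert b W) \<Longrightarrow> lin y x = 0"
  shows "e (vec.span (insert a W)) ((*v) (outer s y)) = e (vec.span (insert b W)) ((*v) (outer s y))"
proof -
  let ?F = "\<lambda>t. e (vec.span (insert (a + t *s b) W)) ((*v) (outer s y))"
  let ?H = "\<lambda>t. e (vec.span (insert (b + t *s a) W)) ((*v) (outer s y))"
  have F: "?F holomorphic_on UNIV" by (rule line_holomorphic[OF assms])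
  have H: "?H holomorphic_on UNIV"
    by (rule line_holomorphic[OF _ _ ab(3,2) card e s]) (use ind ab y in \<open>auto simp: insert_commute\<close>)
  have FH: "?F t = ?H (inverse t)" if "t \<noteq> 0" for t
  proof -
    have eq: "a + t *s b = t *s (b + inverse t *s a)"
      using that by (simp add: vec.scale_right_distrib)
    have "vec.span (insert (a + t *s b) W) = vec.span (insert (b + inverse t *s a) W)"
    proof (intro subset_antisym vec.span_minimal vec.subspace_span)
      have "a + t *s b \<in> vec.span (insert (b + inverse t *s a) W)"
        unfolding eq by (intro vec.span_scale vec.span_base insertI1)
      thus "insert (a + t *s b) W \<subseteq> vec.span (insert (b + inverse t *s a) W)"
        by (auto intro: vec.span_base)
      have eq': "b + inverse t *s a = inverse t *s (a + t *s b)"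
        using that by (simp add: vec.scale_right_distrib)
      have "b + inverse t *s a \<in> vec.span (insert (a + t *s b) W)"
        unfolding eq' by (intro vec.span_scale vec.span_base insertI1)
      thus "insert (b + inverse t *s a) W \<subseteq> vec.span (insert (a + t *s b) W)"
        by (auto intro: vec.span_base)
    qed
    thus ?thesis by simp
  qed
  have "isCont ?H 0" using holomorphic_on_imp_continuous_on[OF H] by (simp add: continuous_on_eq_continuous_at)
  hence "((\<lambda>t. ?H (inverse t)) \<longlongrightarrow> ?H 0) at_infinity"
    by (rule isCont_tendsto_compose) (rule tendsto_inverse_0)
  moreover have "eventually (\<lambda>t. ?H (inverse t) = ?F t) at_infinity"
    unfolding eventually_at_infinity
  proof (intro exI[of _ 1] allI impI)
    fix t :: complex assume "1 \<le> norm t"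
    hence "t \<noteq> 0" by auto
    thus "?H (inverse t) = ?F t" by (rule FH[symmetric])
  qed
  ultimately have "(?F \<longlongrightarrow> ?H 0) at_infinity" by (rule Lim_transform_eventually)
  from Liouville_weak[OF F this, of 0] show ?thesis by simp
qed

text \<open>Two vectors independent modulo \<open>S\<close> exist since \<open>k + 1 < n\<close>,
  and either the first or a combination of both lies outside \<open>S\<close> and is killed by
  \<open>y\<close>. The result is the other end of the pencil to which \<open>line_constant\<close>
  is applied.\<close>

lemma exists_in_kernel_notin:
  fixes S :: "(complex ^ 'n) set"
  assumes S: "S \<in> grass k" and k: "k + 1 < CARD('n)"
  shows "\<exists>b. b \<notin> S \<and> lin y b = 0"
proof -
  have sub: "vec.subspace S" and dim: "vec.dim S = k" using S by (auto simp: grass_def)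
  have full: "\<exists>c. c \<notin> vec.span X" if "vec.dim X < CARD('n)" for X :: "(complex ^ 'n) set"
  proof (rule ccontr)
    assume "\<not> ?thesis"
    hence "vec.span X = UNIV" by auto
    hence "vec.dim X = CARD('n)" using vec.dim_span[of X] vec.dim_UNIV by (simp add: card_cart_basis)
    thus False using that by simp
  qed
  obtain c1 where c1: "c1 \<notin> vec.span S" using full[of S] dim k by auto
  have "vec.dim (insert c1 S) < CARD('n)" using k dim by (simp add: vec.dim_insert)
  then obtain c2 where c2: "c2 \<notin> vec.span (insert c1 S)" using full by blast
  show ?thesis
  proof (cases "lin y c1 = 0")
    case True
    thus ?thesis using c1 vec.span_base by blast
  next
    case False
    let ?r = "lin y c2 / lin y c1"
    have "c2 - ?r *s c1 \<notin> S"
      using c2 vec.span_base[of _ S] by (auto simp: vec.span_breakdown_eq)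
    thus ?thesis using False by (intro exI[of _ "c2 - ?r *s c1"]) (simp add: lin_diff lin_scale)
  qed
qed

section \<open>From an isomorphism to invariance of all subspaces under \<open>B\<close>\<close>

lemma linear_form_matrix:
  assumes add: "\<And>A A'. l (A + A') = l A + l A'" and scale: "\<And>c A. l (mat c ** A) = c * l A"
  shows "l A = trace ((\<chi> i j. l (unit_mat j i)) ** (A :: complex ^ 'n ^ 'n))"
proof -
  have 0: "l 0 = 0" using add[of 0 0] by simp
  have sum: "l (\<Sum>i\<in>I. f i) = (\<Sum>i\<in>I. l (f i))" for I :: "'n set" and f
    by (induction I rule: infinite_finite_induct) (auto simp: 0 add)
  have "l A = l (\<Sum>i\<in>UNIV. \<Sum>j\<in>UNIV. mat (A $ i $ j) ** unit_mat i j)"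
    using matrix_expansion[of A] by simp
  also have "\<dots> = (\<Sum>i\<in>UNIV. \<Sum>j\<in>UNIV. A $ i $ j * l (unit_mat i j))"
    by (simp add: sum scale)
  also have "\<dots> = (\<Sum>j\<in>UNIV. \<Sum>i\<in>UNIV. l (unit_mat i j) * A $ i $ j)"
    by (subst sum.swap) (simp add: mult.commute)
  finally show ?thesis by (simp add: trace_mult)
qed

text \<open>
  Dually to an isomorphism from \<open>E_bundle k B\<close> to \<open>E_bundle k 0\<close>, each rank-one element of the kernel at
  \<open>B = 0\<close> yields an element \<open>M\<close> of the kernel at \<open>B\<close>.  Moving \<open>S\<close> along lines confines the range
  of \<open>M\<close> to the line spanned by \<open>s\<close>; as \<open>M\<close> is a multiple of the identity on \<open>S\<close>, it vanishes there.
\<close>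

lemma iso_kernel_vanishes:
  fixes B :: "complex ^ 'n ^ 'n"
  assumes iso: "bundle_iso (Gr k) (E_bundle k B) (E_bundle k 0)" and k: "1 < k" "k + 1 < CARD('n)"
    and S0: "S0 \<in> grass k" and M0: "M0 \<in> KM B S0" and s0: "s0 \<in> S0"
  shows "M0 *v s0 = 0"
proof (rule ccontr)
  assume nz: "M0 *v s0 \<noteq> 0"
  let ?E = "E_bundle k B" and ?F = "E_bundle k (0 :: complex ^ 'n ^ 'n)"
  obtain \<Phi> \<Psi> where \<Phi>: "\<Phi> \<in> sec (hom_bundle (Gr k) ?E ?F) (grass k)"
    and \<Psi>: "\<Psi> \<in> sec (hom_bundle (Gr k) ?F ?E) (grass k)"
    and inv: "\<And>S e. S \<in> grass k \<Longrightarrow> e \<in> fib ?E S \<Longrightarrow> \<Psi> S (\<Phi> S e) = e"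
    using iso unfolding bundle_iso_def topspace_Gr by blast
  have U: "openin (topo (Gr k)) (grass k :: (complex ^ 'n) set set)"
    using openin_topspace[of "topo (Gr k)"] by (simp add: topspace_Gr)
  \<comment> \<open>The isomorphism turns each constant matrix \<open>A\<close> into a global
    section of the bundle at 0.\<close>
  define X where "X = (\<lambda>A S. \<Phi> S (trace_form k B A S))"
  have X_fib: "X A S \<in> fib ?F S" if "S \<in> grass k" for A S
    using \<Phi> trace_form_in_fib[OF that] that unfolding X_def hom_bundle_def Let_def by auto
  have X_add: "X (A + A') S = X A S + X A' S" if "S \<in> grass k" for A A' S
    using \<Phi> trace_form_in_fib[OF that] that unfolding X_def trace_form_add hom_bundle_def Let_def by auto
  have X_scale: "X (mat c ** A) S = (\<lambda>\<phi>. c * X A S \<phi>)" if "S \<in> grass k" for c A S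
    using \<Phi> trace_form_in_fib[OF that] that scl_E_bundle[of k 0 c]
    unfolding X_def trace_form_scale hom_bundle_def Let_def by auto
  have X_sec: "X A \<in> sec ?F (grass k)" for A
  proof -
    have "(\<lambda>S. \<Phi> S (s S)) \<in> sec ?F W" if "openin (topo (Gr k)) W" "W \<subseteq> grass k" "s \<in> sec ?E W"
      "\<forall>S\<in>W. s S \<in> fib ?E S" for W s
      using \<Phi> that by (simp add: hom_bundle_def Let_def)
    from this[OF U order_refl trace_form_section[OF U]] show ?thesis
      unfolding X_def using trace_form_in_fib by blast
  qed
  have X_zero: "X A S = 0" if S: "S \<in> grass k" and A: "\<And>M. M \<in> KM B S \<Longrightarrow> trace (M ** A) = 0" for A S
  proof -
    have tf: "trace_form k B A S = 0"
      using A by (auto simp: fun_eq_iff trace_form_def fib_E_dual)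
    have "trace_form k B 0 S = 0" by (simp add: fun_eq_iff trace_form_def trace_def)
    hence "X A S = X 0 S" by (simp add: X_def tf)
    also have "X 0 S = 0" using X_add[OF S, of 0 0] by simp
    finally show ?thesis .
  qed
  \<comment> \<open>On a fixed pure tensor \<open>X A S\<close> is linear in \<open>A\<close>, hence
    the trace pairing with this matrix: the transpose of the isomorphism applied to the
    tensor.\<close>
  define \<psi> where "\<psi> = (\<lambda>S s y. \<chi> i j. X (unit_mat j i) S ((*v) (outer s y)))"
  have X_trace: "X A S ((*v) (outer s y)) = trace (\<psi> S s y ** A)" if "S \<in> grass k" for A S s y
    unfolding \<psi>_def by (rule linear_form_matrix) (simp_all add: X_add[OF that] X_scale[OF that])
  \<comment> \<open>A double annihilator argument: \<open>\<psi> S s y\<close> pairs to zero with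
    every \<open>A\<close> that annihilates \<open>KM B S\<close>. The conditions defining
    \<open>KM B S\<close> are linear, and each is expressed by pairing with suitable matrices of
    this kind.\<close>
  have \<psi>_KM: "\<psi> S s y \<in> KM B S" if S: "S \<in> grass k" for S s y
  proof -
    obtain P where P: "P ** P = P" "range ((*v) P) = S" using S by (rule projection_exists)
    have PS: "P *v v = v" if "v \<in> S" for v using that range_projection[OF P(1)] P(2) by simp
    let ?M = "\<psi> S s y"
    have M_zero: "trace (?M ** A) = 0" if "\<And>M. M \<in> KM B S \<Longrightarrow> trace (M ** A) = 0" for A
      using X_trace[OF S, of A s y] X_zero[OF S that] by simp
    have 1: "(mat 1 - P) ** ?M = 0"
    proof (rule trace_mult_all_zero)
      fix Z :: "complex ^ 'n ^ 'n"
      have cyc: "trace (Z ** ((mat 1 - P) ** M)) = trace (M ** (Z ** (mat 1 - P)))" for M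
        using trace_mul_sym[of M "Z ** (mat 1 - P)"] by (simp add: matrix_mul_assoc)
      have "(mat 1 - P) ** M = 0" if "M \<in> KM B S" for M
        using that PS by (simp add: KM_def matrix_eq matrix_vector_mul_assoc[symmetric]
            matrix_vector_mult_diff_rdistrib)
      hence "trace (M ** (Z ** (mat 1 - P))) = 0" if "M \<in> KM B S" for M
        using that unfolding cyc[symmetric] by (simp add: trace_def)
      thus "trace (Z ** ((mat 1 - P) ** ?M)) = 0" unfolding cyc by (rule M_zero)
    qed
    have 2: "?M ** P + mat (trace (B ** ?M)) ** P = 0"
    proof (rule trace_mult_all_zero)
      fix Z :: "complex ^ 'n ^ 'n"
      \<comment> \<open>Obtained by moving \<open>M\<close> to the front under the trace; the scalar
        \<open>trace (B ** M)\<close> accounts for the multiple of \<open>B\<close>.\<close>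
      let ?A = "P ** Z + mat (trace (Z ** P)) ** B"
      have cyc: "trace (Z ** (M ** P + mat (trace (B ** M)) ** P)) = trace (M ** ?A)" for M
        using trace_mul_sym[of "M ** P" Z] trace_mul_sym[of M B]
        by (simp add: matrix_add_ldistrib trace_add mat_mult_assoc_right trace_mat_mult mult.commute)
          (simp add: matrix_mul_assoc)
      have "M ** P + mat (trace (B ** M)) ** P = 0" if "M \<in> KM B S" for M
        using that P(2) by (auto simp: KM_def matrix_eq matrix_vector_mul_assoc[symmetric]
            matrix_vector_mult_add_rdistrib)
      hence "trace (M ** ?A) = 0" if "M \<in> KM B S" for M
        using that unfolding cyc[symmetric] by (simp add: trace_def)
      thus "trace (Z ** (?M ** P + mat (trace (B ** ?M)) ** P)) = 0" unfolding cyc by (rule M_zero)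
    qed
    have "?M *v v \<in> S" for v
    proof -
      have "(mat 1 - P) *v (?M *v v) = 0" using 1 by (simp add: matrix_vector_mul_assoc)
      hence "?M *v v = P *v (?M *v v)" by (simp add: matrix_vector_mult_diff_rdistrib)
      thus ?thesis using P(2) by (metis rangeI)
    qed
    moreover have "?M *v t + trace (B ** ?M) *s t = 0" if "t \<in> S" for t
    proof -
      have "(?M ** P + mat (trace (B ** ?M)) ** P) *v t = 0" unfolding 2 by simp
      thus ?thesis using PS[OF that]
        by (simp add: matrix_vector_mult_add_rdistrib matrix_vector_mul_assoc[symmetric])
    qed
    ultimately show ?thesis by (simp add: KM_def)
  qed
  have \<psi>_vanish: "\<psi> S s y *v w = 0"
    if S: "S \<in> grass k" and s: "s \<in> S" "s \<noteq> 0" and y: "\<And>v. v \<in> S \<Longrightarrow> lin y v = 0" and w: "w \<in> S" for S s y w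
  proof -
    have sub: "vec.subspace S" and dim: "vec.dim S = k" using S by (auto simp: grass_def)
    \<comment> \<open>Otherwise some \<open>?x\<close> in the range extends together with
      \<open>s\<close> to a basis of \<open>S\<close>. Exchanging \<open>?x\<close> for
      \<open>b\<close> gives \<open>S'\<close>, which contains \<open>s\<close>, is killed by
      \<open>y\<close> and omits \<open>?x\<close>; yet the matrix is the same over \<open>S\<close>
      and \<open>S'\<close>.\<close>
    have range: "\<psi> S s y *v v \<in> vec.span {s}" for v
    proof (rule ccontr)
      let ?x = "\<psi> S s y *v v"
      assume nin: "?x \<notin> vec.span {s}"
      have xs: "?x \<noteq> s" using nin vec.span_base by force
      have xS: "?x \<in> S" using \<psi>_KM[OF S] by (simp add: KM_def)
      have "vec.independent {?x, s}" using s(2) nin by (simp add: vec.independent_insert vec.span_empty)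
      moreover have "{?x, s} \<subseteq> S" using xS s(1) by simp
      ultimately obtain V where V: "{?x, s} \<subseteq> V" "V \<subseteq> S" "vec.independent V" "S \<subseteq> vec.span V"
        using vec.maximal_independent_subset_extend by metis
      have spanV: "vec.span V = S" using V sub vec.span_minimal by blast
      have fin: "finite V" using V(3) by (rule vec.finiteI_independent)
      have card: "card V = k" using vec.dim_eq_card_independent[OF V(3)] spanV dim by (metis vec.dim_span)
      define W where "W = V - {?x}"
      have VW: "V = insert ?x W" "?x \<notin> W" using V(1) by (auto simp: W_def)
      have cW: "card W + 1 = k" using card fin VW by (metis Suc_eq_plus1 card_insert_disjoint finite_insert)
      obtain b where b: "b \<notin> S" "lin y b = 0" using exists_in_kernel_notin[OF S k(2)] by blast
      have bV: "b \<notin> vec.span V" using b(1) spanV by simp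
      have bW: "b \<notin> W" "?x \<noteq> b" using b(1) V(2) VW(1) xS by auto
      have ind: "vec.independent (insert ?x (insert b W))"
        using vec.independent_insertI[OF bV V(3)] VW(1) by (simp add: insert_commute)
      define S' where "S' = vec.span (insert b W)"
      have "vec.independent (insert b W)" using ind vec.independent_mono by blast
      moreover have "card (insert b W) = k" using cW bW fin W_def by simp
      ultimately have S': "S' \<in> grass k" unfolding S'_def by (rule span_in_grass)
      have sW: "s \<in> vec.span W" using V(1) xs by (auto simp: W_def intro: vec.span_base)
      have yW: "lin y z = 0" if "z \<in> insert ?x (insert b W)" for z
        using that b(2) y V(2) VW(1) xS by auto
      have "X A S ((*v) (outer s y)) = X A S' ((*v) (outer s y))" for A
        using line_constant[OF ind bW(2) VW(2) bW(1) cW X_sec sW yW] VW(1) spanV by (simp add: S'_def)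
      hence "\<psi> S s y = \<psi> S' s y" by (simp add: \<psi>_def)
      hence "?x \<in> S'" using \<psi>_KM[OF S'] by (simp add: KM_def)
      hence "?x \<in> vec.span (insert ?x (insert b W) - {?x})"
        unfolding S'_def using vec.span_mono[of "insert b W" "insert ?x (insert b W) - {?x}"] bW VW(2) by auto
      thus False using ind unfolding vec.dependent_def by blast
    qed
    have "\<exists>t\<in>S. t \<notin> vec.span {s}"
    proof (rule ccontr)
      assume "\<not> ?thesis"
      hence "S \<subseteq> vec.span {s}" by blast
      hence "vec.dim S \<le> card {s}" by (rule vec.dim_le_card) simp
      thus False using dim k by simp
    qed
    then obtain t where t: "t \<in> S" "t \<notin> vec.span {s}" by blast
    let ?c = "trace (B ** \<psi> S s y)"
    have eq: "\<psi> S s y *v z = - (?c *s z)" if "z \<in> S" for z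
      using \<psi>_KM[OF S, of s y] that by (simp add: KM_def eq_neg_iff_add_eq_0)
    have "?c = 0"
    proof (rule ccontr)
      assume c: "?c \<noteq> 0"
      have "?c *s t \<in> vec.span {s}" using range[of t] vec.span_neg unfolding eq[OF t(1)] by force
      hence "inverse ?c *s (?c *s t) \<in> vec.span {s}" by (rule vec.span_scale)
      thus False using c t(2) by simp
    qed
    thus ?thesis using eq[OF w] by simp
  qed
  obtain i where i: "(M0 *v s0) $ i \<noteq> 0" using nz by (auto simp: vec_eq_iff)
  \<comment> \<open>With this choice \<open>trace (M ** A)\<close> is the \<open>i\<close>-th
    coordinate of \<open>M *v s0\<close>, so it detects \<open>M0\<close> but vanishes on matrices
    that kill \<open>s0\<close>.\<close>
  define A where "A = outer s0 (axis i 1)"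
  obtain P where P: "P ** P = P" "range ((*v) P) = S0" using S0 by (rule projection_exists)
  have XF: "X A S0 \<in> fib ?F S0" by (rule X_fib[OF S0])
  have gen: "X A S0 ((*v) (P ** unit_mat l m ** (mat 1 - P))) = 0" for l m
  proof -
    let ?s = "P *v axis l 1"
    define y where "y = (mat 1 - P) $ m"
    have ly: "lin y v = ((mat 1 - P) *v v) $ m" for v
      by (simp add: y_def lin_def matrix_vector_mult_def)
    have "unit_mat l m = outer (axis l 1) (axis m 1)"
      by (auto simp: vec_eq_iff unit_mat_nth outer_def axis_def)
    hence "unit_mat l m *v v = v $ m *s axis l 1" for v :: "complex ^ 'n"
      by (simp add: outer_mv)
    hence eq: "P ** unit_mat l m ** (mat 1 - P) = outer ?s y"
      by (simp add: matrix_eq matrix_vector_mul_assoc[symmetric] outer_mv ly vec.scale)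
    \<comment> \<open>\<open>\<psi>_vanish\<close> asks for a nonzero vector; if
      \<open>?s = 0\<close> the tensor is zero and linearity suffices.\<close>
    have "trace (\<psi> S0 ?s y ** A) = 0"
    proof (cases "?s = 0")
      case True
      hence "outer ?s y = outer (0 :: complex ^ 'n) y" by simp
      also have "\<dots> = mat 0 ** outer 0 y" by (simp add: vec_eq_iff outer_def)
      finally have o: "outer ?s y = mat 0 ** outer 0 y" .
      have "outer 0 y \<in> KM 0 S0" using S0 by (auto simp: KM_zero K0_def outer_mv grass_def vec.subspace_0)
      moreover have "\<forall>c. \<forall>M\<in>KM 0 S0. X A S0 ((*v) (mat c ** M)) = c * X A S0 ((*v) M)"
        using XF unfolding fib_E_bundle by blast
      ultimately have "X A S0 ((*v) (outer ?s y)) = 0 * X A S0 ((*v) (outer 0 y))"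
        unfolding o by blast
      thus ?thesis by (simp add: X_trace[OF S0])
    next
      case False
      have "?s \<in> S0" using P(2) by auto
      moreover have "lin y v = 0" if "v \<in> S0" for v
        using that range_projection[OF P(1)] P(2) by (simp add: ly matrix_vector_mult_diff_rdistrib)
      ultimately have "\<psi> S0 ?s y *v s0 = 0" using \<psi>_vanish[OF S0 _ False _ s0] by blast
      thus ?thesis by (simp add: A_def trace_mult_outer)
    qed
    thus ?thesis by (simp add: eq X_trace[OF S0])
  qed
  \<comment> \<open>The sandwiched units determine the functional, so \<open>X A S0\<close> is zero.
    The inverse on the fibre then makes \<open>trace_form k B A S0\<close> zero, which
    \<open>M0\<close> contradicts.\<close>
  have "X A S0 = trace_form k 0 (\<chi> j i. X A S0 ((*v) (P ** unit_mat i j ** (mat 1 - P)))) S0"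
    by (rule fib_E_bundle_trace_form[OF S0 KM_zero XF P])
  also have "\<dots> = 0" by (simp add: gen fun_eq_iff trace_form_def trace_mult)
  finally have "X A S0 = X 0 S0" using X_add[OF S0, of 0 0] by simp
  hence "trace_form k B A S0 = trace_form k B 0 S0"
    using inv[OF S0 trace_form_in_fib[OF S0]] unfolding X_def by metis
  hence "trace (M0 ** A) = trace (M0 ** 0)" using M0 by (metis trace_form_mv)
  thus False using i by (simp add: A_def trace_mult_outer trace_def[of 0])
qed

text \<open>If \<open>B s\<close> lies outside \<open>S\<close>, some functional vanishes on
  \<open>S\<close> but not at \<open>B s\<close>. A multiple of its tensor with \<open>s\<close>
  corrects \<open>- P\<close> to an element of the kernel without changing it on \<open>S\<close>,
  where it acts as -1; but elements of the kernel vanish there.\<close>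

lemma iso_preserves:
  fixes B :: "complex ^ 'n ^ 'n"
  assumes iso: "bundle_iso (Gr k) (E_bundle k B) (E_bundle k 0)" and k: "1 < k" "k + 1 < CARD('n)"
    and S: "S \<in> grass k" and s: "s \<in> S"
  shows "B *v s \<in> S"
proof (rule ccontr)
  assume nin: "B *v s \<notin> S"
  have sub: "vec.subspace S" using S by (simp add: grass_def)
  obtain P where P: "P ** P = P" "range ((*v) P) = S" using S by (rule projection_exists)
  have PS: "P *v v = v \<longleftrightarrow> v \<in> S" for v using range_projection[OF P(1)] P(2) by simp
  have "(mat 1 - P) *v (B *v s) \<noteq> 0"
    using nin PS[of "B *v s"] by (auto simp: matrix_vector_mult_diff_rdistrib)
  then obtain i where i: "((mat 1 - P) *v (B *v s)) $ i \<noteq> 0" by (auto simp: vec_eq_iff)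
  define y where "y = (\<chi> j. (mat 1 - P) $ i $ j)"
  have ly: "lin y v = ((mat 1 - P) *v v) $ i" for v
    by (simp add: lin_def y_def matrix_vector_mult_def)
  \<comment> \<open>Solves \<open>trace (B ** M) = 1\<close>, the value the kernel condition demands
    of a matrix acting as -1 on \<open>S\<close>.\<close>
  define c where "c = (1 + trace (B ** P)) / lin y (B *v s)"
  define M where "M = mat c ** outer s y - P"
  have tr: "trace (B ** M) = 1"
    using i by (simp add: M_def matrix_mult_diff_right trace_sub mat_mult_assoc_right trace_mat_mult
        trace_mult_outer c_def ly)
  have Mv: "M *v v = (c * lin y v) *s s - P *v v" for v
    by (simp add: M_def matrix_vector_mult_diff_rdistrib mat_mult_mv outer_mv)
  have y0: "lin y v = 0" if "v \<in> S" for v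
  proof -
    have "P *v v = v" using that PS by simp
    thus ?thesis by (simp add: ly matrix_vector_mult_diff_rdistrib)
  qed
  have Pt: "P *v t = t" if "t \<in> S" for t using PS that by simp
  have "P *v v \<in> S" for v using P(2) by auto
  hence "M \<in> KM B S"
    using sub s y0 Pt by (simp add: KM_def tr Mv vec.subspace_diff vec.subspace_scale)
  hence "M *v s = 0" by (rule iso_kernel_vanishes[OF iso k S _ s])
  hence "s = 0" using y0[OF s] PS[of s] s by (simp add: Mv)
  thus False using nin sub by (simp add: vec.subspace_0)
qed

theorem theorem4p2:
  fixes k :: nat and B :: "complex ^ 'n ^ 'n"
  assumes "1 < k" and "k < CARD('n) - 1"
    and "B \<notin> degenerate_locus k"
  shows "bundle_iso (Gr k) (E_bundle k B) (tangent_bundle (Gr k))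
     \<longleftrightarrow> (\<exists>\<epsilon>::complex. \<epsilon> \<noteq> - 1 / of_nat k \<and> B = mat \<epsilon>)"
proof
  have \<epsilon>_iff: "1 + of_nat k * \<epsilon> = 0 \<longleftrightarrow> \<epsilon> = - 1 / of_nat k" for \<epsilon> :: complex
    using assms(1) by (simp add: field_simps eq_neg_iff_add_eq_0)
  {
    assume iso: "bundle_iso (Gr k) (E_bundle k B) (tangent_bundle (Gr k))"
    \<comment> \<open>The bundle at 0 stands in for the tangent bundle, so the rest of this
      direction deals with matrices instead of derivations.\<close>
    have "bundle_iso (Gr k) (E_bundle k (0 :: complex ^ 'n ^ 'n)) (tangent_bundle (Gr k))"
      by (rule E_bundle_iso_tangent_bundle[OF KM_zero])
    hence iso0: "bundle_iso (Gr k) (E_bundle k B) (E_bundle k 0)"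
      by (rule bundle_iso_trans[OF iso bundle_iso_sym])
    have "\<exists>\<epsilon>. B = mat \<epsilon>"
      by (rule preserves_grass_scalar[of k]) (use assms(1,2) iso_preserves[OF iso0] in auto)
    then obtain \<epsilon> where \<epsilon>: "B = mat \<epsilon>" ..
    have "k \<le> CARD('n)" using assms(2) by linarith
    then obtain S :: "(complex ^ 'n) set" where "S \<in> grass k" using grass_nonempty by blast
    \<comment> \<open>Here nondegeneracy of \<open>B\<close> rules out the exceptional scalar, for
      which the identity of \<open>S\<close> is not attained.\<close>
    hence "\<epsilon> \<noteq> - 1 / of_nat k"
      using mat_degenerate[of S k \<epsilon>] assms(1,3) \<epsilon>_iff[of \<epsilon>] \<epsilon> by auto
    thus "\<exists>\<epsilon>. \<epsilon> \<noteq> - 1 / of_nat k \<and> B = mat \<epsilon>" using \<epsilon> by blast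
  next
    assume "\<exists>\<epsilon>. \<epsilon> \<noteq> - 1 / of_nat k \<and> B = mat \<epsilon>"
    then obtain \<epsilon> where \<epsilon>: "1 + of_nat k * \<epsilon> \<noteq> 0" "B = mat \<epsilon>" using \<epsilon>_iff by blast
    show "bundle_iso (Gr k) (E_bundle k B) (tangent_bundle (Gr k))"
      by (rule E_bundle_iso_tangent_bundle) (use KM_mat[OF _ \<epsilon>(1)] \<epsilon>(2) in simp)
  }
qed

end
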